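(* Suppose $A$ is an $m \times n$ standardized matrix. With probability at least $3/4$, the algorithm BT (written out in the context), applied to $A$, produces a set $\tau = \tau_\star$ of column indices for which $$|\tau| \geq \mathrm{c}\cdot \operatorname{st.rank}(A) \quad\text{and}\quad \kappa(A_\tau) \leq \sqrt{3},$$ where $\mathrm c$ is a positive, universal constant. The computational cost is bounded by $\widetilde{\mathrm O}(|\tau|^2 m + |\tau|^{3.5})$.
   Context: Matrices are real or complex. A matrix is standardized when its columns have unit $\ell_2$ norm. $\|\cdot\|$ is the spectral norm, $\|\cdot\|_{\mathrm F}$ is the Frobenius norm, and $\operatorname{st.rank}(A) = \|A\|_{\mathrm F}^2/\|A\|^2$ is the stable rank. For a set $\tau$ of column indices, $A_\tau$ is the column submatrix of $A$ indexed by $\tau$. The condition number is $\kappa(A) = \max\{ \|Ax\|_2/\|Ay\|_2 : \|x\|_2 = \|y\|_2 = 1\}$. $\lambda_{\max}$ is the algebraically maximal eigenvalue of a Hermitian matrix, $A^*$ is the conjugate transpose, $\mathrm I$ is the identity, and the pseudoinverse $D^\dagger$ of a diagonal matrix $D$ is formed by reciprocating its nonzero entries. The tilde in $\widetilde{\mathrm O}$ indicates that log-like factors are suppressed. Algorithm BT. Input: a standardized matrix $A$ with $n$ columns. Output: a subset $\tau_\star$ of $\{1,\dots,n\}$. Set $\tau_\star = \{1\}$. For $s = 4, 8, 16, \dots, n$ do the following: (a) for $k = 1, 2, 3, \dots, 8\log_2 s$: set $\tau = \text{Cond-Reduce}(A,s)$; if $\kappa(A_\tau) \leq \sqrt{3}$,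 then set $\tau_\star = \tau$ and break out of the loop over $k$; (b) if $|\tau_\star| < s/2$, then exit. Subroutine Cond-Reduce$(A,s)$: (i) Draw a uniformly random set $\sigma$ with cardinality $s$ from $\{1,\dots,n\}$. (ii) With $G = A_\sigma^* A_\sigma - \mathrm I$ and $\alpha = s/4$, solve the convex program $$\min\ \lambda_{\max}\begin{bmatrix} -\alpha F & G \\ G & -\alpha F \end{bmatrix} \quad\text{subject to}\quad \operatorname{trace}(F)=1,\ F \text{ diagonal},\ F \geq 0$$ to obtain a factorization $G = DTD$ with $D$ nonnegative, diagonal and $\operatorname{trace}(D^2)=1$. Namely, from a feasible $F$ with nonpositive objective value take $D = F^{1/2}$ and $T = D^\dagger G D^\dagger$, so that $\|T\| \le \alpha$; from a feasible $F$ with positive objective value $\eta$ take instead $D = \widetilde F^{1/2}$ with $\widetilde F = (\alpha F + \eta\,\mathrm I)/(\alpha+\eta s)$ and $T = D^{-1}GD^{-1}$, so that $\|T\| \le \alpha+\eta s$. (iii) Return $\tau = \{ j \in \sigma : d_{jj}^2 \leq 2/s \}$, where the diagonal entries $d_{jj}$ of $D$ are indexed by $\sigma$. For the cost bound, forming $G$ costs at most $\mathrm O(s^2 m)$, and the optimization is carried out by an interior-point method for semidefinite programming at cost $\widetilde{\mathrm O}(s^{3.5})$. *)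

theory Defs
  imports
    "HOL-Probability.Probability_Mass_Function"
    "HOL-Library.Monad_Syntax"
    "Jordan_Normal_Form.Schur_Decomposition"
    "Jordan_Normal_Form.DL_Submatrix"
begin

text \<open>Matrices are those of Jordan_Normal_Form, so that the dimensions are ordinary natural
  numbers.  The scalars are any type that has both a norm and a conjugation; the theorem uses
  the two instances \<^typ>\<open>real\<close> (where \<^const>\<open>conjugate\<close> is the identity) and \<^typ>\<open>complex\<close>.
  Columns are numbered from 0.\<close>

hide_const (open) Finite_Cartesian_Product.vec Finite_Cartesian_Product.mat
  Finite_Cartesian_Product.row Finite_Cartesian_Product.column
hide_const (open) Determinants.trace
unbundle no vec_syntax

section \<open>Norms and related quantities\<close>

definition l2_norm :: "'a::real_normed_vector vec \<Rightarrow> real" where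
  "l2_norm v = L2_set (\<lambda>i. norm (v $ i)) {..<dim_vec v}"

definition unit_sphere :: "nat \<Rightarrow> 'a::real_normed_vector vec set" where
  "unit_sphere n = {x \<in> carrier_vec n. l2_norm x = 1}"

definition spectral_norm :: "'a::real_normed_field mat \<Rightarrow> real" where
  "spectral_norm A = (SUP x\<in>unit_sphere (dim_col A). l2_norm (A *\<^sub>v x))"

definition frobenius_norm :: "'a::real_normed_field mat \<Rightarrow> real" where
  "frobenius_norm A =
     L2_set (\<lambda>(i, j). norm (A $$ (i, j))) ({..<dim_row A} \<times> {..<dim_col A})"

definition stable_rank :: "'a::real_normed_field mat \<Rightarrow> real" where
  "stable_rank A = (frobenius_norm A)\<^sup>2 / (spectral_norm A)\<^sup>2"

definition standardized :: "'a::real_normed_field mat \<Rightarrow> bool" where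
  "standardized A \<longleftrightarrow> (\<forall>j<dim_col A. l2_norm (col A j) = 1)"

text \<open>The condition number is extended-real valued: on \<^typ>\<open>ennreal\<close> one has
  \<open>a / 0 = \<infinity>\<close> for \<open>a > 0\<close>, so a matrix with linearly dependent columns
  (and some nonzero column) has condition number \<open>\<infinity>\<close>.\<close>

definition cond_number :: "'a::real_normed_field mat \<Rightarrow> ennreal" where
  "cond_number A =
     (SUP x\<in>unit_sphere (dim_col A). SUP y\<in>unit_sphere (dim_col A).
        ennreal (l2_norm (A *\<^sub>v x)) / ennreal (l2_norm (A *\<^sub>v y)))"

abbreviation column_submatrix :: "'a mat \<Rightarrow> nat set \<Rightarrow> 'a mat" where
  "column_submatrix A \<tau> \<equiv> submatrix A UNIV \<tau>"

definition lambda_max :: "'a::real_normed_field mat \<Rightarrow> real" where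
  "lambda_max M = Max {r. eigenvalue M (of_real r)}"

definition mat_trace :: "'a::comm_monoid_add mat \<Rightarrow> 'a" where
  "mat_trace M = (\<Sum>i<dim_row M. M $$ (i, i))"

section \<open>The convex program and the factorization extracted from it\<close>

definition gram_minus_id :: "'a::{conjugatable_field, real_normed_field} mat \<Rightarrow> 'a mat" where
  "gram_minus_id B = mat_adjoint B * B - 1\<^sub>m (dim_col B)"

text \<open>In the definitions below \<open>G\<close> is \<open>s\<close> by \<open>s\<close> and \<open>alpha = s / 4\<close>.  The variable \<open>F\<close> is a
  real matrix over either scalar field, because a diagonal \<open>F \<ge> 0\<close> has real entries.\<close>

definition program_alpha :: "'a mat \<Rightarrow> real" where
  "program_alpha G = real (dim_row G) / 4"

definition program_objective :: "'a::real_normed_field mat \<Rightarrow> real mat \<Rightarrow> real" where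
  "program_objective G F =
     (let E = map_mat of_real (- program_alpha G \<cdot>\<^sub>m F)
      in lambda_max (four_block_mat E G G E))"

definition program_feasible :: "nat \<Rightarrow> real mat \<Rightarrow> bool" where
  "program_feasible s F \<longleftrightarrow>
     F \<in> carrier_mat s s \<and> mat_trace F = 1 \<and> diagonal_mat F \<and> (\<forall>i<s. 0 \<le> F $$ (i, i))"

text \<open>Feasible and optimal up to the additive error \<open>\<epsilon>\<close> (\<open>\<epsilon> = 0\<close> is an exact minimizer).\<close>

definition program_solution ::
    "real \<Rightarrow> 'a::real_normed_field mat \<Rightarrow> real mat \<Rightarrow> bool" where
  "program_solution \<epsilon> G F \<longleftrightarrow>
     program_feasible (dim_row G) F \<and>
     (\<forall>F'. program_feasible (dim_row G) F' \<longrightarrow>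
        program_objective G F \<le> program_objective G F' + \<epsilon>)"

text \<open>The square root and the pseudoinverse of a diagonal matrix are taken entrywise;
  \<open>sqrt 0 = 0\<close> and \<open>inverse 0 = 0\<close> leave the zero entries unchanged.  When \<open>\<eta> > 0\<close> all
  diagonal entries of \<open>D\<close> are positive, so there the pseudoinverse is the inverse.\<close>

definition factorization ::
    "'a::real_normed_field mat \<Rightarrow> real mat \<Rightarrow> real mat \<times> 'a mat" where
  "factorization G F =
     (let s = dim_row G;
          \<alpha> = program_alpha G;
          \<eta> = program_objective G F;
          F' = (if \<eta> \<le> 0 then F
                else (1 / (\<alpha> + \<eta> * real s)) \<cdot>\<^sub>m (\<alpha> \<cdot>\<^sub>m F + \<eta> \<cdot>\<^sub>m 1\<^sub>m s));
          D = map_mat sqrt F';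
          D_pinv = map_mat of_real (map_mat inverse D)
      in (D, D_pinv * G * D_pinv))"

section \<open>The algorithm, instrumented with an operation count\<close>

text \<open>The solver of the convex program, together with the number of operations spent on each
  step of the algorithm: drawing an \<open>s\<close>-subset of \<open>n\<close> indices, forming \<open>G\<close> from \<open>A\<^sub>\<sigma>\<close>, solving
  the program for \<open>G\<close>, extracting the factorization and the selected indices from the solution,
  and testing \<open>\<kappa>(A\<^sub>\<tau>) \<le> \<surd>3\<close> for a given \<open>A\<^sub>\<tau>\<close>.\<close>

record 'a bt_steps =
  solver :: "'a mat \<Rightarrow> real mat"
  draw_ops :: "nat \<Rightarrow> nat \<Rightarrow> nat"
  gram_ops :: "'a mat \<Rightarrow> nat"
  solver_ops :: "'a mat \<Rightarrow> nat"
  extract_ops :: "'a mat \<Rightarrow> nat"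
  test_ops :: "'a mat \<Rightarrow> nat"

text \<open>All programs (and all test matrices) that the algorithm meets come from standardized
  matrices, hence nothing is required of the steps elsewhere.\<close>

definition solver_accuracy ::
    "real \<Rightarrow> 'a::{conjugatable_field, real_normed_field} bt_steps \<Rightarrow> bool" where
  "solver_accuracy \<epsilon> S \<longleftrightarrow>
     (\<forall>B. standardized B \<and> 0 < dim_col B \<longrightarrow>
        program_solution \<epsilon> (gram_minus_id B) (solver S (gram_minus_id B)))"

definition step_costs ::
    "real \<Rightarrow> nat \<Rightarrow> 'a::{conjugatable_field, real_normed_field} bt_steps \<Rightarrow> bool" where
  "step_costs K p S \<longleftrightarrow>
     (\<forall>n s. 0 < s \<and> s \<le> n \<longrightarrow>
        real (draw_ops S s n) \<le> K * real s * (1 + log 2 (real s)) ^ p) \<and>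
     (\<forall>B. standardized B \<and> 0 < dim_col B \<longrightarrow>
        (let m = real (dim_row B); s = real (dim_col B); L = (1 + log 2 s) ^ p;
             G = gram_minus_id B
         in real (gram_ops S B) \<le> K * s\<^sup>2 * m \<and>
            real (solver_ops S G) \<le> K * s powr (7 / 2) * L \<and>
            real (extract_ops S G) \<le> K * s ^ 3 * L \<and>
            real (test_ops S B) \<le> K * (s\<^sup>2 * m + s ^ 3) * L))"

text \<open>The \<open>i\<close>-th column of \<open>column_submatrix A \<sigma>\<close> is column \<open>pick \<sigma> i\<close> of \<open>A\<close>, so \<open>pick \<sigma>\<close>
  translates row and column numbers of \<open>D\<close> back to elements of \<open>\<sigma>\<close>.\<close>

definition cond_reduce ::
    "'a::{conjugatable_field, real_normed_field} bt_steps \<Rightarrow> 'a mat \<Rightarrow> nat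
      \<Rightarrow> (nat set \<times> nat) pmf" where
  "cond_reduce S A s = do {
     \<sigma> \<leftarrow> pmf_of_set {\<sigma>. \<sigma> \<subseteq> {..<dim_col A} \<and> card \<sigma> = s};
     let B = column_submatrix A \<sigma>;
     let G = gram_minus_id B;
     let (D, T) = factorization G (solver S G);
     return_pmf
       ({pick \<sigma> i | i. i < s \<and> (D $$ (i, i))\<^sup>2 \<le> 2 / real s},
        draw_ops S s (dim_col A) + gram_ops S B + solver_ops S G + extract_ops S G)
   }"

text \<open>The loop over \<open>k\<close>: the second argument is the number of iterations left and the last one
  the current \<open>\<tau>\<^sub>0\<close>.  The second component of the result is the number of operations.\<close>

primrec bt_attempts ::
    "'a::{conjugatable_field, real_normed_field} bt_steps \<Rightarrow> nat \<Rightarrow> 'a mat \<Rightarrow> nat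
      \<Rightarrow> nat set \<Rightarrow> (nat set \<times> nat) pmf" where
  "bt_attempts S 0 A s \<tau>\<^sub>0 = return_pmf (\<tau>\<^sub>0, 0)"
| "bt_attempts S (Suc k) A s \<tau>\<^sub>0 = do {
     (\<tau>, c) \<leftarrow> cond_reduce S A s;
     let c' = c + test_ops S (column_submatrix A \<tau>);
     if cond_number (column_submatrix A \<tau>) \<le> ennreal (sqrt 3)
     then return_pmf (\<tau>, c')
     else map_pmf (\<lambda>(\<tau>', c''). (\<tau>', c' + c'')) (bt_attempts S k A s \<tau>\<^sub>0)
   }"

primrec bt_rounds ::
    "'a::{conjugatable_field, real_normed_field} bt_steps \<Rightarrow> 'a mat \<Rightarrow> nat list
      \<Rightarrow> nat set \<Rightarrow> (nat set \<times> nat) pmf" where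
  "bt_rounds S A [] \<tau>\<^sub>0 = return_pmf (\<tau>\<^sub>0, 0)"
| "bt_rounds S A (s # ss) \<tau>\<^sub>0 = do {
     (\<tau>, c) \<leftarrow> bt_attempts S (nat \<lfloor>8 * log 2 (real s)\<rfloor>) A s \<tau>\<^sub>0;
     if real (card \<tau>) < real s / 2
     then return_pmf (\<tau>, c)
     else map_pmf (\<lambda>(\<tau>', c'). (\<tau>', c + c')) (bt_rounds S A ss \<tau>)
   }"

text \<open>The values \<open>s = 4, 8, 16, \<dots>\<close> are the powers of two that do not exceed \<open>n\<close>.  The floor
  above is harmless, since it is applied to an integer.\<close>

definition algorithm_BT ::
    "'a::{conjugatable_field, real_normed_field} bt_steps \<Rightarrow> 'a mat
      \<Rightarrow> (nat set \<times> nat) pmf" where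
  "algorithm_BT S A =
     bt_rounds S A (filter (\<lambda>s. s \<le> dim_col A) (map (\<lambda>j. 2 ^ j) [2..<Suc (dim_col A)])) {0}"

text \<open>The first component of \<open>algorithm_BT S A\<close> is the output set, the second the total
  operation count of the run that produced it.\<close>

end

theory Submission
  imports Defs "Jordan_Normal_Form.Spectral_Radius"
begin

text \<open>Write \<open>k\<close> for the squared spectral norm of \<open>A\<close>, so that the stable rank of a standardized
  matrix with \<open>n\<close> columns is \<open>n / k\<close>, and let \<open>G\<close> be the Gram matrix of a random set \<open>\<sigma>\<close> of
  \<open>s\<close> columns minus the identity.  Everything rests on one fact: if \<open>s\<close> is at most a small
  constant times \<open>n / k\<close>, then with probability at least \<open>1 / 2\<close> there are weights \<open>w \<ge> 0\<close> on
  \<open>\<sigma>\<close> of total mass at most \<open>s / 8\<close> such that \<open>\<bar>x\<^sup>* G x\<bar> \<le> (\<Sum>i. w i * \<bar>x i\<bar>\<^sup>2)\<close> for all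
  \<open>x\<close>.  Adding a multiple of the identity to \<open>w\<close> and rescaling to trace one gives a feasible \<open>F\<close>
  whose objective is at most \<open>- 1 / 8\<close>, so a solver with additive error \<open>1 / 8\<close> finds a
  nonpositive objective value.  Nonpositivity means \<open>\<bar>x\<^sup>* G x\<bar> \<le> (s / 4) x\<^sup>* F x\<close>; on the indices
  where \<open>F\<close> is at most \<open>2 / s\<close>, which are at least half of \<open>\<sigma>\<close> because \<open>F\<close> has trace one, the
  right side is at most half the squared norm of \<open>x\<close>.  There the squared singular values lie
  between \<open>1 / 2\<close> and \<open>3 / 2\<close>, whence the condition number \<open>\<surd>3\<close>.

  The existence of the weights is usually derived from Grothendieck's inequality and an estimate of
  a random \<open>\<infinity>\<close>-to-\<open>1\<close> norm.  Here the weights are built directly, by a barrier argument in the style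
  of Batson, Spielman and Srivastava that treats \<open>G \<le> W\<close> and \<open>- G \<le> W\<close> separately.  The
  columns of \<open>\<sigma>\<close> are added one at a time and a matrix \<open>Q = \<mu> E - I \<plusminus> G\<close> with diagonal \<open>E\<close> is
  kept positive.  When the column \<open>c\<close> joins, with correlations \<open>b\<close> to the previous columns,
  the new entry of \<open>E\<close> is \<open>1 + \<theta> + b\<^sup>* Q\<^sup>-\<^sup>1 b\<close>, which makes the Schur complement at least \<open>\<theta>\<close>.  The
  cost of this choice is controlled by the potential \<open>trace (E Q\<^sup>-\<^sup>1)\<close>: averaged over the
  unused columns, \<open>b b\<^sup>*\<close> is at most of the order \<open>k / n\<close> times the Gram matrix of \<open>\<sigma>\<close>, and that
  matrix is itself bounded by \<open>Q + 2 E\<close>.  The contribution of \<open>Q\<close> is of the size of the potential,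
  while the quadratic term caused by \<open>E\<close> is absorbed by raising \<open>\<mu>\<close> slightly in each step.
  One step is \<open>barrier_step\<close>, its average is \<open>attainable_step\<close>, and double counting of pairs of a
  set and one of its elements (\<open>sum_over_one_element_extensions\<close>) turns the step-by-step averages
  into the average over all \<open>s\<close>-sets, \<open>attainable_average\<close>.  Markov's inequality finishes the
  argument in \<open>few_not_dominated\<close>.

  For such \<open>s\<close>, the \<open>8 log\<^sub>2 s\<close> independent attempts of the algorithm all fail with probability at most \<open>s\<close> to the power
  \<open>- 8\<close>, and these bounds sum to less than \<open>1 / 4\<close> over the powers of two.  On every run the last
  round has \<open>s \<le> 4 \<bar>\<tau>\<bar>\<close>, and the round costs grow geometrically, so the total cost is of the order
  of the cost of a round at \<open>4 \<bar>\<tau>\<bar>\<close>.\<close>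

section \<open>Scalars\<close>

text \<open>Both scalar fields of the theorem are covered at once.  The single axiom makes the conjugation
  isometric and \<open>x + conjugate x\<close> real, which is all that Hermitian forms need.\<close>

class rc_scalar = conjugatable_field + real_normed_field +
  assumes conjugate_mult_self_scaleR: "conjugate x * x = scaleR ((norm x)\<^sup>2) 1"

instance real :: rc_scalar
  by standard (simp add: power2_eq_square)

instance complex :: rc_scalar
proof
  fix x :: complex
  show "conjugate x * x = ((norm x)\<^sup>2) *\<^sub>R 1"
    unfolding scaleR_conv_of_real complex_norm_square by simp
qed

lemma conjugate_mult_self: "conjugate x * x = of_real ((norm (x::'a::rc_scalar))\<^sup>2)"
  unfolding of_real_def by (rule conjugate_mult_self_scaleR)

text \<open>The real part, recovered from the norm by polarization.\<close>

definition re :: "'a::rc_scalar \<Rightarrow> real" where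
  "re x = ((norm (1 + x))\<^sup>2 - 1 - (norm x)\<^sup>2) / 2"

lemma conjugate_one [simp]: "conjugate (1::'a::rc_scalar) = 1"
  using conjugate_mult_self[of "1::'a"] by simp

lemma conjugate_diff: "conjugate (x - y :: 'a::rc_scalar) = conjugate x - conjugate y"
  by (metis conjugate_dist_add conjugate_neg diff_conv_add_uminus)

lemma of_real_re: "of_real (re x) = (x + conjugate x) / (2::'a::rc_scalar)"
proof -
  have "of_real ((norm (1 + x))\<^sup>2) = conjugate (1 + x) * (1 + x)"
    by (simp add: conjugate_mult_self)
  also have "\<dots> = 1 + x + conjugate x + of_real ((norm x)\<^sup>2)"
    unfolding conjugate_dist_add conjugate_one conjugate_mult_self[symmetric] distrib_left
      distrib_right by simp
  finally show ?thesis by (simp add: re_def)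
qed

lemma conjugate_of_real [simp]: "conjugate (of_real r :: 'a::rc_scalar) = of_real r"
proof (cases "r = 0")
  case False
  have "conjugate (of_real r :: 'a) * of_real r = of_real r * of_real r"
    by (simp add: conjugate_mult_self power2_eq_square flip: of_real_mult)
  with False show ?thesis by simp
qed simp

lemma norm_conjugate [simp]: "norm (conjugate x :: 'a::rc_scalar) = norm x"
proof -
  have "(of_real ((norm (conjugate x))\<^sup>2) :: 'a) = of_real ((norm x)\<^sup>2)"
    using conjugate_mult_self[of x] conjugate_mult_self[of "conjugate x"]
    by (simp add: mult.commute)
  then have "(norm (conjugate x))\<^sup>2 = (norm x)\<^sup>2" unfolding of_real_eq_iff .
  then show ?thesis by (simp add: power2_eq_iff_nonneg)
qed

lemma re_eqI: "of_real r = (x + conjugate x) / (2::'a::rc_scalar) \<Longrightarrow> re x = r"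
  by (metis of_real_eq_iff of_real_re)

lemma re_add: "re (x + y :: 'a::rc_scalar) = re x + re y"
  by (rule re_eqI) (simp add: of_real_re conjugate_dist_add field_simps)

lemma re_diff: "re (x - y :: 'a::rc_scalar) = re x - re y"
  by (rule re_eqI) (simp add: of_real_re conjugate_diff field_simps)

lemma re_zero [simp]: "re (0::'a::rc_scalar) = 0"
  by (simp add: re_def)

lemma re_minus [simp]: "re (- x :: 'a::rc_scalar) = - re x"
  using re_diff[of 0 x] by simp

lemma re_sum: "re (sum f A :: 'a::rc_scalar) = (\<Sum>i\<in>A. re (f i))"
  by (induction A rule: infinite_finite_induct) (auto simp: re_add)

lemma re_conjugate [simp]: "re (conjugate x :: 'a::rc_scalar) = re x"
  by (rule re_eqI) (simp add: of_real_re add.commute)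

lemma re_of_real [simp]: "re (of_real r :: 'a::rc_scalar) = r"
  by (rule re_eqI) simp

lemma re_of_real_mult [simp]: "re (of_real r * x :: 'a::rc_scalar) = r * re x"
  by (rule re_eqI) (simp add: of_real_re conjugate_dist_mul field_simps)

lemma re_le_norm: "re (x :: 'a::rc_scalar) \<le> norm x"
proof -
  have "(norm (1 + x))\<^sup>2 \<le> (1 + norm x)\<^sup>2"
    using norm_triangle_ineq[of 1 x] by (intro power_mono) auto
  then show ?thesis by (simp add: re_def power2_eq_square algebra_simps)
qed

lemma re_conjugate_self [simp]: "re (conjugate x * x :: 'a::rc_scalar) = (norm x)\<^sup>2"
  unfolding conjugate_mult_self by (rule re_of_real)

section \<open>Hermitian kernels\<close>

text \<open>A Hermitian matrix is a kernel on a finite index set rather than a matrix of fixed dimension: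
  the barrier argument enlarges the index set by one element in each step, and restriction to subsets
  needs no renumbering.\<close>

definition kapply :: "nat set \<Rightarrow> (nat \<Rightarrow> nat \<Rightarrow> 'a::rc_scalar) \<Rightarrow> (nat \<Rightarrow> 'a) \<Rightarrow> nat \<Rightarrow> 'a" where
  "kapply S Q x i = (\<Sum>j\<in>S. Q i j * x j)"

definition sesq :: "nat set \<Rightarrow> (nat \<Rightarrow> 'a::rc_scalar) \<Rightarrow> (nat \<Rightarrow> 'a) \<Rightarrow> 'a" where
  "sesq S x y = (\<Sum>i\<in>S. conjugate (x i) * y i)"

definition qform :: "nat set \<Rightarrow> (nat \<Rightarrow> nat \<Rightarrow> 'a::rc_scalar) \<Rightarrow> (nat \<Rightarrow> 'a) \<Rightarrow> real" where
  "qform S Q x = re (sesq S x (kapply S Q x))"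

definition wnorm :: "nat set \<Rightarrow> (nat \<Rightarrow> real) \<Rightarrow> (nat \<Rightarrow> 'a::rc_scalar) \<Rightarrow> real" where
  "wnorm S e x = (\<Sum>i\<in>S. e i * (norm (x i))\<^sup>2)"

definition hermitian_on :: "nat set \<Rightarrow> (nat \<Rightarrow> nat \<Rightarrow> 'a::rc_scalar) \<Rightarrow> bool" where
  "hermitian_on S Q \<longleftrightarrow> (\<forall>i\<in>S. \<forall>j\<in>S. Q j i = conjugate (Q i j))"

definition posdef_on :: "nat set \<Rightarrow> (nat \<Rightarrow> nat \<Rightarrow> 'a::rc_scalar) \<Rightarrow> bool" where
  "posdef_on S Q \<longleftrightarrow> (\<forall>x. (\<exists>i\<in>S. x i \<noteq> 0) \<longrightarrow> 0 < qform S Q x)"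

lemma posdef_onD: "posdef_on S Q \<Longrightarrow> i \<in> S \<Longrightarrow> x i \<noteq> 0 \<Longrightarrow> 0 < qform S Q x"
  unfolding posdef_on_def by blast

lemma sesq_add_right: "sesq S x (\<lambda>i. y i + z i) = sesq S x y + sesq S x z"
  by (simp add: sesq_def algebra_simps sum.distrib)

lemma sesq_scale_right: "sesq S x (\<lambda>i. t * y i) = t * sesq S x y"
  by (simp add: sesq_def sum_distrib_left algebra_simps)

lemma sesq_add_left: "sesq S (\<lambda>i. x i + z i) y = sesq S x y + sesq S z y"
  by (simp add: sesq_def algebra_simps conjugate_dist_add sum.distrib)

lemma sesq_scale_left: "sesq S (\<lambda>i. t * x i) y = conjugate t * sesq S x y"
  by (simp add: sesq_def sum_distrib_left conjugate_dist_mul algebra_simps)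

lemma sesq_conjugate: "finite S \<Longrightarrow> conjugate (sesq S x y) = sesq S y x"
  by (simp add: sesq_def sum_conjugate conjugate_dist_mul mult.commute)

lemma kapply_add: "kapply S Q (\<lambda>i. x i + y i) = (\<lambda>i. kapply S Q x i + kapply S Q y i)"
  by (rule ext) (simp add: kapply_def algebra_simps sum.distrib)

lemma kapply_scale: "kapply S Q (\<lambda>i. t * x i) = (\<lambda>i. t * kapply S Q x i)"
  by (rule ext) (simp add: kapply_def sum_distrib_left algebra_simps)

lemma sesq_cong: "\<lbrakk>\<And>i. i \<in> S \<Longrightarrow> x i = x' i; \<And>i. i \<in> S \<Longrightarrow> y i = y' i\<rbrakk> \<Longrightarrow> sesq S x y = sesq S x' y'"
  by (simp add: sesq_def)

lemma sesq_indicator: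
  assumes "finite S" "j \<in> S"
  shows "sesq S (\<lambda>i. if i = j then 1 else 0) x = x j"
proof -
  have "sesq S (\<lambda>i. if i = j then 1 else 0) x = (\<Sum>i\<in>S. if i = j then x i else 0)"
    unfolding sesq_def by (rule sum.cong) auto
  then show ?thesis using assms by simp
qed

lemma sesq_kapply_swap:
  assumes "finite S" "hermitian_on S Q"
  shows "sesq S (kapply S Q x) y = sesq S x (kapply S Q y)"
proof -
  have "sesq S (kapply S Q x) y = (\<Sum>i\<in>S. \<Sum>j\<in>S. conjugate (x j) * (conjugate (Q i j) * y i))"
    unfolding sesq_def kapply_def sum_conjugate[OF assms(1)] conjugate_dist_mul sum_distrib_right
    by (simp only: mult_ac)
  also have "\<dots> = (\<Sum>j\<in>S. \<Sum>i\<in>S. conjugate (x j) * (conjugate (Q i j) * y i))"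
    by (rule sum.swap)
  also have "\<dots> = (\<Sum>j\<in>S. \<Sum>i\<in>S. conjugate (x j) * (Q j i * y i))"
    using assms(2) unfolding hermitian_on_def by (intro sum.cong refl) metis
  also have "\<dots> = sesq S x (kapply S Q y)"
    unfolding sesq_def kapply_def sum_distrib_left ..
  finally show ?thesis .
qed

lemma qform_add_scale:
  assumes "finite S" "hermitian_on S Q"
  shows "qform S Q (\<lambda>i. x i + t * y i)
     = qform S Q x + 2 * re (conjugate t * sesq S y (kapply S Q x)) + (norm t)\<^sup>2 * qform S Q y"
proof -
  have 1: "re (t * sesq S x (kapply S Q y)) = re (conjugate t * sesq S y (kapply S Q x))"
  proof -
    have "re (t * sesq S x (kapply S Q y)) = re (conjugate (t * sesq S x (kapply S Q y)))"
      by (rule re_conjugate[symmetric])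
    also have "conjugate (t * sesq S x (kapply S Q y)) = conjugate t * sesq S (kapply S Q y) x"
      unfolding conjugate_dist_mul sesq_conjugate[OF assms(1)] ..
    finally show ?thesis unfolding sesq_kapply_swap[OF assms] .
  qed
  have 2: "re (conjugate t * (t * z)) = (norm t)\<^sup>2 * re z" for z
    unfolding mult.assoc[symmetric] conjugate_mult_self by (rule re_of_real_mult)
  define a b where "a = kapply S Q x" and "b = kapply S Q y"
  have "kapply S Q (\<lambda>i. x i + t * y i) = (\<lambda>i. a i + t * b i)"
    unfolding a_def b_def using kapply_add[of S Q x "\<lambda>i. t * y i"] kapply_scale[of S Q t y] by simp
  then have "sesq S (\<lambda>i. x i + t * y i) (kapply S Q (\<lambda>i. x i + t * y i))
    = sesq S x a + t * sesq S x b + (conjugate t * sesq S y a + conjugate t * (t * sesq S y b))"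
    by (simp add: sesq_add_left sesq_add_right sesq_scale_left sesq_scale_right distrib_left)
  then have "qform S Q (\<lambda>i. x i + t * y i)
    = re (sesq S x a) + re (t * sesq S x b) + (re (conjugate t * sesq S y a) + re (conjugate t * (t * sesq S y b)))"
    unfolding qform_def by (simp only: re_add)
  moreover have "re (t * sesq S x b) = re (conjugate t * sesq S y a)"
    unfolding a_def b_def by (rule 1)
  moreover note 2[of "sesq S y b"]
  moreover have "qform S Q x = re (sesq S x a)" "qform S Q y = re (sesq S y b)"
    by (simp_all only: qform_def a_def b_def)
  ultimately show ?thesis unfolding a_def[symmetric] by (simp only: mult_2 distrib_right add_ac)
qed

text \<open>The discriminant argument along the line \<open>x - r w y\<close> with real \<open>r\<close>.  A form that vanishes
  at \<open>x\<close> therefore annihilates \<open>Q x\<close>, which later yields eigenvectors.\<close>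

lemma psd_cauchy_schwarz:
  assumes "finite S" "hermitian_on S Q" and psd: "\<And>x. 0 \<le> qform S Q x"
  shows "(norm (sesq S y (kapply S Q x)))\<^sup>2 \<le> qform S Q y * qform S Q x"
proof -
  define w where "w = sesq S y (kapply S Q x)"
  \<comment> \<open>The form is nonnegative at \<open>x - r w y\<close>.\<close>
  have key: "0 \<le> qform S Q x - 2 * r * (norm w)\<^sup>2 + r\<^sup>2 * (norm w)\<^sup>2 * qform S Q y" for r
  proof -
    have "re (conjugate (of_real (- r) * w) * w) = - r * (norm w)\<^sup>2"
      by (simp add: conjugate_dist_mul conjugate_neg mult.assoc flip: of_real_minus) 
    then show ?thesis
      using psd[of "\<lambda>i. x i + (of_real (- r) * w) * y i"] qform_add_scale[OF assms(1,2), of x "of_real (- r) * w" y]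
      unfolding w_def[symmetric] by (simp add: norm_mult power_mult_distrib)
  qed
  have "(norm w)\<^sup>2 \<le> qform S Q y * qform S Q x"
  proof (cases "qform S Q y = 0")
    case True
    have "w = 0"
    proof (rule ccontr)
      assume "w \<noteq> 0"
      then show False
        using key[of "(qform S Q x + 1) / (2 * (norm w)\<^sup>2)"] True psd[of x] by (simp add: field_simps)
    qed
    with True show ?thesis by simp
  next
    case False
    with psd[of y] have "qform S Q y > 0" by simp
    then show ?thesis using key[of "1 / qform S Q y"]
      by (simp add: field_simps power2_eq_square)
  qed
  then show ?thesis by (simp add: w_def)
qed

lemma qform_cong: "(\<And>i. i \<in> S \<Longrightarrow> x i = y i) \<Longrightarrow> qform S Q x = qform S Q y"
  unfolding qform_def sesq_def kapply_def by (intro arg_cong[of _ _ re] sum.cong) auto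

lemma qform_extend_zero:
  assumes "finite S" "T \<subseteq> S"
  shows "qform S Q (\<lambda>i. if i \<in> T then x i else 0) = qform T Q x"
proof -
  have "kapply S Q (\<lambda>i. if i \<in> T then x i else 0) i = kapply T Q x i" for i
    unfolding kapply_def using assms by (intro sum.mono_neutral_cong_right) auto
  then have "kapply S Q (\<lambda>i. if i \<in> T then x i else 0) = kapply T Q x" by (rule ext)
  moreover have "sesq S (\<lambda>i. if i \<in> T then x i else 0) y = sesq T x y" for y
    unfolding sesq_def using assms by (intro sum.mono_neutral_cong_right) auto
  ultimately show ?thesis by (simp add: qform_def)
qed

lemma posdef_on_subset:
  assumes "finite S" "T \<subseteq> S" "posdef_on S Q"
  shows "posdef_on T Q"
  unfolding posdef_on_def
proof (intro allI impI)
  fix x :: "nat \<Rightarrow> 'a" assume "\<exists>i\<in>T. x i \<noteq> 0"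
  then obtain i where i: "i \<in> T" "x i \<noteq> 0" by blast
  have "0 < qform S Q (\<lambda>i. if i \<in> T then x i else 0)"
    by (rule posdef_onD[OF assms(3), of i]) (use i assms(2) in auto)
  then show "0 < qform T Q x" unfolding qform_extend_zero[OF assms(1,2)] .
qed

text \<open>Gaussian elimination on the last index; positive definiteness keeps the pivot nonzero.\<close>

lemma posdef_on_solve:
  assumes "finite S" "posdef_on S Q"
  shows "\<exists>y. \<forall>i\<in>S. kapply S Q y i = b i"
  using assms
proof (induction S arbitrary: b rule: finite_induct)
  case (insert c S)
  have pd: "posdef_on S Q"
    by (rule posdef_on_subset[OF _ _ insert.prems]) (use insert.hyps in auto)
  obtain y0 where y0: "\<And>i. i \<in> S \<Longrightarrow> kapply S Q y0 i = b i"
    using insert.IH[OF pd, of b] by auto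
  obtain y1 where y1: "\<And>i. i \<in> S \<Longrightarrow> kapply S Q y1 i = Q i c"
    using insert.IH[OF pd, of "\<lambda>i. Q i c"] by auto
  define d where "d = Q c c - kapply S Q y1 c"
  define elim where "elim u v t = (\<lambda>i. if i = c then t else u i - t * (v i :: 'a))" for u v t
  have elim: "kapply (insert c S) Q (elim u y1 t) i = Q i c * t + (kapply S Q u i - t * kapply S Q y1 i)"
    for u t i
  proof -
    have "(\<Sum>j\<in>S. Q i j * elim u y1 t j) = (\<Sum>j\<in>S. Q i j * u j - t * (Q i j * y1 j))"
      using insert.hyps by (intro sum.cong) (auto simp: elim_def algebra_simps)
    then show ?thesis using insert.hyps
      by (simp add: kapply_def sum_subtractf sum_distrib_left) (simp add: elim_def)
  qed
  have "d \<noteq> 0"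
  proof
    assume "d = 0"
    have "kapply (insert c S) Q (elim (\<lambda>_. 0) y1 1) i = 0" if "i \<in> insert c S" for i
      unfolding elim using that \<open>d = 0\<close> y1 by (auto simp: d_def kapply_def)
    then have "qform (insert c S) Q (elim (\<lambda>_. 0) y1 1) = 0"
      by (simp add: qform_def sesq_def)
    moreover have "elim (\<lambda>_. 0) y1 1 c \<noteq> 0" by (simp add: elim_def)
    ultimately show False using posdef_onD[OF insert.prems, of c "elim (\<lambda>_. 0) y1 1"] by simp
  qed
  define t where "t = (b c - kapply S Q y0 c) / d"
  have t: "t * Q c c - t * kapply S Q y1 c = b c - kapply S Q y0 c"
    using \<open>d \<noteq> 0\<close> unfolding right_diff_distrib[symmetric] d_def[symmetric] t_def by simp
  have "kapply (insert c S) Q (elim y0 y1 t) i = b i" if "i \<in> insert c S" for i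
  proof (cases "i = c")
    case True
    show ?thesis unfolding elim True using t by (simp add: algebra_simps)
  next
    case False
    with that show ?thesis unfolding elim by (simp add: y0 y1)
  qed
  then show ?case by blast
qed simp

lemma posdef_imp_psd:
  assumes "posdef_on S Q" shows "0 \<le> qform S Q x"
proof (cases "\<exists>i\<in>S. x i \<noteq> 0")
  case True
  then obtain i where "i \<in> S" "x i \<noteq> 0" by blast
  from posdef_onD[where x = x, OF assms this] show ?thesis by simp
next
  case False
  then have "sesq S x y = 0" for y unfolding sesq_def by (intro sum.neutral) auto
  then show ?thesis by (simp add: qform_def)
qed

text \<open>The vectors \<open>u j\<close> are the columns of the inverse, and the value of the form at \<open>u j\<close> is the
  \<open>j\<close>-th diagonal entry of the inverse.  The last property, that this entry bounds
  \<open>\<bar>x j\<bar>\<^sup>2\<close> relative to the form, characterizes diagonal entries of inverses without mentioning inverses;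
  the barrier argument works with such bounds only.\<close>

lemma posdef_on_inverse:
  assumes fin: "finite S" and herm: "hermitian_on S Q" and pd: "posdef_on S Q"
  obtains u :: "nat \<Rightarrow> nat \<Rightarrow> 'a::rc_scalar" where
    "\<And>j x. j \<in> S \<Longrightarrow> sesq S (u j) (kapply S Q x) = x j"
    "\<And>j. j \<in> S \<Longrightarrow> u j j = of_real (qform S Q (u j))"
    "\<And>j. j \<in> S \<Longrightarrow> 0 < qform S Q (u j)"
    "\<And>j x. j \<in> S \<Longrightarrow> (norm (x j))\<^sup>2 \<le> qform S Q (u j) * qform S Q x"
proof -
  have "\<forall>j. \<exists>y. \<forall>i\<in>S. kapply S Q y i = (if i = j then 1 else 0)"
    by (rule allI, rule posdef_on_solve[OF fin pd])
  from choice[OF this] obtain u where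
    u: "\<And>j i. i \<in> S \<Longrightarrow> kapply S Q (u j) i = (if i = j then 1 else 0)"
    by blast
  have 1: "sesq S (u j) (kapply S Q x) = x j" if "j \<in> S" for j x
  proof -
    have "sesq S (u j) (kapply S Q x) = sesq S (\<lambda>i. if i = j then 1 else 0) x"
      unfolding sesq_kapply_swap[OF fin herm, symmetric] using u by (intro sesq_cong) auto
    then show ?thesis using sesq_indicator[OF fin that] by simp
  qed
  have 2: "u j j = of_real (qform S Q (u j))" if "j \<in> S" for j
  proof -
    have "conjugate (u j j) = u j j"
      using 1[OF that, of "u j"] sesq_conjugate[OF fin, of "u j" "kapply S Q (u j)"]
        sesq_kapply_swap[OF fin herm, of "u j" "u j"] by simp
    then have "of_real (re (u j j)) = u j j" by (simp add: of_real_re)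
    then show ?thesis using 1[OF that, of "u j"] by (simp add: qform_def)
  qed
  have 3: "0 < qform S Q (u j)" if "j \<in> S" for j
  proof -
    have "\<exists>i\<in>S. u j i \<noteq> 0"
    proof (rule ccontr)
      assume "\<not> ?thesis"
      then have "kapply S Q (u j) j = 0" by (simp add: kapply_def)
      with u[OF that, of j] show False by simp
    qed
    then obtain i where "i \<in> S" "u j i \<noteq> 0" by blast
    from posdef_onD[where x = "u j", OF pd this] show ?thesis .
  qed
  have 4: "(norm (x j))\<^sup>2 \<le> qform S Q (u j) * qform S Q x" if "j \<in> S" for j x
    using psd_cauchy_schwarz[OF fin herm posdef_imp_psd[OF pd], of "u j" x] 1[OF that] by simp
  show ?thesis by (rule that[OF 1 2 3 4])
qed

lemma wnorm_nonneg: "(\<And>i. i \<in> S \<Longrightarrow> 0 \<le> e i) \<Longrightarrow> 0 \<le> wnorm S e x"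
  by (simp add: wnorm_def sum_nonneg)

lemma sesq_norm_le:
  assumes "finite S"
  shows "norm (sesq S x y) \<le> (\<Sum>i\<in>S. norm (x i) * norm (y i))"
  unfolding sesq_def by (rule order_trans[OF norm_sum]) (simp add: norm_mult)

lemma kapply_add_diag:
  assumes "finite S" "i \<in> S"
  shows "kapply S (\<lambda>i j. of_real a * Q i j + (if i = j then of_real (d i) else 0)) x i
      = of_real a * kapply S Q x i + of_real (d i) * x i"
proof -
  have "(\<Sum>j\<in>S. (if i = j then of_real (d i) else 0) * x j) = (\<Sum>j\<in>S. if j = i then of_real (d i) * x j else 0)"
    by (rule sum.cong) auto
  then show ?thesis using assms
    by (simp add: kapply_def distrib_right sum.distrib sum_distrib_left mult.assoc)
qed

lemma qform_add_diag:
  assumes "finite S"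
  shows "qform S (\<lambda>i j. of_real a * Q i j + (if i = j then of_real (d i) else 0)) x
    = a * qform S Q x + wnorm S d x"
proof -
  have 2: "re (sesq S x (\<lambda>i. of_real (d i) * x i)) = wnorm S d x"
  proof -
    have "re (conjugate (x i) * (of_real (d i) * x i)) = d i * (norm (x i))\<^sup>2" for i
    proof -
      have "conjugate (x i) * (of_real (d i) * x i) = of_real (d i) * (conjugate (x i) * x i)"
        by simp
      then show ?thesis by (simp only: re_of_real_mult re_conjugate_self)
    qed
    then show ?thesis by (simp add: sesq_def wnorm_def re_sum)
  qed
  have "sesq S x (kapply S (\<lambda>i j. of_real a * Q i j + (if i = j then of_real (d i) else 0)) x)
    = sesq S x (\<lambda>i. of_real a * kapply S Q x i + of_real (d i) * x i)"
    by (rule sesq_cong) (simp_all add: kapply_add_diag[OF assms])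
  then show ?thesis
    by (simp add: qform_def sesq_add_right sesq_scale_right re_add 2)
qed

lemma hermitian_on_add_diag:
  assumes "hermitian_on S Q"
  shows "hermitian_on S (\<lambda>i j. of_real a * Q i j + (if i = j then of_real (d i) else 0))"
  unfolding hermitian_on_def
proof (intro ballI)
  fix i j assume "i \<in> S" "j \<in> S"
  then have "conjugate (Q i j) = Q j i" using assms unfolding hermitian_on_def by metis
  then show "of_real a * Q j i + (if j = i then of_real (d j) else 0)
      = conjugate (of_real a * Q i j + (if i = j then of_real (d i) else 0))"
    by (simp add: conjugate_dist_add conjugate_dist_mul)
qed

lemma qform_le_bound:
  assumes "finite S"
  shows "qform S Q x \<le> (\<Sum>i\<in>S. \<Sum>j\<in>S. norm (Q i j)) * wnorm S (\<lambda>_. 1) x"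
proof -
  have le: "norm (x i) * norm (x j) \<le> wnorm S (\<lambda>_. 1) x" if "i \<in> S" "j \<in> S" for i j
  proof -
    have "(norm (x l))\<^sup>2 \<le> wnorm S (\<lambda>_. 1) x" if "l \<in> S" for l
      unfolding wnorm_def using assms that member_le_sum[of l S "\<lambda>i. 1 * (norm (x i))\<^sup>2"] by simp
    from this[OF that(1)] this[OF that(2)] show ?thesis
      using sum_squares_bound[of "norm (x i)" "norm (x j)"] by linarith
  qed
  have "qform S Q x \<le> norm (sesq S x (kapply S Q x))"
    unfolding qform_def by (rule re_le_norm)
  also have "\<dots> \<le> (\<Sum>i\<in>S. norm (x i) * norm (kapply S Q x i))"
    by (rule sesq_norm_le[OF assms])
  also have "\<dots> \<le> (\<Sum>i\<in>S. norm (x i) * (\<Sum>j\<in>S. norm (Q i j) * norm (x j)))"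
    unfolding kapply_def
    by (intro sum_mono mult_left_mono order_trans[OF norm_sum]) (auto simp: norm_mult)
  also have "\<dots> = (\<Sum>i\<in>S. \<Sum>j\<in>S. norm (Q i j) * (norm (x i) * norm (x j)))"
    by (simp add: sum_distrib_left algebra_simps)
  also have "\<dots> \<le> (\<Sum>i\<in>S. \<Sum>j\<in>S. norm (Q i j) * wnorm S (\<lambda>_. 1) x)"
    by (intro sum_mono mult_left_mono le) auto
  finally show ?thesis by (simp add: sum_distrib_right)
qed

text \<open>Let \<open>r\<close> be the infimum of the numbers for which \<open>r I - Q\<close> is positive semidefinite.  If \<open>r I - Q\<close>
  were positive definite, the diagonal of its inverse would bound \<open>I\<close> by a multiple of \<open>r I - Q\<close>
  and \<open>r\<close> could be lowered.  So the form has a nontrivial zero, and this is an eigenvector by the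
  Cauchy-Schwarz inequality.  The argument works over both scalar fields.\<close>

lemma top_eigenvector:
  assumes fin: "finite S" and ne: "S \<noteq> {}" and herm: "hermitian_on S Q"
  obtains r x where "\<exists>i\<in>S. x i \<noteq> 0" "\<And>i. i \<in> S \<Longrightarrow> kapply S Q x i = of_real r * x i"
    "\<And>y. qform S Q y \<le> r * wnorm S (\<lambda>_. 1) y"
proof -
  define P where "P = {r. \<forall>y. qform S Q y \<le> r * wnorm S (\<lambda>_. 1) y}"
  obtain l where l: "l \<in> S" using ne by auto
  have P_ne: "P \<noteq> {}" using qform_le_bound[OF fin, of Q] by (auto simp: P_def)
  have bdd: "bdd_below P"
  proof
    fix r assume "r \<in> P"
    then have "qform S Q (\<lambda>i. if i = l then 1 else 0)
        \<le> r * wnorm S (\<lambda>_. 1) (\<lambda>i. if i = l then 1 else 0::'a)" unfolding P_def by blast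
    moreover have "wnorm S (\<lambda>_. 1) (\<lambda>i. if i = l then 1 else 0::'a) = 1"
    proof -
      have "wnorm S (\<lambda>_. 1) (\<lambda>i. if i = l then 1 else 0::'a) = (\<Sum>i\<in>S. if i = l then 1 else 0)"
        unfolding wnorm_def by (rule sum.cong) auto
      then show ?thesis using l fin by simp
    qed
    ultimately show "qform S Q (\<lambda>i. if i = l then 1 else 0) \<le> r"
      by simp
  qed
  define r where "r = Inf P"
  have rP: "r \<in> P"
  proof -
    have "qform S Q y \<le> r * wnorm S (\<lambda>_. 1) y" for y
    proof (rule ccontr)
      assume less: "\<not> ?thesis"
      have w0: "wnorm S (\<lambda>_. 1) y \<ge> 0" by (rule wnorm_nonneg) auto
      have "wnorm S (\<lambda>_. 1) y \<noteq> 0"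
      proof
        assume "wnorm S (\<lambda>_. 1) y = 0"
        moreover obtain p where "p \<in> P" using P_ne by blast
        then have "qform S Q y \<le> p * wnorm S (\<lambda>_. 1) y" unfolding P_def by blast
        ultimately show False using less by simp
      qed
      with w0 have w: "wnorm S (\<lambda>_. 1) y > 0" by simp
      have "qform S Q y / wnorm S (\<lambda>_. 1) y \<le> r"
        unfolding r_def
      proof (rule cInf_greatest[OF P_ne])
        fix p assume "p \<in> P"
        then have "qform S Q y \<le> p * wnorm S (\<lambda>_. 1) y" unfolding P_def by blast
        then show "qform S Q y / wnorm S (\<lambda>_. 1) y \<le> p" using w by (simp add: divide_le_eq)
      qed
      with w less show False by (simp add: divide_le_eq)
    qed
    then show ?thesis by (simp add: P_def)
  qed
  define Q0 where "Q0 = (\<lambda>i j. of_real (- 1) * Q i j + (if i = j then of_real r else 0))"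
  have Q0: "qform S Q0 y = r * wnorm S (\<lambda>_. 1) y - qform S Q y" for y
    unfolding Q0_def qform_add_diag[OF fin] by (simp add: wnorm_def sum_distrib_left)
  have herm0: "hermitian_on S Q0" unfolding Q0_def by (rule hermitian_on_add_diag[OF herm])
  have psd0: "0 \<le> qform S Q0 y" for y using rP unfolding Q0 P_def by simp
  have "\<not> posdef_on S Q0"
  proof
    assume pd: "posdef_on S Q0"
    obtain u :: "nat \<Rightarrow> nat \<Rightarrow> 'a" where
      "\<And>j x. j \<in> S \<Longrightarrow> sesq S (u j) (kapply S Q0 x) = x j"
      "\<And>j. j \<in> S \<Longrightarrow> u j j = of_real (qform S Q0 (u j))"
      and u: "\<And>j. j \<in> S \<Longrightarrow> 0 < qform S Q0 (u j)"
         "\<And>j x. j \<in> S \<Longrightarrow> (norm (x j))\<^sup>2 \<le> qform S Q0 (u j) * qform S Q0 x"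
      by (rule posdef_on_inverse[OF fin herm0 pd]) blast
    define C where "C = (\<Sum>j\<in>S. qform S Q0 (u j))"
    have C: "C > 0" unfolding C_def using fin ne u(1) by (intro sum_pos) auto
    have "wnorm S (\<lambda>_. 1) y \<le> C * qform S Q0 y" for y
      unfolding wnorm_def C_def sum_distrib_right by (rule sum_mono) (simp add: u(2))
    then have "qform S Q y \<le> (r - 1 / C) * wnorm S (\<lambda>_. 1) y" for y
      using C unfolding Q0 by (simp add: field_simps)
    then have "r - 1 / C \<in> P" unfolding P_def by blast
    then have "r \<le> r - 1 / C" unfolding r_def using bdd by (rule cInf_lower)
    with C show False by (simp add: field_simps)
  qed
  then obtain x where x: "\<exists>i\<in>S. x i \<noteq> 0" "\<not> 0 < qform S Q0 x"
    unfolding posdef_on_def by blast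
  then have x0: "qform S Q0 x = 0" using psd0[of x] by simp
  have "kapply S Q x i = of_real r * x i" if i: "i \<in> S" for i
  proof -
    have "sesq S (\<lambda>j. if j = i then 1 else 0) (kapply S Q0 x) = 0"
      using psd_cauchy_schwarz[OF fin herm0 psd0, of "\<lambda>j. if j = i then 1 else 0" x] x0 by simp
    then have "kapply S Q0 x i = 0" using sesq_indicator[OF fin i, of "kapply S Q0 x"] by simp
    moreover have "kapply S Q0 x i = of_real r * x i - kapply S Q x i"
      using kapply_add_diag[OF fin i, of "- 1" Q "\<lambda>_. r" x] unfolding Q0_def by simp
    ultimately show ?thesis by simp
  qed
  moreover have "qform S Q y \<le> r * wnorm S (\<lambda>_. 1) y" for y
    using rP unfolding P_def by blast
  ultimately show ?thesis using that[of x r] x(1) by blast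
qed

section \<open>Adding one column\<close>

lemma qform_insert:
  assumes "finite S" "c \<notin> S" "hermitian_on (insert c S) Q"
  shows "qform (insert c S) Q x
     = qform S Q x + 2 * re (conjugate (x c) * kapply S Q x c) + re (Q c c) * (norm (x c))\<^sup>2"
proof -
  have col: "sesq S x (\<lambda>i. Q i c * x c) = conjugate (conjugate (x c) * kapply S Q x c)"
  proof -
    have "conjugate (Q c i) = Q i c" if "i \<in> S" for i
      using assms(3) that unfolding hermitian_on_def by (metis insert_iff)
    then have "sesq S x (\<lambda>i. Q i c * x c) = (\<Sum>i\<in>S. x c * (conjugate (Q c i) * conjugate (x i)))"
      unfolding sesq_def by (intro sum.cong) (simp_all add: mult_ac)
    also have "\<dots> = conjugate (conjugate (x c) * kapply S Q x c)"
      by (simp add: kapply_def sum_conjugate[OF assms(1)] conjugate_dist_mul sum_distrib_left)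
    finally show ?thesis .
  qed
  have diag: "re (conjugate (x c) * (Q c c * x c)) = re (Q c c) * (norm (x c))\<^sup>2"
  proof -
    have "conjugate (x c) * (Q c c * x c) = of_real ((norm (x c))\<^sup>2) * Q c c"
      unfolding conjugate_mult_self[symmetric] by (simp only: mult_ac)
    then have "re (conjugate (x c) * (Q c c * x c)) = (norm (x c))\<^sup>2 * re (Q c c)"
      by (simp only: re_of_real_mult)
    then show ?thesis by (simp only: mult.commute)
  qed
  have "kapply (insert c S) Q x = (\<lambda>i. Q i c * x c + kapply S Q x i)"
    by (rule ext) (use assms in \<open>simp add: kapply_def\<close>)
  then have "sesq (insert c S) x (kapply (insert c S) Q x)
      = conjugate (x c) * (Q c c * x c) + conjugate (x c) * kapply S Q x c
        + (sesq S x (\<lambda>i. Q i c * x c) + sesq S x (kapply S Q x))"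
    using assms(1,2) by (simp add: sesq_def distrib_left sum.distrib)
  then show ?thesis
    by (simp add: qform_def re_add col diag)
qed

lemma twice_mult_le_add:
  fixes a b p q :: real
  assumes "0 \<le> p" "0 \<le> q" "a\<^sup>2 * b\<^sup>2 \<le> p * q"
  shows "2 * a * b \<le> p + q"
proof (rule power2_le_imp_le)
  have "(2 * a * b)\<^sup>2 = 4 * (a\<^sup>2 * b\<^sup>2)" by (simp add: power_mult_distrib)
  also have "\<dots> \<le> 4 * (p * q)" using assms(3) by simp
  also have "\<dots> = (p + q)\<^sup>2 - (p - q)\<^sup>2" by (simp add: power2_eq_square algebra_simps)
  also have "\<dots> \<le> (p + q)\<^sup>2" by simp
  finally show "(2 * a * b)\<^sup>2 \<le> (p + q)\<^sup>2" .
qed (use assms in auto)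

text \<open>The Cauchy-Schwarz inequality in the plane, for the vectors of length \<open>\<surd>R, \<surd>(Y / \<theta>)\<close> and
  \<open>\<surd>A, \<surd>(\<theta> X)\<close>.\<close>

lemma sum_square_le_product:
  fixes a b R A X Y :: real
  assumes "a\<^sup>2 \<le> R * A" "b\<^sup>2 = X * Y" "0 < \<theta>" "0 \<le> R" "0 \<le> A" "0 \<le> X" "0 \<le> Y"
  shows "(a + b)\<^sup>2 \<le> (R + Y / \<theta>) * (A + \<theta> * X)"
proof -
  have "a\<^sup>2 * b\<^sup>2 \<le> (R * A) * (X * Y)"
    unfolding assms(2) using assms by (intro mult_right_mono) auto
  also have "\<dots> = (R * (\<theta> * X)) * (A * Y / \<theta>)" using assms(3) by simp
  finally have "2 * a * b \<le> R * (\<theta> * X) + A * Y / \<theta>"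
    using assms by (intro twice_mult_le_add) auto
  then have "(a + b)\<^sup>2 \<le> R * A + (R * (\<theta> * X) + A * Y / \<theta>) + X * Y"
    using assms(1,2) by (simp add: power2_sum)
  also have "\<dots> = (R + Y / \<theta>) * (A + \<theta> * X)" using assms(3) by (simp add: field_simps)
  finally show ?thesis .
qed

text \<open>The kernel \<open>g\<close> is the Gram kernel of \<open>n\<close> unit vectors, and \<open>gram_bound\<close> says that applying the adjoint
  of the whole matrix to a combination of the columns in \<open>S\<close> increases the squared norm by at most
  the factor \<open>k\<close>.  The sign \<open>\<epsilon>\<close> selects which of the two one-sided bounds on \<open>g - I\<close> is
  built.\<close>

locale gram_barrier =
  fixes g :: "nat \<Rightarrow> nat \<Rightarrow> 'a::rc_scalar" and n :: nat and k \<theta> \<epsilon> :: real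
  assumes gram_hermitian: "hermitian_on {..<n} g"
    and gram_diag: "\<And>i. i < n \<Longrightarrow> g i i = 1"
    and gram_bound: "\<And>S u. S \<subseteq> {..<n} \<Longrightarrow>
        (\<Sum>c<n. (norm (\<Sum>j\<in>S. g c j * u j))\<^sup>2) \<le> k * qform S g u"
    and k_ge_1: "1 \<le> k" and theta: "0 < \<theta>" "\<theta> \<le> 1 / 2" and sign: "\<epsilon> = 1 \<or> \<epsilon> = - 1"
begin

text \<open>The matrix \<open>\<mu> E - I + \<epsilon> (g - I)\<close> with \<open>E\<close> the diagonal matrix of \<open>e\<close>.\<close>

definition barrier_kernel :: "real \<Rightarrow> (nat \<Rightarrow> real) \<Rightarrow> nat \<Rightarrow> nat \<Rightarrow> 'a" where
  "barrier_kernel \<mu> e = (\<lambda>i j. of_real \<epsilon> * g i j + (if i = j then of_real (\<mu> * e i - 1 - \<epsilon>) else 0))"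

text \<open>The number \<open>\<rho> j\<close> bounds the \<open>j\<close>-th diagonal entry of the inverse of the barrier matrix.  The
  bound is stated through the form, which avoids naming the inverse.  The matrix is positive definite as a consequence.\<close>

definition barrier :: "nat set \<Rightarrow> real \<Rightarrow> (nat \<Rightarrow> real) \<Rightarrow> (nat \<Rightarrow> real) \<Rightarrow> bool" where
  "barrier S \<mu> e \<rho> \<longleftrightarrow> (\<forall>i\<in>S. 1 + \<theta> \<le> e i \<and> 0 \<le> \<rho> i) \<and>
     (\<forall>x. 0 \<le> qform S (barrier_kernel \<mu> e) x \<and> (\<forall>j\<in>S. (norm (x j))\<^sup>2 \<le> \<rho> j * qform S (barrier_kernel \<mu> e) x))"

lemma gram_hermitian_on: "S \<subseteq> {..<n} \<Longrightarrow> hermitian_on S g"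
  using gram_hermitian unfolding hermitian_on_def by blast

lemma gram_swap: "i < n \<Longrightarrow> j < n \<Longrightarrow> conjugate (g i j) = g j i"
  using gram_hermitian unfolding hermitian_on_def by (metis lessThan_iff)

lemma hermitian_on_barrier_kernel: "S \<subseteq> {..<n} \<Longrightarrow> hermitian_on S (barrier_kernel \<mu> e)"
  unfolding barrier_kernel_def by (intro hermitian_on_add_diag gram_hermitian_on)

lemma qform_barrier_kernel:
  "finite S \<Longrightarrow> qform S (barrier_kernel \<mu> e) x = \<epsilon> * qform S g x + wnorm S (\<lambda>i. \<mu> * e i - 1 - \<epsilon>) x"
  unfolding barrier_kernel_def by (rule qform_add_diag)

lemma qform_barrier_kernel_shift:
  assumes "finite S"
  shows "qform S (barrier_kernel (\<mu> + \<delta>) e) x = qform S (barrier_kernel \<mu> e) x + \<delta> * wnorm S e x"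
  unfolding qform_barrier_kernel[OF assms] wnorm_def by (simp add: algebra_simps sum_distrib_left flip: sum.distrib)

lemma wnorm_mono:
  assumes "\<And>i. i \<in> S \<Longrightarrow> d i \<le> e i"
  shows "wnorm S d x \<le> wnorm S e x"
  unfolding wnorm_def by (intro sum_mono mult_right_mono assms) auto

text \<open>Averaging over the next column produces the Gram form of \<open>S\<close>, and this lemma feeds it back into
  the barrier.  For \<open>\<epsilon> = 1\<close> the Gram matrix is \<open>Q + 2 I - \<mu> E\<close>, for \<open>\<epsilon> = - 1\<close> it is \<open>\<mu> E - Q\<close>.\<close>

lemma gram_le_barrier:
  assumes "finite S" "1 \<le> \<mu>" "\<mu> \<le> 2" "\<And>i. i \<in> S \<Longrightarrow> 1 \<le> e i" "0 \<le> qform S (barrier_kernel \<mu> e) x"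
  shows "qform S g x \<le> qform S (barrier_kernel \<mu> e) x + 2 * wnorm S e x"
proof -
  have two: "2 * wnorm S e x = wnorm S (\<lambda>i. 2 * e i) x"
    by (simp add: wnorm_def sum_distrib_left mult.assoc)
  from sign show ?thesis
  proof
    assume "\<epsilon> = 1"
    then have "qform S g x = qform S (barrier_kernel \<mu> e) x + wnorm S (\<lambda>i. 2 - \<mu> * e i) x"
      unfolding qform_barrier_kernel[OF assms(1)] by (simp add: wnorm_def sum.distrib[symmetric] algebra_simps)
    also have "wnorm S (\<lambda>i. 2 - \<mu> * e i) x \<le> wnorm S (\<lambda>i. 2 * e i) x"
    proof (rule wnorm_mono)
      fix i assume "i \<in> S"
      from assms(4)[OF this] assms(2) have "0 \<le> \<mu> * e i" "1 \<le> e i" by auto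
      then show "2 - \<mu> * e i \<le> 2 * e i" by linarith
    qed
    finally show ?thesis by (simp add: two)
  next
    assume "\<epsilon> = - 1"
    then have "qform S g x = wnorm S (\<lambda>i. \<mu> * e i) x - qform S (barrier_kernel \<mu> e) x"
      unfolding qform_barrier_kernel[OF assms(1)] by simp
    moreover have "wnorm S (\<lambda>i. \<mu> * e i) x \<le> wnorm S (\<lambda>i. 2 * e i) x"
    proof (rule wnorm_mono)
      fix i assume "i \<in> S"
      from assms(4)[OF this] assms(3) show "\<mu> * e i \<le> 2 * e i" by (intro mult_right_mono) auto
    qed
    ultimately show ?thesis using assms(5) by (simp add: two)
  qed
qed

text \<open>Write \<open>Q\<close> for the barrier matrix on \<open>S\<close> after \<open>\<mu>\<close> has been raised by \<open>\<delta>\<close>, \<open>R j\<close> for the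
  diagonal of its inverse, and \<open>\<tau> j\<close> for the \<open>E\<close>-weighted squared norm of the \<open>j\<close>-th column of its
  inverse.  Raising \<open>\<mu>\<close> lowers the diagonal of the inverse by at least \<open>\<delta> * \<tau> j\<close>.  If
  \<open>b\<close> is the column of correlations of \<open>c\<close> with \<open>S\<close>, then \<open>y c\<close> is \<open>Q\<^sup>-\<^sup>1 b\<close> and \<open>\<beta> c\<close> is
  \<open>b\<^sup>* Q\<^sup>-\<^sup>1 b\<close>.  The new barrier form at \<open>x\<close> is the old one at \<open>x + \<epsilon> (x c) (y c)\<close> plus the Schur complement,
  which is at least \<open>\<theta>\<close>, times \<open>\<bar>x c\<bar>\<^sup>2\<close>; this gives the new diagonal bounds.  The sum of
  \<open>\<bar>y c j\<bar>\<^sup>2\<close> over all \<open>c\<close> is small because \<open>y c j\<close> is the inner product of \<open>c\<close>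
  with the combination of columns given by \<open>u j\<close>.\<close>

lemma barrier_step:
  assumes S: "S \<subseteq> {..<n}" and bar: "barrier S \<mu> e \<rho>"
    and lam: "1 \<le> \<mu>" "\<mu> + \<delta> \<le> 2" and delta: "0 < \<delta>"
  shows "\<exists>\<tau> R \<beta> y. (\<forall>j\<in>S. 0 \<le> \<tau> j \<and> 0 \<le> R j \<and> R j + \<delta> * \<tau> j \<le> \<rho> j \<and>
      (\<Sum>c\<in>{..<n} - S. (norm (y c j))\<^sup>2) \<le> k * (R j + 2 * \<tau> j)) \<and>
    (\<forall>c\<in>{..<n} - S. 2 * \<beta> c \<le> (\<Sum>j\<in>S. (norm (g j c))\<^sup>2 + e j * (norm (y c j :: 'a))\<^sup>2) \<and>
      barrier (insert c S) (\<mu> + \<delta>) (e(c := 1 + \<theta> + \<beta> c))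
        (\<lambda>j. if j = c then 1 / \<theta> else R j + (norm (y c j))\<^sup>2 / \<theta>))"
proof -
  have fin: "finite S" using S finite_subset by blast
  define Q where "Q = barrier_kernel \<mu> e"
  define Q' where "Q' = barrier_kernel (\<mu> + \<delta>) e"
  have e1: "1 + \<theta> \<le> e i" "0 \<le> \<rho> i" if "i \<in> S" for i
    using bar that unfolding barrier_def by blast+
  have e: "1 + \<theta> \<le> e i" "1 \<le> e i" "0 \<le> \<rho> i" if "i \<in> S" for i
    using e1[OF that] theta by simp_all
  have psd: "0 \<le> qform S Q x" for x
    using bar unfolding barrier_def Q_def by blast
  have rho: "(norm (x j))\<^sup>2 \<le> \<rho> j * qform S Q x" if "j \<in> S" for x j
    using bar that unfolding barrier_def Q_def by blast
  have Q': "qform S Q' x = qform S Q x + \<delta> * wnorm S e x" for x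
    unfolding Q_def Q'_def by (rule qform_barrier_kernel_shift[OF fin])
  have herm: "hermitian_on S Q'" unfolding Q'_def by (rule hermitian_on_barrier_kernel[OF S])
  have pd: "posdef_on S Q'"
    unfolding posdef_on_def
  proof (intro allI impI)
    fix x :: "nat \<Rightarrow> 'a" assume "\<exists>i\<in>S. x i \<noteq> 0"
    then obtain i where i: "i \<in> S" "x i \<noteq> 0" by blast
    have "0 < wnorm S e x"
      unfolding wnorm_def
    proof (rule sum_pos2[OF fin i(1)])
      show "0 < e i * (norm (x i))\<^sup>2" using e(2)[OF i(1)] i(2) by simp
    qed (use e(2) in force)
    then show "0 < qform S Q' x" unfolding Q' using psd[of x] delta by (simp add: add_nonneg_pos)
  qed
  obtain u :: "nat \<Rightarrow> nat \<Rightarrow> 'a" where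
    u1: "\<And>j x. j \<in> S \<Longrightarrow> sesq S (u j) (kapply S Q' x) = x j" and
    u2: "\<And>j. j \<in> S \<Longrightarrow> u j j = of_real (qform S Q' (u j))" and
    u3: "\<And>j. j \<in> S \<Longrightarrow> 0 < qform S Q' (u j)" and
    u4: "\<And>j x. j \<in> S \<Longrightarrow> (norm (x j))\<^sup>2 \<le> qform S Q' (u j) * qform S Q' x"
    by (rule posdef_on_inverse[OF fin herm pd]) blast
  define R where "R j = qform S Q' (u j)" for j
  define \<tau> where "\<tau> j = wnorm S e (u j)" for j
  have tau: "0 \<le> \<tau> j" for j unfolding \<tau>_def using e(2) by (intro wnorm_nonneg) force
  have R: "0 < R j" if "j \<in> S" for j unfolding R_def by (rule u3[OF that])
  \<comment> \<open>The old diagonal bound at \<open>u j\<close>, where the shifted form takes the value \<open>R j\<close>.\<close>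
  have Rtau: "R j + \<delta> * \<tau> j \<le> \<rho> j" if j: "j \<in> S" for j
  proof -
    have "norm (u j j) = R j" unfolding u2[OF j] using R[OF j] by (simp add: R_def)
    moreover have "qform S Q (u j) = R j - \<delta> * \<tau> j" unfolding R_def \<tau>_def Q' by simp
    ultimately have *: "(R j)\<^sup>2 \<le> \<rho> j * (R j - \<delta> * \<tau> j)" using rho[OF j, of "u j"] by simp
    have pos: "0 < R j - \<delta> * \<tau> j"
    proof (rule ccontr)
      assume "\<not> ?thesis"
      then have "\<rho> j * (R j - \<delta> * \<tau> j) \<le> 0" using e(3)[OF j] by (simp add: mult_nonneg_nonpos)
      moreover have "0 < (R j)\<^sup>2" using R[OF j] by simp
      ultimately show False using * by linarith
    qed
    have "(R j + \<delta> * \<tau> j) * (R j - \<delta> * \<tau> j) \<le> (R j)\<^sup>2"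
      using zero_le_square[of "\<delta> * \<tau> j"] by (simp add: power2_eq_square algebra_simps)
    then have "(R j + \<delta> * \<tau> j) * (R j - \<delta> * \<tau> j) \<le> \<rho> j * (R j - \<delta> * \<tau> j)" using * by linarith
    then show ?thesis using pos by simp
  qed
  have "\<forall>c. \<exists>y. \<forall>i\<in>S. kapply S Q' y i = g i c"
    by (rule allI, rule posdef_on_solve[OF fin pd])
  from choice[OF this] obtain y where y: "\<And>c i. i \<in> S \<Longrightarrow> kapply S Q' (y c) i = g i c"
    by blast
  have yj: "norm (y c j) = norm (\<Sum>i\<in>S. g c i * u j i)" if j: "j \<in> S" and c: "c < n" for c j
  proof -
    have "y c j = sesq S (u j) (\<lambda>i. g i c)"
      unfolding u1[OF j, symmetric] by (rule sesq_cong) (simp_all add: y)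
    then have "conjugate (y c j) = sesq S (\<lambda>i. g i c) (u j)"
      using sesq_conjugate[OF fin] by simp
    also have "\<dots> = (\<Sum>i\<in>S. g c i * u j i)"
      unfolding sesq_def
    proof (rule sum.cong[OF refl])
      fix i assume "i \<in> S"
      then have "i < n" using S by auto
      then show "conjugate (g i c) * u j i = g c i * u j i" using gram_swap[OF _ c] by simp
    qed
    finally show ?thesis by (metis norm_conjugate)
  qed
  have ysum: "(\<Sum>c\<in>{..<n} - S. (norm (y c j))\<^sup>2) \<le> k * (R j + 2 * \<tau> j)" if j: "j \<in> S" for j
  proof -
    have "(\<Sum>c\<in>{..<n} - S. (norm (y c j))\<^sup>2) \<le> (\<Sum>c<n. (norm (y c j))\<^sup>2)"
      by (rule sum_mono2) auto
    also have "\<dots> = (\<Sum>c<n. (norm (\<Sum>i\<in>S. g c i * u j i))\<^sup>2)"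
      using yj[OF j] by (intro sum.cong) auto
    also have "\<dots> \<le> k * qform S g (u j)" by (rule gram_bound[OF S])
    also have "\<dots> \<le> k * (qform S Q' (u j) + 2 * wnorm S e (u j))"
      unfolding Q'_def
      by (intro mult_left_mono gram_le_barrier[OF fin])
        (use k_ge_1 lam delta e(2) R[OF j] in \<open>auto simp: R_def Q'_def\<close>)
    finally show ?thesis by (simp add: R_def \<tau>_def)
  qed
  define \<beta> where "\<beta> c = qform S Q' (y c)" for c
  have beta0: "0 \<le> \<beta> c" for c unfolding \<beta>_def by (rule posdef_imp_psd[OF pd])
  have beta: "2 * \<beta> c \<le> (\<Sum>j\<in>S. (norm (g j c))\<^sup>2 + e j * (norm (y c j))\<^sup>2)" for c
  proof -
    have "sesq S (y c) (kapply S Q' (y c)) = sesq S (y c) (\<lambda>i. g i c)"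
      by (rule sesq_cong) (simp_all add: y)
    then have "\<beta> c \<le> norm (sesq S (y c) (\<lambda>i. g i c))"
      unfolding \<beta>_def qform_def by (simp add: re_le_norm)
    also have "\<dots> \<le> (\<Sum>i\<in>S. norm (y c i) * norm (g i c))" by (rule sesq_norm_le[OF fin])
    finally have "2 * \<beta> c \<le> (\<Sum>i\<in>S. 2 * (norm (y c i) * norm (g i c)))"
      by (simp add: sum_distrib_left[symmetric])
    also have "\<dots> \<le> (\<Sum>j\<in>S. (norm (g j c))\<^sup>2 + e j * (norm (y c j))\<^sup>2)"
    proof (rule sum_mono)
      fix i assume "i \<in> S"
      have "1 * (norm (y c i))\<^sup>2 \<le> e i * (norm (y c i))\<^sup>2"
        by (rule mult_right_mono[OF e(2)[OF \<open>i \<in> S\<close>]]) simp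
      then show "2 * (norm (y c i) * norm (g i c)) \<le> (norm (g i c))\<^sup>2 + e i * (norm (y c i))\<^sup>2"
        using sum_squares_bound[of "norm (y c i)" "norm (g i c)"] by simp
    qed
    finally show ?thesis .
  qed
  have new: "barrier (insert c S) (\<mu> + \<delta>) (e(c := 1 + \<theta> + \<beta> c))
        (\<lambda>j. if j = c then 1 / \<theta> else R j + (norm (y c j))\<^sup>2 / \<theta>)"
    if c: "c \<in> {..<n} - S" for c
  proof -
    define e' where "e' = e(c := 1 + \<theta> + \<beta> c)"
    define Qn where "Qn = barrier_kernel (\<mu> + \<delta>) e'"
    have cS: "c \<notin> S" "c < n" "insert c S \<subseteq> {..<n}" using c S by auto
    have hermn: "hermitian_on (insert c S) Qn" unfolding Qn_def by (rule hermitian_on_barrier_kernel[OF cS(3)])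
    have QnS: "Qn i j = Q' i j" if "i \<in> S" for i j
      using that cS(1) by (auto simp: Qn_def Q'_def barrier_kernel_def e'_def)
    \<comment> \<open>Completing the square in the new variable.\<close>
    have key: "qform S Q' (\<lambda>i. x i + (of_real \<epsilon> * x c) * y c i) + \<theta> * (norm (x c))\<^sup>2
        \<le> qform (insert c S) Qn x" for x
    proof -
      define w where "w = (\<Sum>i\<in>S. g c i * x i)"
      have 1: "sesq S (y c) (kapply S Q' x) = w"
      proof -
        have "sesq S (y c) (kapply S Q' x) = sesq S (\<lambda>i. g i c) x"
          unfolding sesq_kapply_swap[OF fin herm, symmetric] by (rule sesq_cong) (simp_all add: y)
        also have "\<dots> = w"
          unfolding sesq_def w_def using S cS(2) by (intro sum.cong) (auto simp: gram_swap)
        finally show ?thesis .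
      qed
      have 2: "kapply S Qn x c = of_real \<epsilon> * w"
      proof -
        have "Qn c j = of_real \<epsilon> * g c j" if "j \<in> S" for j
          using that cS(1) by (auto simp: Qn_def barrier_kernel_def)
        then show ?thesis unfolding kapply_def w_def sum_distrib_left
          by (intro sum.cong) (auto simp: mult_ac)
      qed
      have 3: "re (Qn c c) = (\<mu> + \<delta>) * (1 + \<theta> + \<beta> c) - 1"
      proof -
        have "Qn c c = of_real ((\<mu> + \<delta>) * (1 + \<theta> + \<beta> c) - 1)"
          by (simp add: Qn_def barrier_kernel_def e'_def gram_diag[OF cS(2)])
        then show ?thesis by (simp only: re_of_real)
      qed
      have 4: "qform S Qn x = qform S Q' x"
        unfolding qform_def kapply_def using QnS
        by (intro arg_cong[of _ _ re] sesq_cong sum.cong) auto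
      have eps2: "(norm (of_real \<epsilon> * x c))\<^sup>2 = (norm (x c))\<^sup>2"
        using sign by (auto simp: norm_mult)
      have cross: "conjugate (of_real \<epsilon> * x c) * w = conjugate (x c) * (of_real \<epsilon> * w)"
        by (simp add: conjugate_dist_mul)
      have "qform S Q' (\<lambda>i. x i + (of_real \<epsilon> * x c) * y c i)
          = qform S Q' x + 2 * re (conjugate (x c) * (of_real \<epsilon> * w)) + (norm (x c))\<^sup>2 * \<beta> c"
        unfolding qform_add_scale[OF fin herm] 1 cross eps2 \<beta>_def ..
      moreover have "qform (insert c S) Qn x = qform S Q' x
          + 2 * re (conjugate (x c) * (of_real \<epsilon> * w))
          + ((\<mu> + \<delta>) * (1 + \<theta> + \<beta> c) - 1) * (norm (x c))\<^sup>2"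
        unfolding qform_insert[OF fin cS(1) hermn] 2 3 4 ..
      moreover have "(\<theta> + \<beta> c) * (norm (x c))\<^sup>2
          \<le> ((\<mu> + \<delta>) * (1 + \<theta> + \<beta> c) - 1) * (norm (x c))\<^sup>2"
      proof (rule mult_right_mono)
        have "1 * (1 + \<theta> + \<beta> c) \<le> (\<mu> + \<delta>) * (1 + \<theta> + \<beta> c)"
          using lam delta theta beta0[of c] by (intro mult_right_mono) auto
        then show "\<theta> + \<beta> c \<le> (\<mu> + \<delta>) * (1 + \<theta> + \<beta> c) - 1" by simp
      qed simp
      ultimately show ?thesis by (simp add: algebra_simps)
    qed
    have bound: "(norm (x j))\<^sup>2 \<le> (if j = c then 1 / \<theta> else R j + (norm (y c j))\<^sup>2 / \<theta>)
        * qform (insert c S) Qn x" if j: "j \<in> insert c S" for x j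
    proof -
      define z where "z = (\<lambda>i. x i + (of_real \<epsilon> * x c) * y c i)"
      have zpos: "0 \<le> qform S Q' z" by (rule posdef_imp_psd[OF pd])
      have keyz: "qform S Q' z + \<theta> * (norm (x c))\<^sup>2 \<le> qform (insert c S) Qn x"
        unfolding z_def by (rule key)
      show ?thesis
      proof (cases "j = c")
        case True
        have "\<theta> * (norm (x c))\<^sup>2 \<le> qform (insert c S) Qn x" using keyz zpos by linarith
        then show ?thesis using True theta by (simp add: field_simps)
      next
        case False
        with j have jS: "j \<in> S" by simp
        have "x j = z j - (of_real \<epsilon> * x c) * y c j" by (simp add: z_def)
        then have "norm (x j) \<le> norm (z j) + norm ((of_real \<epsilon> * x c) * y c j)"
          by (simp add: norm_triangle_ineq4)
        also have "norm ((of_real \<epsilon> * x c) * y c j) = norm (x c) * norm (y c j)"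
          using sign by (auto simp: norm_mult)
        finally have "(norm (x j))\<^sup>2 \<le> (norm (z j) + norm (x c) * norm (y c j))\<^sup>2"
          by (intro power_mono) auto
        also have "\<dots> \<le> (R j + (norm (y c j))\<^sup>2 / \<theta>) * (qform S Q' z + \<theta> * (norm (x c))\<^sup>2)"
          by (rule sum_square_le_product)
            (use u4[OF jS, of z] R[OF jS] zpos theta in \<open>auto simp: R_def power_mult_distrib\<close>)
        also have "\<dots> \<le> (R j + (norm (y c j))\<^sup>2 / \<theta>) * qform (insert c S) Qn x"
          using R[OF jS] theta by (intro mult_left_mono keyz) auto
        finally show ?thesis using False by simp
      qed
    qed
    have nonneg: "0 \<le> qform (insert c S) Qn x" for x
    proof -
      have "0 \<le> qform S Q' (\<lambda>i. x i + (of_real \<epsilon> * x c) * y c i)" by (rule posdef_imp_psd[OF pd])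
      moreover have "0 \<le> \<theta> * (norm (x c))\<^sup>2" using theta by simp
      ultimately show ?thesis using key[of x] by linarith
    qed
    have "1 + \<theta> \<le> e' i \<and> 0 \<le> (if i = c then 1 / \<theta> else R i + (norm (y c i))\<^sup>2 / \<theta>)"
      if i: "i \<in> insert c S" for i
    proof (cases "i = c")
      case True
      then show ?thesis using theta beta0[of c] by (simp add: e'_def)
    next
      case False
      with i have iS: "i \<in> S" by simp
      show ?thesis using False e(1)[OF iS] R[OF iS] theta by (simp add: e'_def)
    qed
    with bound nonneg show ?thesis
      unfolding barrier_def Qn_def[symmetric] e'_def[symmetric] by blast
  qed
  show ?thesis
    by (intro exI[of _ \<tau>] exI[of _ R] exI[of _ \<beta>] exI[of _ y] conjI ballI)
      (use tau R Rtau ysum beta new in \<open>auto intro: less_imp_le\<close>)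
qed

end

section \<open>Averaging over subsets\<close>

definition subsets_of_size :: "nat \<Rightarrow> nat \<Rightarrow> nat set set" where
  "subsets_of_size n t = {\<sigma>. \<sigma> \<subseteq> {..<n} \<and> card \<sigma> = t}"

lemma finite_subsets_of_size [simp]: "finite (subsets_of_size n t)"
  unfolding subsets_of_size_def by (rule finite_subset[of _ "Pow {..<n}"]) auto

lemma card_subsets_of_size: "card (subsets_of_size n t) = n choose t"
  unfolding subsets_of_size_def using n_subsets[of "{..<n}" t] by simp

text \<open>Both sides sum over the pairs of a \<open>t + 1\<close>-set and one of its elements.  This replaces
  conditional expectations along a random ordering of the chosen set.\<close>

lemma sum_over_one_element_extensions:
  fixes W :: "nat set \<Rightarrow> nat \<Rightarrow> real"
  shows "(\<Sum>\<sigma>\<in>subsets_of_size n (Suc t). \<Sum>c\<in>\<sigma>. W (\<sigma> - {c}) c)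
    = (\<Sum>S\<in>subsets_of_size n t. \<Sum>c\<in>{..<n} - S. W S c)"
proof -
  have fin: "finite \<sigma>" if "\<sigma> \<in> subsets_of_size n t" for \<sigma> t
    using that finite_subset[of \<sigma> "{..<n}"] by (simp add: subsets_of_size_def)
  have "(\<Sum>\<sigma>\<in>subsets_of_size n (Suc t). \<Sum>c\<in>\<sigma>. W (\<sigma> - {c}) c)
      = (\<Sum>(\<sigma>, c)\<in>Sigma (subsets_of_size n (Suc t)) (\<lambda>\<sigma>. \<sigma>). W (\<sigma> - {c}) c)"
    by (rule sum.Sigma) (auto intro: fin)
  also have "\<dots> = (\<Sum>(S, c)\<in>Sigma (subsets_of_size n t) (\<lambda>S. {..<n} - S). W S c)"
  proof (rule sum.reindex_bij_witness[where j = "\<lambda>(\<sigma>, c). (\<sigma> - {c}, c)" and i = "\<lambda>(S, c). (insert c S, c)"])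
    fix a assume "a \<in> Sigma (subsets_of_size n (Suc t)) (\<lambda>\<sigma>. \<sigma>)"
    then obtain \<sigma> c where a: "a = (\<sigma>, c)" "\<sigma> \<in> subsets_of_size n (Suc t)" "c \<in> \<sigma>" by auto
    show "(case case a of (\<sigma>, c) \<Rightarrow> (\<sigma> - {c}, c) of (S, c) \<Rightarrow> (insert c S, c)) = a"
      using a by auto
    show "(case a of (\<sigma>, c) \<Rightarrow> (\<sigma> - {c}, c)) \<in> Sigma (subsets_of_size n t) (\<lambda>S. {..<n} - S)"
      using a fin[OF a(2)] by (auto simp: subsets_of_size_def)
    show "(case case a of (\<sigma>, c) \<Rightarrow> (\<sigma> - {c}, c) of (S, c) \<Rightarrow> W S c) = (case a of (\<sigma>, c) \<Rightarrow> W (\<sigma> - {c}) c)"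
      using a by simp
  next
    fix b assume "b \<in> Sigma (subsets_of_size n t) (\<lambda>S. {..<n} - S)"
    then obtain S c where b: "b = (S, c)" "S \<in> subsets_of_size n t" "c < n" "c \<notin> S" by auto
    show "(case case b of (S, c) \<Rightarrow> (insert c S, c) of (\<sigma>, c) \<Rightarrow> (\<sigma> - {c}, c)) = b"
      using b by simp
    show "(case b of (S, c) \<Rightarrow> (insert c S, c)) \<in> Sigma (subsets_of_size n (Suc t)) (\<lambda>\<sigma>. \<sigma>)"
      using b fin[OF b(2)] by (auto simp: subsets_of_size_def)
  qed
  also have "\<dots> = (\<Sum>S\<in>subsets_of_size n t. \<Sum>c\<in>{..<n} - S. W S c)"
    by (rule sum.Sigma[symmetric]) auto
  finally show ?thesis .
qed

lemma Suc_mult_binomial_Suc: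
  assumes "t \<le> n"
  shows "real (Suc t) * real (n choose Suc t) = (real n - real t) * real (n choose t)"
proof -
  have "Suc t * (n choose Suc t) = (n - t) * (n choose t)"
    by (metis binomial_absorb_comp binomial_absorption)
  then have "real (Suc t * (n choose Suc t)) = real ((n - t) * (n choose t))" by simp
  then show ?thesis using assms by (simp only: of_nat_mult of_nat_diff)
qed

context gram_barrier
begin

text \<open>The potential \<open>trace (E Q\<^sup>-\<^sup>1)\<close> plus a multiple of the total excess of \<open>E\<close> over \<open>1 + \<theta>\<close>.  The
  factor \<open>4 / \<theta>\<^sup>2\<close> is so large that a bound of order \<open>s / \<theta>\<close> on the weight makes the excess at most of order
  \<open>\<theta> s\<close>.\<close>

definition weight :: "nat set \<Rightarrow> (nat \<Rightarrow> real) \<Rightarrow> (nat \<Rightarrow> real) \<Rightarrow> real" where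
  "weight S e \<rho> = (\<Sum>i\<in>S. e i * \<rho> i) + 4 / \<theta>\<^sup>2 * (\<Sum>i\<in>S. e i - 1 - \<theta>)"

definition attainable :: "nat set \<Rightarrow> real \<Rightarrow> real \<Rightarrow> bool" where
  "attainable S \<mu> V \<longleftrightarrow> (\<exists>e \<rho>. barrier S \<mu> e \<rho> \<and> weight S e \<rho> \<le> V)"

lemma attainable_mono: "attainable S \<mu> V \<Longrightarrow> V \<le> V' \<Longrightarrow> attainable S \<mu> V'"
  unfolding attainable_def by (meson order_trans)

lemma weight_parts_nonneg:
  assumes "barrier S \<mu> e \<rho>"
  shows "0 \<le> (\<Sum>i\<in>S. e i * \<rho> i)" "0 \<le> (\<Sum>i\<in>S. e i - 1 - \<theta>)"
proof -
  have e: "1 + \<theta> \<le> e i" "0 \<le> \<rho> i" if "i \<in> S" for i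
    using assms that unfolding barrier_def by blast+
  show "0 \<le> (\<Sum>i\<in>S. e i * \<rho> i)"
  proof (rule sum_nonneg)
    fix i assume "i \<in> S"
    from e[OF this] theta show "0 \<le> e i * \<rho> i" by (intro mult_nonneg_nonneg) linarith+
  qed
  show "0 \<le> (\<Sum>i\<in>S. e i - 1 - \<theta>)"
  proof (rule sum_nonneg)
    fix i assume "i \<in> S"
    from e[OF this] show "0 \<le> e i - 1 - \<theta>" by linarith
  qed
qed

lemma attainable_nonneg:
  assumes "attainable S \<mu> V" shows "0 \<le> V"
proof -
  obtain e \<rho> where bar: "barrier S \<mu> e \<rho>" and wV: "weight S e \<rho> \<le> V"
    using assms unfolding attainable_def by blast
  have "0 \<le> 4 / \<theta>\<^sup>2 * (\<Sum>i\<in>S. e i - 1 - \<theta>)"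
    using weight_parts_nonneg(2)[OF bar] theta by (intro mult_nonneg_nonneg) auto
  then show ?thesis using wV weight_parts_nonneg(1)[OF bar] unfolding weight_def by linarith
qed

lemma gram_column_bound:
  assumes "j < n"
  shows "(\<Sum>c<n. (norm (g j c))\<^sup>2) \<le> k"
proof -
  have "norm (g j c) = norm (g c j)" if "c < n" for c
    by (metis norm_conjugate gram_swap[OF that assms])
  then have "(\<Sum>c<n. (norm (g j c))\<^sup>2) = (\<Sum>c<n. (norm (\<Sum>l\<in>{j}. g c l * (\<lambda>_. 1) l))\<^sup>2)"
    by simp
  also have "\<dots> \<le> k * qform {j} g (\<lambda>_. 1)"
    by (rule gram_bound) (use assms in auto)
  also have "qform {j} g (\<lambda>_. 1) = 1"
    using gram_diag[OF assms] re_of_real[of 1, where 'a='a] by (simp add: qform_def sesq_def kapply_def)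
  finally show ?thesis by simp
qed

text \<open>The arithmetic of one averaged step: \<open>N\<close> unused columns, potential \<open>P\<close>, excess \<open>Z\<close>, and \<open>T\<close> the
  quadratic term.  The gain \<open>\<theta> / s * T\<close> from raising \<open>\<mu>\<close> pays for the occurrence of \<open>T\<close> in the
  bound on \<open>Y\<close>; this is where \<open>s\<close> has to be small compared with \<open>n / k\<close>.\<close>

lemma average_bound:
  fixes s t N P T Z Y B V :: real
  assumes s: "0 < s" "0 \<le> t" "t \<le> s" and small: "16 * k * s \<le> \<theta>^3 * real n" and N: "real n \<le> 2 * N"
    and nonneg: "0 \<le> P" "0 \<le> T" "0 \<le> Z"
    and Y: "Y \<le> k * (P + 2 * T)" and B: "2 * B \<le> k * t + Y"
    and V: "P + \<theta> / s * T + 4 / \<theta>\<^sup>2 * Z \<le> V"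
  shows "N * P + Y / \<theta> + N * ((1 + \<theta>) / \<theta>) + N * (4 / \<theta>\<^sup>2 * Z) + (1 / \<theta> + 4 / \<theta>\<^sup>2) * B
    \<le> N * (V * (1 + \<theta> / (2 * s)) + 2 / \<theta>)"
proof -
  define a where "a = 3 / (2 * \<theta>) + 2 / \<theta>\<^sup>2"
  define b where "b = (1 / \<theta> + 4 / \<theta>\<^sup>2) / 2"
  have ab: "0 \<le> b" "b \<le> a" "a = 1 / \<theta> + b"
    unfolding a_def b_def using theta by (auto simp: field_simps)
  have "a \<le> 4 / \<theta>\<^sup>2"
    unfolding a_def using theta by (simp add: field_simps power2_eq_square)
  then have "a * (k * s) \<le> 4 / \<theta>\<^sup>2 * (k * s)"
    using k_ge_1 s by (intro mult_right_mono) auto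
  also have "\<dots> \<le> 4 / \<theta>\<^sup>2 * (\<theta>^3 * real n / 16)"
    using small theta by (intro mult_left_mono) auto
  also have "\<dots> = \<theta> * real n / 4" using theta by (simp add: field_simps power2_eq_square power3_eq_cube)
  also have "\<dots> \<le> N * \<theta> / 2" using N theta by simp
  finally have ak: "a * k \<le> N * \<theta> / (2 * s)" using s by (simp add: field_simps)
  have N0: "0 \<le> N" using N by linarith
  have "a * Y \<le> a * (k * (P + 2 * T))" using ab Y by (intro mult_left_mono) auto
  also have "\<dots> = (a * k) * (P + 2 * T)" by simp
  also have "\<dots> \<le> N * \<theta> / (2 * s) * (P + 2 * T)" using ak nonneg by (intro mult_right_mono) auto
  finally have 1: "a * Y \<le> N * (\<theta> / (2 * s) * P + \<theta> / s * T)" using s by (simp add: field_simps)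
  have "b * (k * t) \<le> a * k * t" using ab k_ge_1 s by (simp add: mult_right_mono)
  also have "\<dots> \<le> N * \<theta> / (2 * s) * s"
    using ak s N0 theta by (intro mult_mono) auto
  also have "\<dots> = N * (\<theta> / 2)" using s by simp
  also have "\<dots> \<le> N * ((1 - \<theta>) / \<theta>)"
  proof (rule mult_left_mono[OF _ N0])
    have "\<theta> * \<theta> \<le> 1 / 2 * (1 / 2)" using theta by (intro mult_mono) auto
    then show "\<theta> / 2 \<le> (1 - \<theta>) / \<theta>" using theta by (simp add: field_simps)
  qed
  finally have 2: "b * (k * t) \<le> N * ((1 - \<theta>) / \<theta>)" .
  have "(1 / \<theta> + 4 / \<theta>\<^sup>2) * B = b * (2 * B)" by (simp add: b_def)
  also have "\<dots> \<le> b * (k * t + Y)" using ab B by (intro mult_left_mono) auto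
  finally have 3: "(1 / \<theta> + 4 / \<theta>\<^sup>2) * B \<le> b * (k * t) + b * Y" by (simp add: distrib_left)
  have 4: "a * Y = Y / \<theta> + b * Y" by (simp add: ab(3) distrib_right)
  have 5: "N * ((1 - \<theta>) / \<theta>) + N * ((1 + \<theta>) / \<theta>) = N * (2 / \<theta>)"
    using theta by (simp add: field_simps)
  define V0 where "V0 = P + \<theta> / s * T + 4 / \<theta>\<^sup>2 * Z"
  have "P \<le> V0" using nonneg s theta unfolding V0_def by simp
  then have "V0 + \<theta> / (2 * s) * P \<le> V0 + \<theta> / (2 * s) * V0"
    using theta s by (intro add_left_mono mult_left_mono) auto
  also have "\<dots> = V0 * (1 + \<theta> / (2 * s))" by (simp add: algebra_simps)
  also have "\<dots> \<le> V * (1 + \<theta> / (2 * s))"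
    using V theta s unfolding V0_def by (intro mult_right_mono) auto
  finally have "N * (V0 + \<theta> / (2 * s) * P) \<le> N * (V * (1 + \<theta> / (2 * s)))"
    by (rule mult_left_mono[OF _ N0])
  then have 6: "N * P + N * (\<theta> / s * T) + N * (4 / \<theta>\<^sup>2 * Z) + N * (\<theta> / (2 * s) * P)
      \<le> N * (V * (1 + \<theta> / (2 * s)))"
    unfolding V0_def by (simp only: distrib_left)
  show ?thesis unfolding distrib_left[of N "V * (1 + \<theta> / (2 * s))"]
    using 1 2 3 4 5 6 unfolding distrib_left[of N "\<theta> / (2 * s) * P"] by linarith
qed

text \<open>The averaged form of \<open>barrier_step\<close>: summing over the unused columns \<open>c\<close> replaces \<open>\<beta> c\<close> and
  \<open>y c\<close>, which may be large for a single column, by the bounds on their sums.\<close>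

lemma attainable_step:
  assumes S: "S \<subseteq> {..<n}" and card: "card S < s" and small: "16 * k * real s \<le> \<theta>^3 * real n"
    and att: "attainable S \<mu> V" and mu: "1 \<le> \<mu>" "\<mu> + \<theta> / s \<le> 2"
  shows "\<exists>V'. (\<forall>c\<in>{..<n} - S. attainable (insert c S) (\<mu> + \<theta> / s) (V' c)) \<and>
    (\<Sum>c\<in>{..<n} - S. V' c) \<le> (real n - real (card S)) * (V * (1 + \<theta> / (2 * real s)) + 2 / \<theta>)"
proof -
  have fin: "finite S" using S finite_subset by blast
  have s0: "0 < real s" using card by simp
  have delta: "0 < \<theta> / real s" using s0 theta by simp
  obtain e \<rho> where bar: "barrier S \<mu> e \<rho>" and wV: "weight S e \<rho> \<le> V"
    using att unfolding attainable_def by blast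
  obtain \<tau> R \<beta> and y :: "nat \<Rightarrow> nat \<Rightarrow> 'a" where
    old: "\<forall>j\<in>S. 0 \<le> \<tau> j \<and> 0 \<le> R j \<and> R j + \<theta> / s * \<tau> j \<le> \<rho> j \<and>
      (\<Sum>c\<in>{..<n} - S. (norm (y c j))\<^sup>2) \<le> k * (R j + 2 * \<tau> j)" and
    added: "\<forall>c\<in>{..<n} - S. 2 * \<beta> c \<le> (\<Sum>j\<in>S. (norm (g j c))\<^sup>2 + e j * (norm (y c j))\<^sup>2) \<and>
      barrier (insert c S) (\<mu> + \<theta> / s) (e(c := 1 + \<theta> + \<beta> c))
        (\<lambda>j. if j = c then 1 / \<theta> else R j + (norm (y c j))\<^sup>2 / \<theta>)"
    using barrier_step[OF S bar mu delta] by (elim exE conjE)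
  have tau: "0 \<le> \<tau> j" and R: "0 \<le> R j" and rho: "R j + \<theta> / s * \<tau> j \<le> \<rho> j" and
    ysum: "(\<Sum>c\<in>{..<n} - S. (norm (y c j))\<^sup>2) \<le> k * (R j + 2 * \<tau> j)" if "j \<in> S" for j
    using bspec[OF old that] by blast+
  have beta: "2 * \<beta> c \<le> (\<Sum>j\<in>S. (norm (g j c))\<^sup>2 + e j * (norm (y c j))\<^sup>2)" and
    new: "barrier (insert c S) (\<mu> + \<theta> / s) (e(c := 1 + \<theta> + \<beta> c))
        (\<lambda>j. if j = c then 1 / \<theta> else R j + (norm (y c j))\<^sup>2 / \<theta>)" if "c \<in> {..<n} - S" for c
    using bspec[OF added that] by blast+
  define V' where "V' c = weight (insert c S) (e(c := 1 + \<theta> + \<beta> c))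
        (\<lambda>j. if j = c then 1 / \<theta> else R j + (norm (y c j))\<^sup>2 / \<theta>)" for c
  define P where "P = (\<Sum>j\<in>S. e j * R j)"
  define T where "T = (\<Sum>j\<in>S. e j * \<tau> j)"
  define Z where "Z = (\<Sum>j\<in>S. e j - 1 - \<theta>)"
  define Y where "Y = (\<Sum>c\<in>{..<n} - S. \<Sum>j\<in>S. e j * (norm (y c j))\<^sup>2)"
  define B where "B = (\<Sum>c\<in>{..<n} - S. \<beta> c)"
  define N where "N = real n - real (card S)"
  have e0: "0 \<le> e j" if "j \<in> S" for j
  proof -
    have "1 + \<theta> \<le> e j" using bar that unfolding barrier_def by blast
    then show ?thesis using theta by linarith
  qed
  have cardle: "card S \<le> n" using card_mono[OF _ S] by simp
  have cardN: "real (card ({..<n} - S)) = N"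
    unfolding N_def using card_Diff_subset[OF fin S] cardle by (simp add: of_nat_diff)
  have V'_eq: "V' c = P + (\<Sum>j\<in>S. e j * (norm (y c j))\<^sup>2) / \<theta> + (1 + \<theta>) / \<theta> + 4 / \<theta>\<^sup>2 * Z
      + (1 / \<theta> + 4 / \<theta>\<^sup>2) * \<beta> c" if "c \<in> {..<n} - S" for c
  proof -
    have cS: "c \<notin> S" using that by simp
    have "(\<Sum>i\<in>insert c S. (e(c := 1 + \<theta> + \<beta> c)) i * (if i = c then 1 / \<theta> else R i + (norm (y c i))\<^sup>2 / \<theta>))
        = (1 + \<theta> + \<beta> c) / \<theta> + (\<Sum>i\<in>S. e i * (R i + (norm (y c i))\<^sup>2 / \<theta>))"
      using fin cS by (simp add: sum.insert) (intro sum.cong, auto)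
    also have "(\<Sum>i\<in>S. e i * (R i + (norm (y c i))\<^sup>2 / \<theta>)) = P + (\<Sum>j\<in>S. e j * (norm (y c j))\<^sup>2) / \<theta>"
      by (simp add: P_def distrib_left sum.distrib sum_divide_distrib)
    finally have 1: "(\<Sum>i\<in>insert c S. (e(c := 1 + \<theta> + \<beta> c)) i * (if i = c then 1 / \<theta> else R i + (norm (y c i))\<^sup>2 / \<theta>))
        = (1 + \<theta> + \<beta> c) / \<theta> + (P + (\<Sum>j\<in>S. e j * (norm (y c j))\<^sup>2) / \<theta>)" .
    have 2: "(\<Sum>i\<in>insert c S. (e(c := 1 + \<theta> + \<beta> c)) i - 1 - \<theta>) = \<beta> c + Z"
      unfolding Z_def using fin cS by (simp add: sum.insert) (intro sum.cong, auto)
    show ?thesis unfolding V'_def weight_def 1 2 by (simp add: add_divide_distrib algebra_simps)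
  qed
  have sumV: "(\<Sum>c\<in>{..<n} - S. V' c) = N * P + Y / \<theta> + N * ((1 + \<theta>) / \<theta>) + N * (4 / \<theta>\<^sup>2 * Z)
      + (1 / \<theta> + 4 / \<theta>\<^sup>2) * B"
  proof -
    have "(\<Sum>c\<in>{..<n} - S. V' c) = (\<Sum>c\<in>{..<n} - S. P + (\<Sum>j\<in>S. e j * (norm (y c j))\<^sup>2) / \<theta>
        + (1 + \<theta>) / \<theta> + 4 / \<theta>\<^sup>2 * Z + (1 / \<theta> + 4 / \<theta>\<^sup>2) * \<beta> c)"
      by (rule sum.cong[OF refl V'_eq])
    also have "\<dots> = real (card ({..<n} - S)) * P + Y / \<theta> + real (card ({..<n} - S)) * ((1 + \<theta>) / \<theta>)
        + real (card ({..<n} - S)) * (4 / \<theta>\<^sup>2 * Z) + (1 / \<theta> + 4 / \<theta>\<^sup>2) * B"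
      unfolding Y_def B_def sum.distrib sum_constant sum_distrib_left sum_divide_distrib ..
    finally show ?thesis unfolding cardN .
  qed
  have "Y = (\<Sum>j\<in>S. e j * (\<Sum>c\<in>{..<n} - S. (norm (y c j))\<^sup>2))"
    unfolding Y_def sum_distrib_left by (rule sum.swap)
  also have "\<dots> \<le> (\<Sum>j\<in>S. e j * (k * (R j + 2 * \<tau> j)))"
  proof (rule sum_mono)
    fix j assume j: "j \<in> S"
    show "e j * (\<Sum>c\<in>{..<n} - S. (norm (y c j))\<^sup>2) \<le> e j * (k * (R j + 2 * \<tau> j))"
      by (rule mult_left_mono[OF ysum[OF j] e0[OF j]])
  qed
  also have "\<dots> = k * (P + 2 * T)"
  proof -
    have "e j * (k * (R j + 2 * \<tau> j)) = k * (e j * R j) + 2 * k * (e j * \<tau> j)" for j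
      by (simp add: algebra_simps)
    then have "(\<Sum>j\<in>S. e j * (k * (R j + 2 * \<tau> j))) = k * P + 2 * k * T"
      unfolding P_def T_def by (simp only: sum.distrib sum_distrib_left)
    then show ?thesis by (simp add: distrib_left)
  qed
  finally have Y: "Y \<le> k * (P + 2 * T)" .
  have "2 * B \<le> (\<Sum>c\<in>{..<n} - S. \<Sum>j\<in>S. (norm (g j c))\<^sup>2 + e j * (norm (y c j))\<^sup>2)"
    unfolding B_def sum_distrib_left by (rule sum_mono) (rule beta)
  also have "\<dots> = (\<Sum>j\<in>S. \<Sum>c\<in>{..<n} - S. (norm (g j c))\<^sup>2) + Y"
    unfolding Y_def sum.distrib by (rule arg_cong2[of _ _ _ _ "(+)", OF sum.swap refl])
  also have "(\<Sum>j\<in>S. \<Sum>c\<in>{..<n} - S. (norm (g j c))\<^sup>2) \<le> (\<Sum>j\<in>S. k)"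
  proof (rule sum_mono)
    fix j assume "j \<in> S"
    have "(\<Sum>c\<in>{..<n} - S. (norm (g j c))\<^sup>2) \<le> (\<Sum>c<n. (norm (g j c))\<^sup>2)"
      by (rule sum_mono2) auto
    also have "\<dots> \<le> k" by (rule gram_column_bound) (use S \<open>j \<in> S\<close> in auto)
    finally show "(\<Sum>c\<in>{..<n} - S. (norm (g j c))\<^sup>2) \<le> k" .
  qed
  finally have B: "2 * B \<le> k * real (card S) + Y" by (simp add: mult.commute)
  have "P + \<theta> / s * T = (\<Sum>j\<in>S. e j * (R j + \<theta> / s * \<tau> j))"
  proof -
    have "e j * (R j + \<theta> / s * \<tau> j) = e j * R j + \<theta> / s * (e j * \<tau> j)" for j
      by (simp add: distrib_left)
    then show ?thesis unfolding P_def T_def by (simp only: sum.distrib sum_distrib_left)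
  qed
  also have "\<dots> \<le> (\<Sum>j\<in>S. e j * \<rho> j)" 
  proof (rule sum_mono)
    fix j assume j: "j \<in> S"
    show "e j * (R j + \<theta> / s * \<tau> j) \<le> e j * \<rho> j"
      by (rule mult_left_mono[OF rho[OF j] e0[OF j]])
  qed
  finally have V: "P + \<theta> / s * T + 4 / \<theta>\<^sup>2 * Z \<le> V" using wV unfolding weight_def Z_def by linarith
  have N: "real n \<le> 2 * N"
  proof -
    have "16 * real s \<le> 16 * k * real s" using k_ge_1 s0 by simp
    moreover have "\<theta>^3 \<le> 1" using theta by (intro power_le_one) auto
    then have "\<theta>^3 * real n \<le> real n" by (intro mult_left_le_one_le) (use theta in auto)
    ultimately have "16 * real s \<le> real n" using small by linarith
    moreover have "real (card S) \<le> real s" using card by simp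
    moreover have "a \<le> 2 * (a - c)" if "16 * b \<le> a" "c \<le> b" "0 < b" for a b c :: real
      using that by simp
    ultimately show ?thesis unfolding N_def using s0 by blast
  qed
  have "(\<Sum>c\<in>{..<n} - S. V' c) \<le> N * (V * (1 + \<theta> / (2 * real s)) + 2 / \<theta>)"
    unfolding sumV
  proof (rule average_bound[OF s0 _ _ small N _ _ _ Y B V])
    show "0 \<le> P" "0 \<le> T" unfolding P_def T_def using e0 R tau by (auto intro!: sum_nonneg)
    show "0 \<le> Z" unfolding Z_def by (rule weight_parts_nonneg(2)[OF bar])
  qed (use card in auto)
  moreover have "attainable (insert c S) (\<mu> + \<theta> / s) (V' c)" if "c \<in> {..<n} - S" for c
    unfolding attainable_def V'_def using new[OF that] by blast
  ultimately show ?thesis unfolding N_def by blast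
qed

text \<open>Starting from the empty set, the average weight grows in each step by the factor
  \<open>1 + \<theta> / (2 s)\<close> and the constant \<open>2 / \<theta>\<close>, so it stays linear in \<open>t\<close> up to \<open>t = s\<close>.  A set of size
  \<open>t + 1\<close> is reached through each of its elements, and the best way is at most the average.\<close>

lemma attainable_average:
  assumes s: "0 < s" and small: "16 * k * real s \<le> \<theta>^3 * real n" and sn: "s \<le> n"
  shows "t \<le> s \<Longrightarrow> \<exists>V. (\<forall>\<sigma>\<in>subsets_of_size n t. attainable \<sigma> (1 + \<theta> / s * t) (V \<sigma>)) \<and>
    (\<Sum>\<sigma>\<in>subsets_of_size n t. V \<sigma>) \<le> real (n choose t) * (4 * real t / \<theta>)"
proof (induction t)
  case 0
  have "subsets_of_size n 0 = {{}}"
    unfolding subsets_of_size_def by (auto simp: card_eq_0_iff dest: finite_subset)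
  moreover have "attainable {} 1 0"
    unfolding attainable_def barrier_def weight_def by (auto simp: qform_def sesq_def)
  ultimately show ?case by (intro exI[of _ "\<lambda>_. 0"]) simp
next
  case (Suc t)
  then have t: "t < s" "t \<le> n" using sn by auto
  obtain V where V: "\<And>S. S \<in> subsets_of_size n t \<Longrightarrow> attainable S (1 + \<theta> / s * t) (V S)"
    and sumV: "(\<Sum>S\<in>subsets_of_size n t. V S) \<le> real (n choose t) * (4 * real t / \<theta>)"
    using Suc by auto
  have mu: "1 \<le> 1 + \<theta> / s * t" "1 + \<theta> / s * t + \<theta> / s \<le> 2"
  proof -
    show "1 \<le> 1 + \<theta> / s * t" using theta by simp
    have "\<theta> / s * t + \<theta> / s = \<theta> / s * (real t + 1)" by (simp add: distrib_left)
    also have "\<dots> \<le> \<theta> / s * s" using t theta by (intro mult_left_mono) auto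
    also have "\<dots> = \<theta>" using s by simp
    finally show "1 + \<theta> / s * t + \<theta> / s \<le> 2" using theta by simp
  qed
  have mu_Suc: "1 + \<theta> / s * t + \<theta> / s = 1 + \<theta> / s * Suc t" by (simp add: algebra_simps add_divide_distrib)
  have "\<forall>S\<in>subsets_of_size n t. \<exists>V'. (\<forall>c\<in>{..<n} - S. attainable (insert c S) (1 + \<theta> / s * Suc t) (V' c)) \<and>
    (\<Sum>c\<in>{..<n} - S. V' c) \<le> (real n - real t) * (V S * (1 + \<theta> / (2 * real s)) + 2 / \<theta>)"
  proof
    fix S assume S: "S \<in> subsets_of_size n t"
    then have "S \<subseteq> {..<n}" "card S = t" by (auto simp: subsets_of_size_def)
    then show "\<exists>V'. (\<forall>c\<in>{..<n} - S. attainable (insert c S) (1 + \<theta> / s * Suc t) (V' c)) \<and>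
    (\<Sum>c\<in>{..<n} - S. V' c) \<le> (real n - real t) * (V S * (1 + \<theta> / (2 * real s)) + 2 / \<theta>)"
      using attainable_step[OF _ _ small V[OF S] mu] t unfolding mu_Suc by simp
  qed
  from bchoice[OF this] obtain W where
    W: "\<And>S c. S \<in> subsets_of_size n t \<Longrightarrow> c \<in> {..<n} - S \<Longrightarrow> attainable (insert c S) (1 + \<theta> / s * Suc t) (W S c)"
    and sumW: "\<And>S. S \<in> subsets_of_size n t \<Longrightarrow>
      (\<Sum>c\<in>{..<n} - S. W S c) \<le> (real n - real t) * (V S * (1 + \<theta> / (2 * real s)) + 2 / \<theta>)"
    by blast
  \<comment> \<open>The average over all ways of reaching \<open>\<sigma>\<close>; some way is at least as good.\<close>
  define V' where "V' \<sigma> = (\<Sum>c\<in>\<sigma>. W (\<sigma> - {c}) c) / real (Suc t)" for \<sigma>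
  have "attainable \<sigma> (1 + \<theta> / s * Suc t) (V' \<sigma>)" if \<sigma>: "\<sigma> \<in> subsets_of_size n (Suc t)" for \<sigma>
  proof -
    have sub: "\<sigma> \<subseteq> {..<n}" "card \<sigma> = Suc t" using \<sigma> by (auto simp: subsets_of_size_def)
    then have fin: "finite \<sigma>" using finite_subset by blast
    have "\<exists>c\<in>\<sigma>. W (\<sigma> - {c}) c \<le> V' \<sigma>"
    proof (rule ccontr)
      assume "\<not> ?thesis"
      then have "(\<Sum>c\<in>\<sigma>. V' \<sigma>) < (\<Sum>c\<in>\<sigma>. W (\<sigma> - {c}) c)"
        using fin sub by (intro sum_strict_mono) auto
      then show False unfolding V'_def using sub(2) by simp
    qed
    then obtain c where c: "c \<in> \<sigma>" "W (\<sigma> - {c}) c \<le> V' \<sigma>" by blast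
    have "\<sigma> - {c} \<in> subsets_of_size n t" using sub fin c by (auto simp: subsets_of_size_def)
    moreover have "c \<in> {..<n} - (\<sigma> - {c})" using sub c by auto
    ultimately have "attainable (insert c (\<sigma> - {c})) (1 + \<theta> / s * Suc t) (W (\<sigma> - {c}) c)" by (rule W)
    moreover have "insert c (\<sigma> - {c}) = \<sigma>" using c by auto
    ultimately show ?thesis using attainable_mono c(2) by simp
  qed
  moreover have "(\<Sum>\<sigma>\<in>subsets_of_size n (Suc t). V' \<sigma>) \<le> real (n choose Suc t) * (4 * real (Suc t) / \<theta>)"
  proof -
    have "real (Suc t) * (\<Sum>\<sigma>\<in>subsets_of_size n (Suc t). V' \<sigma>)
        = (\<Sum>\<sigma>\<in>subsets_of_size n (Suc t). \<Sum>c\<in>\<sigma>. W (\<sigma> - {c}) c)"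
      unfolding V'_def sum_divide_distrib[symmetric] by simp
    also have "\<dots> = (\<Sum>S\<in>subsets_of_size n t. \<Sum>c\<in>{..<n} - S. W S c)"
      by (rule sum_over_one_element_extensions)
    also have "\<dots> \<le> (\<Sum>S\<in>subsets_of_size n t. (real n - real t) * (V S * (1 + \<theta> / (2 * real s)) + 2 / \<theta>))"
      by (rule sum_mono) (rule sumW)
    also have "\<dots> = (real n - real t) * ((\<Sum>S\<in>subsets_of_size n t. V S) * (1 + \<theta> / (2 * real s))
        + real (n choose t) * (2 / \<theta>))"
      by (simp add: sum_distrib_left[symmetric] sum.distrib sum_distrib_right[symmetric] card_subsets_of_size)
    also have "\<dots> \<le> (real n - real t) * (real (n choose t) * (4 * real t / \<theta>) * (1 + \<theta> / (2 * real s))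
        + real (n choose t) * (2 / \<theta>))"
      using t theta sumV by (intro mult_left_mono add_right_mono mult_right_mono) auto
    also have "\<dots> = (real n - real t) * (real (n choose t) * (4 * real t / \<theta> * (1 + \<theta> / (2 * real s)) + 2 / \<theta>))"
      by (simp only: distrib_left[of "real (n choose t)"] mult.assoc)
    also have "\<dots> \<le> (real n - real t) * (real (n choose t) * (4 * real (Suc t) / \<theta>))"
    proof (intro mult_left_mono)
      have "4 * real t / \<theta> * (1 + \<theta> / (2 * real s)) = 4 * real t / \<theta> + 2 * (real t / real s)"
        using theta s by (simp add: field_simps)
      moreover have "real t / real s \<le> 1" using t by simp
      moreover have "2 \<le> 2 / \<theta>" using theta by (simp add: field_simps)
      moreover have "4 * real (Suc t) / \<theta> = 4 * real t / \<theta> + 2 / \<theta> + 2 / \<theta>"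
        by (simp add: add_divide_distrib distrib_left)
      ultimately show "4 * real t / \<theta> * (1 + \<theta> / (2 * real s)) + 2 / \<theta> \<le> 4 * real (Suc t) / \<theta>"
        by linarith
    qed (use t in auto)
    also have "\<dots> = real (Suc t) * (real (n choose Suc t) * (4 * real (Suc t) / \<theta>))"
      using Suc_mult_binomial_Suc[OF t(2)] by (simp only: mult.assoc[symmetric])
    finally show ?thesis by (rule mult_left_le_imp_le) simp
  qed
  ultimately show ?case by blast
qed

definition dominated :: "nat set \<Rightarrow> real \<Rightarrow> bool" where
  "dominated \<sigma> b \<longleftrightarrow> (\<exists>w. (\<forall>i\<in>\<sigma>. 0 \<le> w i) \<and> (\<Sum>i\<in>\<sigma>. w i) \<le> b \<and>
     (\<forall>x. 0 \<le> \<epsilon> * (qform \<sigma> g x - wnorm \<sigma> (\<lambda>_. 1) x) + wnorm \<sigma> w x))"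

lemma dominated_if_attainable:
  assumes fin: "finite \<sigma>" and card: "card \<sigma> = s" and s: "0 < s"
    and att: "attainable \<sigma> (1 + \<theta>) (16 * real s / \<theta>)"
  shows "dominated \<sigma> (11 * \<theta> * real s)"
proof -
  obtain e \<rho> where bar: "barrier \<sigma> (1 + \<theta>) e \<rho>" and wt: "weight \<sigma> e \<rho> \<le> 16 * real s / \<theta>"
    using att unfolding attainable_def by blast
  have e: "1 + \<theta> \<le> e i" if "i \<in> \<sigma>" for i using bar that unfolding barrier_def by blast
  have "4 / \<theta>\<^sup>2 * (\<Sum>i\<in>\<sigma>. e i - 1 - \<theta>) \<le> 16 * real s / \<theta>"
    using wt weight_parts_nonneg(1)[OF bar] unfolding weight_def by linarith
  then have excess: "(\<Sum>i\<in>\<sigma>. e i - 1 - \<theta>) \<le> 4 * \<theta> * real s"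
    using theta by (simp add: field_simps power2_eq_square)
  define w where "w i = (1 + \<theta>) * e i - 1" for i
  have "0 \<le> w i" if "i \<in> \<sigma>" for i
  proof -
    have "1 * 1 \<le> (1 + \<theta>) * e i" using e[OF that] theta by (intro mult_mono) auto
    then show ?thesis by (simp add: w_def)
  qed
  moreover have "(\<Sum>i\<in>\<sigma>. w i) \<le> 11 * \<theta> * real s"
  proof -
    have "w i = (1 + \<theta>) * (e i - 1 - \<theta>) + (2 * \<theta> + \<theta> * \<theta>)" for i
      by (simp add: w_def algebra_simps)
    then have "(\<Sum>i\<in>\<sigma>. w i) = (1 + \<theta>) * (\<Sum>i\<in>\<sigma>. e i - 1 - \<theta>) + real s * (2 * \<theta> + \<theta> * \<theta>)"
      using card by (simp add: sum.distrib sum_distrib_left)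
    also have "\<dots> \<le> 2 * (4 * \<theta> * real s) + real s * (2 * \<theta> + \<theta> * 1)"
      using excess theta weight_parts_nonneg(2)[OF bar]
      by (intro add_mono mult_mono mult_left_mono) auto
    finally show ?thesis by (simp add: algebra_simps)
  qed
  moreover have "0 \<le> \<epsilon> * (qform \<sigma> g x - wnorm \<sigma> (\<lambda>_. 1) x) + wnorm \<sigma> w x" for x
  proof -
    have "0 \<le> qform \<sigma> (barrier_kernel (1 + \<theta>) e) x" using bar unfolding barrier_def by blast
    then show ?thesis unfolding qform_barrier_kernel[OF fin] w_def wnorm_def
      by (simp add: algebra_simps sum_subtractf sum_distrib_left)
  qed
  ultimately show ?thesis unfolding dominated_def by blast
qed

text \<open>Markov's inequality: the average weight is at most \<open>4 s / \<theta>\<close>, and weight \<open>16 s / \<theta>\<close> suffices.\<close>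

lemma few_not_dominated:
  assumes s: "0 < s" and small: "16 * k * real s \<le> \<theta>^3 * real n" and sn: "s \<le> n"
  shows "4 * card {\<sigma>\<in>subsets_of_size n s. \<not> dominated \<sigma> (11 * \<theta> * real s)} \<le> n choose s"
proof -
  obtain V where V: "\<And>\<sigma>. \<sigma> \<in> subsets_of_size n s \<Longrightarrow> attainable \<sigma> (1 + \<theta>) (V \<sigma>)"
    and sumV: "(\<Sum>\<sigma>\<in>subsets_of_size n s. V \<sigma>) \<le> real (n choose s) * (4 * real s / \<theta>)"
    using attainable_average[OF assms order_refl] s by auto
  define B where "B = {\<sigma>\<in>subsets_of_size n s. \<not> dominated \<sigma> (11 * \<theta> * real s)}"
  have V0: "0 \<le> V \<sigma>" if "\<sigma> \<in> subsets_of_size n s" for \<sigma> using attainable_nonneg V that by blast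
  have large: "16 * real s / \<theta> \<le> V \<sigma>" if "\<sigma> \<in> B" for \<sigma>
  proof (rule ccontr)
    assume "\<not> ?thesis"
    then have less: "V \<sigma> \<le> 16 * real s / \<theta>" by simp
    have \<sigma>: "\<sigma> \<in> subsets_of_size n s" "\<not> dominated \<sigma> (11 * \<theta> * real s)" using that by (auto simp: B_def)
    then have "finite \<sigma>" "card \<sigma> = s" using s card.infinite by (fastforce simp: subsets_of_size_def)+
    then show False using dominated_if_attainable[OF _ _ s attainable_mono[OF V[OF \<sigma>(1)] less]] \<sigma>(2) by blast
  qed
  have "real (card B) * (16 * real s / \<theta>) = (\<Sum>\<sigma>\<in>B. 16 * real s / \<theta>)" by simp
  also have "\<dots> \<le> (\<Sum>\<sigma>\<in>B. V \<sigma>)" by (rule sum_mono) (rule large)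
  also have "\<dots> \<le> (\<Sum>\<sigma>\<in>subsets_of_size n s. V \<sigma>)"
    by (rule sum_mono2) (auto simp: B_def intro: V0)
  also note sumV
  also have "real (card B) * (16 * real s / \<theta>) = (4 * real (card B)) * (4 * real s / \<theta>)" by simp
  finally have "(4 * real (card B)) * (4 * real s / \<theta>) \<le> real (n choose s) * (4 * real s / \<theta>)" .
  moreover have "0 < 4 * real s / \<theta>" using s theta by simp
  ultimately have "4 * real (card B) \<le> real (n choose s)" by (rule mult_right_le_imp_le)
  then show ?thesis unfolding B_def by linarith
qed

end

section \<open>The objective of the convex program\<close>

abbreviation entries :: "'a mat \<Rightarrow> nat \<Rightarrow> nat \<Rightarrow> 'a" where
  "entries M \<equiv> \<lambda>i j. M $$ (i, j)"

lemma mult_mat_vec_kapply: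
  assumes "M \<in> carrier_mat a b" "v \<in> carrier_vec b" "i < a"
  shows "(M *\<^sub>v v) $ i = kapply {..<b} (entries M) (($) v) i"
  using assms by (simp add: scalar_prod_def kapply_def lessThan_atLeast0)

text \<open>The set of real eigenvalues is nonempty and its maximum is the top eigenvalue; without this, the
  definition of \<open>lambda_max\<close> as a maximum of a set would say nothing.\<close>

lemma lambda_max_entries:
  assumes M: "M \<in> carrier_mat N N" and N: "0 < N" and herm: "hermitian_on {..<N} (entries (M :: 'a::rc_scalar mat))"
  shows "qform {..<N} (entries M) x \<le> lambda_max M * wnorm {..<N} (\<lambda>_. 1) x"
    and "(\<And>x. qform {..<N} (entries M) x \<le> r * wnorm {..<N} (\<lambda>_. 1) x) \<Longrightarrow> lambda_max M \<le> r"
proof -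
  let ?P = "{r. eigenvalue M (of_real r)}"
  have fin: "finite ?P"
  proof (rule finite_imageD)
    show "finite ((of_real :: real \<Rightarrow> 'a) ` ?P)"
      by (rule finite_subset[OF _ card_finite_spectrum(1)[OF M]]) (auto simp: spectrum_def)
  qed (auto simp: inj_on_def)
  obtain r x where x: "\<exists>i\<in>{..<N}. x i \<noteq> 0"
    and eig: "\<And>i. i \<in> {..<N} \<Longrightarrow> kapply {..<N} (entries M) x i = of_real r * x i"
    and top: "\<And>y. qform {..<N} (entries M) y \<le> r * wnorm {..<N} (\<lambda>_. 1) y"
    using top_eigenvector[OF _ _ herm] N by (metis (no_types, lifting) finite_lessThan lessThan_empty_iff not_less_zero)
  have "eigenvalue M (of_real r)"
    unfolding eigenvalue_def eigenvector_def
  proof (intro exI[of _ "vec N x"] conjI)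
    show "vec N x \<in> carrier_vec (dim_row M)" using M by simp
    show "vec N x \<noteq> 0\<^sub>v (dim_row M)"
    proof
      assume *: "vec N x = 0\<^sub>v (dim_row M)"
      obtain i where i: "i < N" "x i \<noteq> 0" using x by auto
      have "vec N x $ i = 0\<^sub>v (dim_row M) $ i" by (simp only: *)
      then show False using i M by simp
    qed
    show "M *\<^sub>v vec N x = of_real r \<cdot>\<^sub>v vec N x"
    proof (rule eq_vecI)
      fix i assume "i < dim_vec (of_real r \<cdot>\<^sub>v vec N x)"
      then have i: "i < N" by simp
      have "(M *\<^sub>v vec N x) $ i = kapply {..<N} (entries M) (($) (vec N x)) i"
        by (rule mult_mat_vec_kapply[OF M _ i]) simp
      also have "\<dots> = kapply {..<N} (entries M) x i"
        unfolding kapply_def by (rule sum.cong) auto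
      finally show "(M *\<^sub>v vec N x) $ i = (of_real r \<cdot>\<^sub>v vec N x) $ i"
        using i eig by simp
    qed (use M in simp)
  qed
  then have rP: "r \<in> ?P" by simp
  have upper: "r' \<le> q" if r': "r' \<in> ?P"
    and q: "\<And>x. qform {..<N} (entries M) x \<le> q * wnorm {..<N} (\<lambda>_. 1) x" for r' q
  proof -
    obtain v where v: "v \<in> carrier_vec N" "v \<noteq> 0\<^sub>v N" "M *\<^sub>v v = of_real r' \<cdot>\<^sub>v v"
      using r' M unfolding eigenvalue_def eigenvector_def by auto
    have "\<exists>i<N. v $ i \<noteq> 0"
    proof (rule ccontr)
      assume "\<not> ?thesis"
      then have "v = 0\<^sub>v N" using v(1) by (intro eq_vecI) auto
      with v(2) show False by simp
    qed
    then obtain i where i: "i < N" "v $ i \<noteq> 0" by blast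
    have pos: "0 < wnorm {..<N} (\<lambda>_. 1) (($) v)"
      unfolding wnorm_def by (rule sum_pos2[of _ i]) (use i in auto)
    have "kapply {..<N} (entries M) (($) v) i = of_real r' * v $ i" if "i < N" for i
      using mult_mat_vec_kapply[OF M v(1) that] v(1,3) that by simp
    then have "sesq {..<N} (($) v) (kapply {..<N} (entries M) (($) v))
        = sesq {..<N} (($) v) (\<lambda>i. of_real r' * v $ i)"
      by (intro sesq_cong) auto
    then have "qform {..<N} (entries M) (($) v) = r' * re (sesq {..<N} (($) v) (($) v))"
      unfolding qform_def sesq_scale_right by simp
    also have "re (sesq {..<N} (($) v) (($) v)) = wnorm {..<N} (\<lambda>_. 1) (($) v)"
      unfolding sesq_def wnorm_def re_sum by (simp only: re_conjugate_self mult_1)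
    finally show ?thesis using q[of "($) v"] pos by simp
  qed
  have lmax: "lambda_max M = r"
    unfolding lambda_max_def by (rule Max_eqI[OF fin upper[OF _ top] rP])
  show "qform {..<N} (entries M) x \<le> lambda_max M * wnorm {..<N} (\<lambda>_. 1) x" for x
    unfolding lmax by (rule top)
  show "lambda_max M \<le> r" if "\<And>x. qform {..<N} (entries M) x \<le> r * wnorm {..<N} (\<lambda>_. 1) x" for r
    unfolding lmax by (rule upper[OF rP that])
qed

lemma sum_lessThan_add:
  "sum f {..<s + t} = sum f {..<s} + (\<Sum>i<t. f (s + i))" for f :: "nat \<Rightarrow> 'a::comm_monoid_add"
  by (induction t) (simp_all add: add.assoc)

lemma sesq_lessThan_add:
  "sesq {..<s + t} x y = sesq {..<s} x y + sesq {..<t} (\<lambda>i. x (s + i)) (\<lambda>i. y (s + i))"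
  unfolding sesq_def by (rule sum_lessThan_add)

lemma wnorm_lessThan_add:
  "wnorm {..<s + t} (\<lambda>_. 1) x = wnorm {..<s} (\<lambda>_. 1) x + wnorm {..<t} (\<lambda>_. 1) (\<lambda>i. x (s + i))"
  unfolding wnorm_def by (rule sum_lessThan_add)

lemma norm_add_squared:
  "(norm (x + y))\<^sup>2 = (norm x)\<^sup>2 + 2 * re (conjugate x * y) + (norm (y :: 'a::rc_scalar))\<^sup>2"
proof -
  have "re (conjugate y * x) = re (conjugate x * y)"
    using re_conjugate[of "conjugate y * x"] by (simp add: conjugate_dist_mul mult.commute)
  moreover have "(norm (x + y))\<^sup>2 = re (conjugate (x + y) * (x + y))" by simp
  moreover have "conjugate (x + y) * (x + y) = conjugate x * x + conjugate x * y + (conjugate y * x + conjugate y * y)"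
    by (simp add: conjugate_dist_add distrib_left distrib_right)
  ultimately show ?thesis by (simp only: re_add re_conjugate_self)
qed

lemma wnorm_parallelogram:
  "wnorm S e (\<lambda>i. y i + 1 * z i) + wnorm S e (\<lambda>i. y i + (- 1) * z i) = 2 * wnorm S e y + 2 * wnorm S e z"
proof -
  have "e i * (norm (y i + z i))\<^sup>2 + e i * (norm (y i - z i))\<^sup>2
      = 2 * (e i * (norm (y i))\<^sup>2) + 2 * (e i * (norm (z i))\<^sup>2)" for i
  proof -
    have "(norm (y i + z i))\<^sup>2 + (norm (y i - z i))\<^sup>2 = 2 * (norm (y i))\<^sup>2 + 2 * (norm (z i))\<^sup>2"
      using norm_add_squared[of "y i" "z i"] norm_add_squared[of "y i" "- z i"] by simp
    then have "e i * ((norm (y i + z i))\<^sup>2 + (norm (y i - z i))\<^sup>2)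
        = e i * (2 * (norm (y i))\<^sup>2 + 2 * (norm (z i))\<^sup>2)" by (simp only:)
    then show ?thesis by (simp add: distrib_left)
  qed
  then show ?thesis unfolding wnorm_def
    by (simp only: sum.distrib[symmetric] sum_distrib_left) simp
qed

text \<open>The Hermitian block matrix of the program has the form
  \<open>(y, z) \<mapsto> 2 re \<langle>y, G z\<rangle> - \<alpha> F[y] - \<alpha> F[z]\<close>, which by polarization is governed by
  \<open>\<plusminus> G\<close> against \<open>\<alpha> F\<close>.\<close>

locale program_instance =
  fixes G :: "'a::rc_scalar mat" and F :: "real mat" and s :: nat
  assumes G: "G \<in> carrier_mat s s" and G_hermitian: "hermitian_on {..<s} (entries G)"
    and F: "F \<in> carrier_mat s s" "diagonal_mat F" and s_pos: "0 < s"
begin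

abbreviation "f \<equiv> \<lambda>i. F $$ (i, i)"
abbreviation "block \<equiv> four_block_mat (map_mat of_real (- program_alpha G \<cdot>\<^sub>m F)) G G
  (map_mat of_real (- program_alpha G \<cdot>\<^sub>m F)) :: 'a mat"

lemma block_carrier: "block \<in> carrier_mat (s + s) (s + s)"
  using G F by auto

lemma block_index:
  assumes "i < s" "j < s"
  shows "block $$ (i, j) = (if i = j then of_real (- (program_alpha G * f i)) else 0)"
    "block $$ (i, s + j) = G $$ (i, j)" "block $$ (s + i, j) = G $$ (i, j)"
    "block $$ (s + i, s + j) = (if i = j then of_real (- (program_alpha G * f i)) else 0)"
  using assms G F by (auto simp: diagonal_mat_def)

lemma G_swap: "i < s \<Longrightarrow> j < s \<Longrightarrow> conjugate (G $$ (i, j)) = G $$ (j, i)"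
  using G_hermitian unfolding hermitian_on_def by (metis lessThan_iff)

lemma block_hermitian: "hermitian_on {..<s + s} (entries block)"
  unfolding hermitian_on_def
proof (intro ballI)
  have *: "\<exists>i'<s. i = i' \<or> i = s + i'" if "i \<in> {..<s + s}" for i
    using that by (cases "i < s") (auto intro: exI[of _ "i - s"])
  fix i j assume "i \<in> {..<s + s}" "j \<in> {..<s + s}"
  from *[OF this(1)] *[OF this(2)] obtain i' j' where
    ij: "i' < s" "i = i' \<or> i = s + i'" "j' < s" "j = j' \<or> j = s + j'" by blast
  show "block $$ (j, i) = conjugate (block $$ (i, j))"
    using ij(2,4) by (elim disjE) (simp_all only: block_index[OF ij(1,3)] block_index[OF ij(3,1)] G_swap[OF ij(1,3)],
      auto simp del: of_real_minus)
qed

lemma qform_block: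
  "qform {..<s + s} (entries block) x
    = - (program_alpha G * wnorm {..<s} f x) - program_alpha G * wnorm {..<s} f (\<lambda>i. x (s + i))
      + 2 * re (sesq {..<s} x (kapply {..<s} (entries G) (\<lambda>i. x (s + i))))"
proof -
  let ?z = "\<lambda>i. x (s + i)" and ?\<alpha> = "program_alpha G"
  have diag: "(\<Sum>j<s. (if i = j then of_real (- (?\<alpha> * f i)) else 0) * y j) = of_real (- (?\<alpha> * f i)) * (y i :: 'a)"
    if "i < s" for i y
  proof -
    have "(\<Sum>j<s. (if i = j then of_real (- (?\<alpha> * f i)) else 0) * y j)
        = (\<Sum>j<s. if j = i then of_real (- (?\<alpha> * f i)) * y i else 0)"
      by (rule sum.cong) auto
    then show ?thesis using that by simp
  qed
  have 1: "kapply {..<s + s} (entries block) x i = of_real (- (?\<alpha> * f i)) * x i + kapply {..<s} (entries G) ?z i"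
    if i: "i < s" for i
  proof -
    have "kapply {..<s + s} (entries block) x i
        = (\<Sum>j<s. (if i = j then of_real (- (?\<alpha> * f i)) else 0) * x j) + (\<Sum>j<s. G $$ (i, j) * ?z j)"
      unfolding kapply_def sum_lessThan_add
      by (intro arg_cong2[of _ _ _ _ "(+)"] sum.cong) (simp_all only: lessThan_iff block_index[OF i])
    then show ?thesis unfolding diag[OF i] kapply_def .
  qed
  have 2: "kapply {..<s + s} (entries block) x (s + i) = of_real (- (?\<alpha> * f i)) * ?z i + kapply {..<s} (entries G) x i"
    if i: "i < s" for i
  proof -
    have "kapply {..<s + s} (entries block) x (s + i)
        = (\<Sum>j<s. G $$ (i, j) * x j) + (\<Sum>j<s. (if i = j then of_real (- (?\<alpha> * f i)) else 0) * ?z j)"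
      unfolding kapply_def sum_lessThan_add
      by (intro arg_cong2[of _ _ _ _ "(+)"] sum.cong) (simp_all only: lessThan_iff block_index[OF i])
    then show ?thesis unfolding diag[OF i] kapply_def by (simp only: add.commute)
  qed
  have d: "re (sesq {..<s} y (\<lambda>i. of_real (- (?\<alpha> * f i)) * y i)) = - (?\<alpha> * wnorm {..<s} f y)" for y :: "nat \<Rightarrow> 'a"
  proof -
    have "re (conjugate (y i) * (of_real (- (?\<alpha> * f i)) * y i)) = - (?\<alpha> * f i) * (norm (y i))\<^sup>2" for i
    proof -
      have "conjugate (y i) * (of_real (- (?\<alpha> * f i)) * y i) = of_real (- (?\<alpha> * f i)) * (conjugate (y i) * y i)"
        by (simp only: mult_ac)
      then show ?thesis by (simp only: re_of_real_mult re_conjugate_self)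
    qed
    then show ?thesis unfolding sesq_def wnorm_def re_sum
      by (simp add: sum_distrib_left sum_negf mult.assoc)
  qed
  have cross: "re (sesq {..<s} ?z (kapply {..<s} (entries G) x)) = re (sesq {..<s} x (kapply {..<s} (entries G) ?z))"
    using sesq_kapply_swap[OF _ G_hermitian, of x ?z] sesq_conjugate[of "{..<s}" "kapply {..<s} (entries G) x" ?z]
    by (metis finite_lessThan re_conjugate)
  have "sesq {..<s + s} x (kapply {..<s + s} (entries block) x)
    = sesq {..<s} x (\<lambda>i. of_real (- (?\<alpha> * f i)) * x i + kapply {..<s} (entries G) ?z i)
      + sesq {..<s} ?z (\<lambda>i. of_real (- (?\<alpha> * f i)) * ?z i + kapply {..<s} (entries G) x i)"
    unfolding sesq_lessThan_add
    by (intro arg_cong2[of _ _ _ _ "(+)"] sesq_cong) (simp_all only: lessThan_iff 1 2)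
  then show ?thesis unfolding qform_def by (simp only: sesq_add_right re_add d cross)
qed

lemma program_objective_block: "program_objective G F = lambda_max block"
  unfolding program_objective_def Let_def ..

text \<open>Polarization bounds the off-diagonal blocks: \<open>4 re \<langle>y, G z\<rangle>\<close> is the form of \<open>G\<close> at \<open>y + z\<close> minus
  that at \<open>y - z\<close>, and the parallelogram law splits the diagonal bound again.\<close>

lemma objective_le:
  assumes "\<And>x. \<bar>qform {..<s} (entries G) x\<bar> + r * wnorm {..<s} (\<lambda>_. 1) x
      \<le> program_alpha G * wnorm {..<s} f x"
  shows "program_objective G F \<le> - r"
  unfolding program_objective_block
proof (rule lambda_max_entries(2)[OF block_carrier _ block_hermitian])
  show "0 < s + s" using s_pos by simp
  fix x :: "nat \<Rightarrow> 'a"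
  let ?z = "\<lambda>i. x (s + i)"
  define y where "y = x" 
  define z where "z = ?z"
  define X where "X = re (sesq {..<s} y (kapply {..<s} (entries G) z))"
  have X: "re (sesq {..<s} z (kapply {..<s} (entries G) y)) = X"
    unfolding X_def
    using sesq_kapply_swap[OF _ G_hermitian, of y z] sesq_conjugate[of "{..<s}" "kapply {..<s} (entries G) y" z]
    by (metis finite_lessThan re_conjugate)
  have p: "qform {..<s} (entries G) (\<lambda>i. y i + 1 * z i)
      = qform {..<s} (entries G) y + 2 * X + qform {..<s} (entries G) z"
    using qform_add_scale[OF _ G_hermitian, of y 1 z] X by simp
  have m: "qform {..<s} (entries G) (\<lambda>i. y i + (- 1) * z i)
      = qform {..<s} (entries G) y - 2 * X + qform {..<s} (entries G) z"
    using qform_add_scale[OF _ G_hermitian, of y "- 1" z] X by (simp add: conjugate_neg)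
  have "4 * X = qform {..<s} (entries G) (\<lambda>i. y i + 1 * z i) - qform {..<s} (entries G) (\<lambda>i. y i + (- 1) * z i)"
    unfolding p m by simp
  also have "\<dots> \<le> program_alpha G * (wnorm {..<s} f (\<lambda>i. y i + 1 * z i) + wnorm {..<s} f (\<lambda>i. y i + (- 1) * z i))
      - r * (wnorm {..<s} (\<lambda>_. 1) (\<lambda>i. y i + 1 * z i) + wnorm {..<s} (\<lambda>_. 1) (\<lambda>i. y i + (- 1) * z i))"
    using assms[of "\<lambda>i. y i + 1 * z i"] assms[of "\<lambda>i. y i + (- 1) * z i"]
    unfolding distrib_left by linarith
  finally have "2 * X \<le> program_alpha G * wnorm {..<s} f y + program_alpha G * wnorm {..<s} f z
      - r * (wnorm {..<s} (\<lambda>_. 1) y + wnorm {..<s} (\<lambda>_. 1) z)"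
    unfolding wnorm_parallelogram by (simp add: algebra_simps)
  then show "qform {..<s + s} (entries block) x \<le> - r * wnorm {..<s + s} (\<lambda>_. 1) x"
    unfolding qform_block wnorm_lessThan_add X_def y_def z_def by (simp add: algebra_simps)
qed

text \<open>The block form is evaluated at \<open>(x, x)\<close> and \<open>(x, - x)\<close>.\<close>

lemma objective_nonpos_bound:
  assumes "program_objective G F \<le> 0"
  shows "\<bar>qform {..<s} (entries G) x\<bar> \<le> program_alpha G * wnorm {..<s} f x"
proof -
  have le: "qform {..<s + s} (entries block) y \<le> 0" for y
  proof -
    have "qform {..<s + s} (entries block) y \<le> lambda_max block * wnorm {..<s + s} (\<lambda>_. 1) y"
      by (rule lambda_max_entries(1)[OF block_carrier _ block_hermitian]) (use s_pos in simp)
    also have "\<dots> \<le> 0"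
      using assms unfolding program_objective_block by (intro mult_nonpos_nonneg wnorm_nonneg) auto
    finally show ?thesis .
  qed
  have *: "t * qform {..<s} (entries G) x \<le> program_alpha G * wnorm {..<s} f x" if t: "t = 1 \<or> t = - 1" for t
  proof -
    define y where "y i = (if i < s then x i else of_real t * x (i - s))" for i
    have fst: "qform {..<s} (entries G) y = qform {..<s} (entries G) x" "wnorm {..<s} f y = wnorm {..<s} f x"
      by (auto intro!: qform_cong sum.cong simp: y_def wnorm_def)
    have snd: "(\<lambda>i. y (s + i)) = (\<lambda>i. of_real t * x i)" by (simp add: y_def)
    have w: "wnorm {..<s} f (\<lambda>i. of_real t * x i) = wnorm {..<s} f x"
      using t by (auto simp: wnorm_def norm_mult)
    have cr: "re (sesq {..<s} y (kapply {..<s} (entries G) (\<lambda>i. of_real t * x i))) = t * qform {..<s} (entries G) x"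
    proof -
      have "sesq {..<s} y (kapply {..<s} (entries G) x) = sesq {..<s} x (kapply {..<s} (entries G) x)"
        by (rule sesq_cong) (auto simp: y_def)
      then show ?thesis by (simp only: kapply_scale sesq_scale_right re_of_real_mult qform_def)
    qed
    show ?thesis using le[of y] unfolding qform_block snd fst(2) w cr by linarith
  qed
  from *[of 1] *[of "- 1"] show ?thesis by auto
qed

end

section \<open>Gram matrices\<close>

definition gram :: "'a::rc_scalar mat \<Rightarrow> nat \<Rightarrow> nat \<Rightarrow> 'a" where
  "gram A i j = (\<Sum>r<dim_row A. conjugate (A $$ (r, i)) * A $$ (r, j))"

lemma qform_kernel_cong:
  "(\<And>i j. i \<in> S \<Longrightarrow> j \<in> S \<Longrightarrow> Q i j = Q' i j) \<Longrightarrow> qform S Q x = qform S Q' x"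
  unfolding qform_def kapply_def by (intro arg_cong[of _ _ re] sesq_cong sum.cong) auto

lemma l2_norm_squared: "(l2_norm v)\<^sup>2 = (\<Sum>i<dim_vec v. (norm (v $ i))\<^sup>2)"
  unfolding l2_norm_def L2_set_def by (simp add: sum_nonneg)

lemma l2_norm_nonneg [simp]: "0 \<le> l2_norm v"
  unfolding l2_norm_def by simp

lemma hermitian_on_gram: "hermitian_on S (gram A)"
  unfolding hermitian_on_def gram_def
  by (auto simp: sum_conjugate conjugate_dist_mul mult.commute)

lemma kapply_gram:
  "kapply S (gram A) u c = (\<Sum>r<dim_row A. conjugate (A $$ (r, c)) * (\<Sum>j\<in>S. A $$ (r, j) * u j))"
  unfolding kapply_def gram_def sum_distrib_left sum_distrib_right mult.assoc by (rule sum.swap)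

lemma sum_conjugate_self: "re (\<Sum>i\<in>I. conjugate (x i) * x i) = (\<Sum>i\<in>I. (norm (x i :: 'a::rc_scalar))\<^sup>2)"
  unfolding re_sum re_conjugate_self ..

lemma qform_gram:
  assumes "finite S"
  shows "qform S (gram A) u = (\<Sum>r<dim_row A. (norm (\<Sum>j\<in>S. A $$ (r, j) * u j))\<^sup>2)"
proof -
  define a where "a r = (\<Sum>j\<in>S. A $$ (r, j) * u j)" for r
  have "sesq S u (kapply S (gram A) u)
      = (\<Sum>i\<in>S. \<Sum>r<dim_row A. conjugate (u i) * (conjugate (A $$ (r, i)) * a r))"
    unfolding sesq_def kapply_gram sum_distrib_left a_def ..
  also have "\<dots> = (\<Sum>r<dim_row A. \<Sum>i\<in>S. conjugate (u i) * (conjugate (A $$ (r, i)) * a r))"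
    by (rule sum.swap)
  also have "\<dots> = (\<Sum>r<dim_row A. conjugate (a r) * a r)"
  proof (rule sum.cong[OF refl])
    fix r
    have "conjugate (a r) = (\<Sum>i\<in>S. conjugate (A $$ (r, i)) * conjugate (u i))"
      unfolding a_def by (simp add: sum_conjugate[OF assms] conjugate_dist_mul)
    then show "(\<Sum>i\<in>S. conjugate (u i) * (conjugate (A $$ (r, i)) * a r)) = conjugate (a r) * a r"
      by (simp add: sum_distrib_right sum_distrib_left mult_ac)
  qed
  finally show ?thesis unfolding qform_def a_def by (simp only: sum_conjugate_self)
qed

lemma l2_norm_mult_vec_squared:
  assumes "v \<in> carrier_vec (dim_col A)"
  shows "(l2_norm (A *\<^sub>v v))\<^sup>2 = (\<Sum>r<dim_row A. (norm (\<Sum>j<dim_col A. A $$ (r, j) * v $ j))\<^sup>2)"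
proof -
  have "(A *\<^sub>v v) $ r = (\<Sum>j<dim_col A. A $$ (r, j) * v $ j)" if "r < dim_row A" for r
    using assms that by (simp add: scalar_prod_def lessThan_atLeast0)
  then show ?thesis unfolding l2_norm_squared by simp
qed

lemma l2_norm_mult_vec_gram:
  assumes "v \<in> carrier_vec (dim_col A)"
  shows "(l2_norm (A *\<^sub>v v))\<^sup>2 = qform {..<dim_col A} (gram A) (($) v)"
  unfolding l2_norm_mult_vec_squared[OF assms] by (rule qform_gram[symmetric]) simp

text \<open>The Cauchy-Schwarz inequality for finite sums.\<close>

lemma sum_mult_le_l2:
  fixes x y :: "nat \<Rightarrow> 'a::rc_scalar"
  shows "norm (\<Sum>i\<in>I. x i * y i) \<le> L2_set (\<lambda>i. norm (x i)) I * L2_set (\<lambda>i. norm (y i)) I"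
proof -
  have "norm (\<Sum>i\<in>I. x i * y i) \<le> (\<Sum>i\<in>I. \<bar>norm (x i)\<bar> * \<bar>norm (y i)\<bar>)"
    by (rule order_trans[OF norm_sum]) (simp add: norm_mult)
  also have "\<dots> \<le> L2_set (\<lambda>i. norm (x i)) I * L2_set (\<lambda>i. norm (y i)) I"
    by (rule L2_set_mult_ineq)
  finally show ?thesis .
qed

lemma l2_norm_smult: "l2_norm (of_real t \<cdot>\<^sub>v v) = \<bar>t\<bar> * l2_norm (v :: 'a::rc_scalar vec)"
proof (rule power2_eq_imp_eq)
  show "(l2_norm (of_real t \<cdot>\<^sub>v v))\<^sup>2 = (\<bar>t\<bar> * l2_norm v)\<^sup>2"
    unfolding power_mult_distrib l2_norm_squared
    by (simp add: norm_mult power_mult_distrib sum_distrib_left)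
qed auto

lemma spectral_norm_bdd:
  "bdd_above ((\<lambda>x. l2_norm ((A :: 'a::rc_scalar mat) *\<^sub>v x)) ` unit_sphere (dim_col A))"
proof (intro bdd_aboveI2)
  fix x :: "'a vec" assume "x \<in> unit_sphere (dim_col A)"
  then have x: "x \<in> carrier_vec (dim_col A)" "l2_norm x = 1" by (auto simp: unit_sphere_def)
  have "l2_norm (A *\<^sub>v x) \<le> (\<Sum>r<dim_row A. norm ((A *\<^sub>v x) $ r))"
    unfolding l2_norm_def by (rule order_trans[OF L2_set_le_sum]) auto
  also have "\<dots> \<le> (\<Sum>r<dim_row A. L2_set (\<lambda>j. norm (A $$ (r, j))) {..<dim_col A})"
  proof (rule sum_mono)
    fix r assume r: "r \<in> {..<dim_row A}"
    have "(A *\<^sub>v x) $ r = (\<Sum>j<dim_col A. A $$ (r, j) * x $ j)"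
      using x r by (simp add: scalar_prod_def lessThan_atLeast0)
    also have "norm \<dots> \<le> L2_set (\<lambda>j. norm (A $$ (r, j))) {..<dim_col A} * L2_set (\<lambda>j. norm (x $ j)) {..<dim_col A}"
      by (rule sum_mult_le_l2)
    also have "L2_set (\<lambda>j. norm (x $ j)) {..<dim_col A} = 1"
      using x by (auto simp: l2_norm_def)
    finally show "norm ((A *\<^sub>v x) $ r) \<le> L2_set (\<lambda>j. norm (A $$ (r, j))) {..<dim_col A}" by simp
  qed
  finally show "l2_norm (A *\<^sub>v x) \<le> (\<Sum>r<dim_row A. L2_set (\<lambda>j. norm (A $$ (r, j))) {..<dim_col A})" .
qed

lemma l2_norm_mult_vec_le:
  fixes A :: "'a::rc_scalar mat"
  assumes v: "v \<in> carrier_vec (dim_col A)"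
  shows "l2_norm (A *\<^sub>v v) \<le> spectral_norm A * l2_norm v"
proof (cases "l2_norm v = 0")
  case True
  then have "(\<Sum>i<dim_vec v. (norm (v $ i))\<^sup>2) = 0" by (simp flip: l2_norm_squared)
  then have "v $ i = 0" if "i < dim_vec v" for i
    using that by (subst (asm) sum_nonneg_eq_0_iff) auto
  then have "(l2_norm (A *\<^sub>v v))\<^sup>2 = 0"
    using v unfolding l2_norm_mult_vec_squared[OF v] by simp
  then show ?thesis using True by simp
next
  case False
  then have pos: "0 < l2_norm v" using l2_norm_nonneg[of v] by linarith
  \<comment> \<open>Normalizing \<open>v\<close>, since the spectral norm is a supremum over unit vectors.\<close>
  define t where "t = 1 / l2_norm v"
  define x where "x = of_real t \<cdot>\<^sub>v v"
  have "x \<in> unit_sphere (dim_col A)"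
    using v pos unfolding unit_sphere_def x_def by (simp add: l2_norm_smult del: of_real_divide) (simp add: t_def)
  then have "l2_norm (A *\<^sub>v x) \<le> spectral_norm A"
    unfolding spectral_norm_def by (rule cSUP_upper[OF _ spectral_norm_bdd])
  moreover have "A *\<^sub>v x = of_real t \<cdot>\<^sub>v (A *\<^sub>v v)"
    unfolding x_def by (rule mult_mat_vec[OF _ v]) auto
  ultimately have "\<bar>t\<bar> * l2_norm (A *\<^sub>v v) \<le> spectral_norm A"
    by (simp only: l2_norm_smult)
  then have "t * l2_norm (A *\<^sub>v v) \<le> spectral_norm A" using pos by (simp add: t_def)
  then show ?thesis using pos by (simp add: t_def field_simps)
qed

lemma spectral_bound:
  fixes A :: "'a::rc_scalar mat" and z :: "nat \<Rightarrow> 'a"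
  shows "(\<Sum>r<dim_row A. (norm (\<Sum>j<dim_col A. A $$ (r, j) * z j))\<^sup>2)
    \<le> (spectral_norm A)\<^sup>2 * (\<Sum>j<dim_col A. (norm (z j))\<^sup>2)"
proof -
  define v where "v = vec (dim_col A) z"
  have v: "v \<in> carrier_vec (dim_col A)" by (simp add: v_def)
  have "(l2_norm (A *\<^sub>v v))\<^sup>2 \<le> (spectral_norm A * l2_norm v)\<^sup>2"
    by (rule power_mono[OF l2_norm_mult_vec_le[OF v]]) simp
  then have "(\<Sum>r<dim_row A. (norm (\<Sum>j<dim_col A. A $$ (r, j) * v $ j))\<^sup>2)
      \<le> (spectral_norm A)\<^sup>2 * (\<Sum>j<dim_vec v. (norm (v $ j))\<^sup>2)"
    unfolding power_mult_distrib l2_norm_mult_vec_squared[OF v] l2_norm_squared[of v] .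
  then show ?thesis by (simp add: v_def)
qed

lemma gram_diag:
  assumes "standardized A" "i < dim_col A"
  shows "gram A i i = 1"
proof -
  have "gram A i i = of_real (\<Sum>r<dim_row A. (norm (A $$ (r, i)))\<^sup>2)"
    by (simp add: gram_def conjugate_mult_self)
  also have "(\<Sum>r<dim_row A. (norm (A $$ (r, i)))\<^sup>2) = (l2_norm (col A i))\<^sup>2"
    unfolding l2_norm_squared using assms(2) by simp
  also have "\<dots> = 1" using assms unfolding standardized_def by simp
  finally show ?thesis by simp
qed

text \<open>With \<open>v\<close> the combination of the columns in \<open>S\<close> and \<open>z\<close> its image under the adjoint, \<open>\<parallel>z\<parallel>\<^sup>2\<close>
  is the inner product of \<open>A z\<close> and \<open>v\<close>, hence at most \<open>\<parallel>A\<parallel> \<parallel>z\<parallel> \<parallel>v\<parallel>\<close>.\<close>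

lemma gram_spectral_bound:
  fixes A :: "'a::rc_scalar mat"
  assumes S: "S \<subseteq> {..<dim_col A}"
  shows "(\<Sum>c<dim_col A. (norm (\<Sum>j\<in>S. gram A c j * u j))\<^sup>2) \<le> (spectral_norm A)\<^sup>2 * qform S (gram A) u"
proof -
  have fin: "finite S" using S finite_subset by blast
  define v where "v r = (\<Sum>j\<in>S. A $$ (r, j) * u j)" for r
  define z where "z c = (\<Sum>j\<in>S. gram A c j * u j)" for c
  define Z where "Z = L2_set (\<lambda>c. norm (z c)) {..<dim_col A}"
  define V where "V = L2_set (\<lambda>r. norm (v r)) {..<dim_row A}"
  have Z2: "Z\<^sup>2 = (\<Sum>c<dim_col A. (norm (z c))\<^sup>2)" unfolding Z_def L2_set_def by (simp add: sum_nonneg)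
  have V2: "V\<^sup>2 = qform S (gram A) u"
    unfolding V_def L2_set_def qform_gram[OF fin] v_def by (simp add: sum_nonneg)
  have zc: "z c = (\<Sum>r<dim_row A. conjugate (A $$ (r, c)) * v r)" for c
    unfolding z_def v_def using kapply_gram[of S A u c] by (simp add: kapply_def)
  define w where "w r = (\<Sum>c<dim_col A. A $$ (r, c) * z c)" for r
  have "(\<Sum>c<dim_col A. conjugate (z c) * z c) = (\<Sum>r<dim_row A. conjugate (w r) * v r)"
  proof -
    have "(\<Sum>c<dim_col A. conjugate (z c) * z c)
        = (\<Sum>c<dim_col A. \<Sum>r<dim_row A. conjugate (z c) * (conjugate (A $$ (r, c)) * v r))"
      by (subst (2) zc) (simp add: sum_distrib_left)
    also have "\<dots> = (\<Sum>r<dim_row A. \<Sum>c<dim_col A. conjugate (z c) * (conjugate (A $$ (r, c)) * v r))"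
      by (rule sum.swap)
    also have "\<dots> = (\<Sum>r<dim_row A. conjugate (w r) * v r)"
      unfolding w_def by (simp add: sum_conjugate conjugate_dist_mul sum_distrib_right sum_distrib_left mult_ac)
    finally show ?thesis .
  qed
  then have "Z\<^sup>2 = re (\<Sum>r<dim_row A. conjugate (w r) * v r)"
    unfolding Z2 by (simp add: sum_conjugate_self flip: sum_conjugate_self)
  also have "\<dots> \<le> norm (\<Sum>r<dim_row A. conjugate (w r) * v r)" by (rule re_le_norm)
  also have "\<dots> \<le> L2_set (\<lambda>r. norm (w r)) {..<dim_row A} * V"
    unfolding V_def using sum_mult_le_l2[of "\<lambda>r. conjugate (w r)" v] by simp
  also have "L2_set (\<lambda>r. norm (w r)) {..<dim_row A} \<le> spectral_norm' * Z"
    if "spectral_norm' = \<bar>spectral_norm A\<bar>" for spectral_norm'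
  proof (rule power2_le_imp_le)
    have "(L2_set (\<lambda>r. norm (w r)) {..<dim_row A})\<^sup>2 = (\<Sum>r<dim_row A. (norm (w r))\<^sup>2)"
      unfolding L2_set_def by (simp add: sum_nonneg)
    also have "\<dots> \<le> (spectral_norm A)\<^sup>2 * Z\<^sup>2" unfolding w_def Z2 by (rule spectral_bound)
    finally show "(L2_set (\<lambda>r. norm (w r)) {..<dim_row A})\<^sup>2 \<le> (spectral_norm' * Z)\<^sup>2"
      by (simp add: power_mult_distrib that)
  qed (simp add: that Z_def)
  finally have *: "Z\<^sup>2 \<le> \<bar>spectral_norm A\<bar> * Z * V"
    by (simp add: mult_right_mono V_def)
  have "Z \<le> \<bar>spectral_norm A\<bar> * V"
  proof (cases "Z = 0")
    case False
    then have "0 < Z" by (simp add: Z_def order_less_le)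
    then show ?thesis using * by (simp add: power2_eq_square mult.assoc mult.left_commute[of _ Z])
  qed (simp add: V_def)
  then have "Z\<^sup>2 \<le> (\<bar>spectral_norm A\<bar> * V)\<^sup>2" by (rule power_mono) (simp add: Z_def)
  then show ?thesis unfolding power_mult_distrib Z2 V2 z_def by simp
qed

lemma spectral_norm_ge_1:
  fixes A :: "'a::rc_scalar mat"
  assumes "standardized A" "0 < dim_col A"
  shows "1 \<le> (spectral_norm A)\<^sup>2"
proof -
  have "(\<Sum>c<dim_col A. (norm (\<Sum>j\<in>{0}. gram A c j * 1))\<^sup>2) \<le> (spectral_norm A)\<^sup>2 * qform {0} (gram A) (\<lambda>_. 1)"
    by (rule gram_spectral_bound) (use assms in auto)
  also have "qform {0} (gram A) (\<lambda>_. 1) = 1"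
    using gram_diag[OF assms] re_of_real[of 1, where 'a='a] by (simp add: qform_def sesq_def kapply_def)
  finally have "(\<Sum>c<dim_col A. (norm (gram A c 0))\<^sup>2) \<le> (spectral_norm A)\<^sup>2" by simp
  moreover have "(norm (gram A 0 0))\<^sup>2 \<le> (\<Sum>c<dim_col A. (norm (gram A c 0))\<^sup>2)"
    by (rule member_le_sum) (use assms in auto)
  ultimately show ?thesis using gram_diag[OF assms] by simp
qed

lemma stable_rank_standardized:
  fixes A :: "'a::rc_scalar mat"
  assumes "standardized A"
  shows "stable_rank A = real (dim_col A) / (spectral_norm A)\<^sup>2"
proof -
  have "(frobenius_norm A)\<^sup>2 = (\<Sum>(i, j)\<in>{..<dim_row A} \<times> {..<dim_col A}. (norm (A $$ (i, j)))\<^sup>2)"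
    unfolding frobenius_norm_def L2_set_def by (simp add: sum_nonneg case_prod_beta)
  also have "\<dots> = (\<Sum>i<dim_row A. \<Sum>j<dim_col A. (norm (A $$ (i, j)))\<^sup>2)"
    by (rule sum.cartesian_product[symmetric])
  also have "\<dots> = (\<Sum>j<dim_col A. \<Sum>i<dim_row A. (norm (A $$ (i, j)))\<^sup>2)"
    by (rule sum.swap)
  also have "\<dots> = (\<Sum>j<dim_col A. 1)"
  proof (rule sum.cong[OF refl])
    fix j assume j: "j \<in> {..<dim_col A}"
    have "(\<Sum>i<dim_row A. (norm (A $$ (i, j)))\<^sup>2) = (l2_norm (col A j))\<^sup>2"
      unfolding l2_norm_squared using j by simp
    then show "(\<Sum>i<dim_row A. (norm (A $$ (i, j)))\<^sup>2) = 1"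
      using assms j unfolding standardized_def by simp
  qed
  finally show ?thesis by (simp add: stable_rank_def)
qed

lemma gram_barrier_standardized:
  fixes A :: "'a::rc_scalar mat"
  assumes "standardized A" "0 < dim_col A" "0 < \<theta>" "\<theta> \<le> 1 / 2" "\<epsilon> = 1 \<or> \<epsilon> = - 1"
  shows "gram_barrier (gram A) (dim_col A) ((spectral_norm A)\<^sup>2) \<theta> \<epsilon>"
  using assms hermitian_on_gram gram_diag gram_spectral_bound spectral_norm_ge_1
  by unfold_locales blast+

section \<open>Column submatrices\<close>

lemma column_submatrix_dim:
  assumes "\<sigma> \<subseteq> {..<dim_col A}"
  shows "dim_row (column_submatrix A \<sigma>) = dim_row A" "dim_col (column_submatrix A \<sigma>) = card \<sigma>"
proof -
  have "{j. j < dim_col A \<and> j \<in> \<sigma>} = \<sigma>" using assms by auto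
  then show "dim_row (column_submatrix A \<sigma>) = dim_row A" "dim_col (column_submatrix A \<sigma>) = card \<sigma>"
    by (simp_all add: dim_submatrix)
qed

lemma column_submatrix_index:
  assumes "\<sigma> \<subseteq> {..<dim_col A}" "r < dim_row A" "i < card \<sigma>"
  shows "column_submatrix A \<sigma> $$ (r, i) = A $$ (r, pick \<sigma> i)"
proof -
  have "{j. j < dim_col A \<and> j \<in> \<sigma>} = \<sigma>" using assms by auto
  then show ?thesis using assms by (subst submatrix_index) (auto simp: pick_UNIV)
qed

lemma bij_betw_pick:
  assumes "finite \<sigma>"
  shows "bij_betw (pick \<sigma>) {..<card \<sigma>} \<sigma>"
proof -
  have "inj_on (pick \<sigma>) {..<card \<sigma>}"
    by (rule inj_onI) (metis lessThan_iff nat_neq_iff pick_mono_le)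
  moreover have sub: "pick \<sigma> ` {..<card \<sigma>} \<subseteq> \<sigma>" using pick_in_set_le by auto
  ultimately show ?thesis
    unfolding bij_betw_def using card_subset_eq[OF assms sub] card_image by force
qed

lemma gram_column_submatrix:
  assumes "\<sigma> \<subseteq> {..<dim_col A}" "i < card \<sigma>" "j < card \<sigma>"
  shows "gram (column_submatrix A \<sigma>) i j = gram A (pick \<sigma> i) (pick \<sigma> j)"
  unfolding gram_def column_submatrix_dim[OF assms(1)]
  by (intro sum.cong) (use assms in \<open>auto simp: column_submatrix_index\<close>)

lemma qform_reindex:
  assumes "bij_betw p I S"
  shows "qform I (\<lambda>i j. Q (p i) (p j)) (\<lambda>i. y (p i)) = qform S Q y"
proof -
  have "kapply I (\<lambda>i j. Q (p i) (p j)) (\<lambda>i. y (p i)) i = kapply S Q y (p i)" for i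
    unfolding kapply_def by (rule sum.reindex_bij_betw[OF assms])
  then have "sesq I (\<lambda>i. y (p i)) (kapply I (\<lambda>i j. Q (p i) (p j)) (\<lambda>i. y (p i))) = sesq S y (kapply S Q y)"
    unfolding sesq_def using sum.reindex_bij_betw[OF assms, of "\<lambda>c. conjugate (y c) * kapply S Q y c"] by simp
  then show ?thesis by (simp add: qform_def)
qed

lemma qform_gram_column_submatrix:
  assumes sub: "\<sigma> \<subseteq> {..<dim_col A}"
  shows "qform {..<card \<sigma>} (gram (column_submatrix A \<sigma>)) (\<lambda>i. y (pick \<sigma> i)) = qform \<sigma> (gram A) y"
proof -
  have "qform {..<card \<sigma>} (gram (column_submatrix A \<sigma>)) (\<lambda>i. y (pick \<sigma> i))
      = qform {..<card \<sigma>} (\<lambda>i j. gram A (pick \<sigma> i) (pick \<sigma> j)) (\<lambda>i. y (pick \<sigma> i))"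
    by (rule qform_kernel_cong) (use gram_column_submatrix[OF sub] in auto)
  also have "\<dots> = qform \<sigma> (gram A) y"
    using sub finite_subset by (intro qform_reindex bij_betw_pick) blast
  finally show ?thesis .
qed

lemma wnorm_reindex:
  assumes "bij_betw p I S"
  shows "wnorm I (\<lambda>i. e (p i)) (\<lambda>i. y (p i)) = wnorm S e y"
  unfolding wnorm_def by (rule sum.reindex_bij_betw[OF assms])

lemma standardized_column_submatrix:
  assumes "standardized A" "\<sigma> \<subseteq> {..<dim_col A}"
  shows "standardized (column_submatrix A \<sigma>)"
  unfolding standardized_def column_submatrix_dim[OF assms(2)]
proof (intro allI impI)
  fix i assume i: "i < card \<sigma>"
  then have p: "pick \<sigma> i < dim_col A" using pick_in_set_le[OF i] assms(2) by auto
  have "col (column_submatrix A \<sigma>) i = col A (pick \<sigma> i)"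
    by (rule eq_vecI) (use i p assms(2) in \<open>auto simp: column_submatrix_dim column_submatrix_index\<close>)
  with p show "l2_norm (col (column_submatrix A \<sigma>) i) = 1"
    using assms(1) unfolding standardized_def by simp
qed

lemma gram_minus_id_carrier: "gram_minus_id B \<in> carrier_mat (dim_col B) (dim_col B)"
  unfolding gram_minus_id_def by (auto simp: mat_adjoint_def)

lemma gram_minus_id_index:
  assumes "i < dim_col B" "j < dim_col B"
  shows "gram_minus_id B $$ (i, j) = gram B i j - (if i = j then 1 else 0)"
proof -
  have dims: "dim_row (mat_adjoint B) = dim_col B" "dim_col (mat_adjoint B) = dim_row B"
    by (simp_all add: mat_adjoint_def)
  have "row (mat_adjoint B) i = conjugate (col B i)"
    using assms(1) unfolding mat_adjoint_def by simp
  then have "(mat_adjoint B * B) $$ (i, j) = conjugate (col B i) \<bullet> col B j"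
    using assms dims by simp
  also have "\<dots> = gram B i j"
    using assms by (simp add: scalar_prod_def gram_def lessThan_atLeast0)
  finally show ?thesis unfolding gram_minus_id_def using assms dims by simp
qed

lemma hermitian_on_gram_minus_id: "hermitian_on {..<dim_col B} (entries (gram_minus_id B))"
  unfolding hermitian_on_def
proof (intro ballI)
  fix i j assume "i \<in> {..<dim_col B}" "j \<in> {..<dim_col B}"
  moreover have "gram B j i = conjugate (gram B i j)"
    using hermitian_on_gram[of UNIV B] unfolding hermitian_on_def by blast
  ultimately show "gram_minus_id B $$ (j, i) = conjugate (gram_minus_id B $$ (i, j))"
    by (simp add: gram_minus_id_index conjugate_diff)
qed

lemma qform_gram_minus_id:
  "qform {..<dim_col B} (entries (gram_minus_id B)) x
    = qform {..<dim_col B} (gram B) x - wnorm {..<dim_col B} (\<lambda>_. 1) x"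
proof -
  have "qform {..<dim_col B} (entries (gram_minus_id B)) x
      = qform {..<dim_col B} (\<lambda>i j. of_real 1 * gram B i j + (if i = j then of_real (- 1) else 0)) x"
    by (rule qform_kernel_cong) (auto simp: gram_minus_id_index)
  also have "\<dots> = 1 * qform {..<dim_col B} (gram B) x + wnorm {..<dim_col B} (\<lambda>_. - 1) x"
    by (rule qform_add_diag) simp
  finally show ?thesis by (simp add: wnorm_def sum_negf)
qed

lemma cond_number_le_sqrt3:
  fixes A :: "'a::rc_scalar mat"
  assumes sub: "\<tau> \<subseteq> {..<dim_col A}"
    and near: "\<And>x. \<bar>qform \<tau> (gram A) x - wnorm \<tau> (\<lambda>_. 1) x\<bar> \<le> 1 / 2 * wnorm \<tau> (\<lambda>_. 1) x"
  shows "cond_number (column_submatrix A \<tau>) \<le> ennreal (sqrt 3)"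
proof -
  let ?B = "column_submatrix A \<tau>" and ?t = "card \<tau>"
  note dims = column_submatrix_dim[OF sub]
  have fin: "finite \<tau>" using sub finite_subset by blast
  note bij = bij_betw_pick[OF fin]
  have bounds: "1 / 2 \<le> (l2_norm (?B *\<^sub>v x))\<^sup>2 \<and> (l2_norm (?B *\<^sub>v x))\<^sup>2 \<le> 3 / 2"
    if x: "x \<in> unit_sphere (dim_col ?B)" for x
  proof -
    have xc: "x \<in> carrier_vec (dim_col ?B)" "l2_norm x = 1" using x by (auto simp: unit_sphere_def)
    define y where "y c = x $ (inv_into {..<?t} (pick \<tau>) c)" for c
    have y: "y (pick \<tau> i) = x $ i" if "i < ?t" for i
      unfolding y_def using bij that by (simp add: bij_betw_def inv_into_f_f)
    have "qform {..<?t} (gram ?B) (($) x) = qform {..<?t} (gram ?B) (\<lambda>i. y (pick \<tau> i))"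
      by (rule qform_cong) (simp add: y)
    also have "\<dots> = qform \<tau> (gram A) y" by (rule qform_gram_column_submatrix[OF sub])
    finally have 1: "(l2_norm (?B *\<^sub>v x))\<^sup>2 = qform \<tau> (gram A) y"
      unfolding l2_norm_mult_vec_gram[OF xc(1)] dims .
    have "wnorm \<tau> (\<lambda>_. 1) y = wnorm {..<?t} (\<lambda>_. 1) (\<lambda>i. y (pick \<tau> i))"
      using wnorm_reindex[OF bij, of "\<lambda>_. 1" y] by simp
    also have "\<dots> = (l2_norm x)\<^sup>2"
      unfolding l2_norm_squared using xc(1) dims by (simp add: wnorm_def y)
    finally have 2: "wnorm \<tau> (\<lambda>_. 1) y = 1" using xc(2) by simp
    show ?thesis using near[of y] unfolding 1 2 by linarith
  qed
  have "ennreal (l2_norm (?B *\<^sub>v x)) / ennreal (l2_norm (?B *\<^sub>v y)) \<le> ennreal (sqrt 3)"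
    if x: "x \<in> unit_sphere (dim_col ?B)" and y: "y \<in> unit_sphere (dim_col ?B)" for x y
  proof -
    have "(l2_norm (?B *\<^sub>v x))\<^sup>2 \<le> 3 * (l2_norm (?B *\<^sub>v y))\<^sup>2" using bounds[OF x] bounds[OF y] by linarith
    then have "(l2_norm (?B *\<^sub>v x))\<^sup>2 \<le> (sqrt 3 * l2_norm (?B *\<^sub>v y))\<^sup>2" by (simp add: power_mult_distrib)
    then have le: "l2_norm (?B *\<^sub>v x) \<le> sqrt 3 * l2_norm (?B *\<^sub>v y)" by (rule power2_le_imp_le) simp
    have "l2_norm (?B *\<^sub>v y) \<noteq> 0" using bounds[OF y] by auto
    then have pos: "0 < l2_norm (?B *\<^sub>v y)" using l2_norm_nonneg[of "?B *\<^sub>v y"] by linarith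
    have "ennreal (l2_norm (?B *\<^sub>v x)) / ennreal (l2_norm (?B *\<^sub>v y)) = ennreal (l2_norm (?B *\<^sub>v x) / l2_norm (?B *\<^sub>v y))"
      by (rule divide_ennreal) (use pos in auto)
    also have "\<dots> \<le> ennreal (sqrt 3)"
      by (rule ennreal_leI) (use le pos in \<open>simp add: divide_le_eq\<close>)
    finally show ?thesis .
  qed
  then show ?thesis unfolding cond_number_def by (intro SUP_least)
qed

section \<open>One call of the reduction step\<close>

definition balanced :: "'a::rc_scalar mat \<Rightarrow> nat \<Rightarrow> nat set \<Rightarrow> bool" where
  "balanced A s \<tau> \<longleftrightarrow> \<tau> \<subseteq> {..<dim_col A} \<and> real s / 2 \<le> real (card \<tau>) \<and>
     cond_number (column_submatrix A \<tau>) \<le> ennreal (sqrt 3)"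

text \<open>The set returned by the reduction step, as a function of the random set \<open>\<sigma>\<close> and of a choice \<open>F\<close> of
  solutions of the convex programs.\<close>

definition selection :: "'a::rc_scalar mat \<Rightarrow> (nat set \<Rightarrow> real mat) \<Rightarrow> nat set \<Rightarrow> nat set" where
  "selection A F \<sigma> = (let D = fst (factorization (gram_minus_id (column_submatrix A \<sigma>)) (F \<sigma>))
     in {pick \<sigma> i | i. i < card \<sigma> \<and> (D $$ (i, i))\<^sup>2 \<le> 2 / real (card \<sigma>)})"

text \<open>In both cases of the factorization the squared diagonal of \<open>D\<close> is a probability vector.\<close>

lemma factorization_diagonal:
  assumes F: "program_feasible s F" and G: "dim_row G = s" and s: "0 < s"
  obtains f where "\<And>i. i < s \<Longrightarrow> 0 \<le> f i" "\<And>i. i < s \<Longrightarrow> (fst (factorization G F) $$ (i, i))\<^sup>2 = f i"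
    "(\<Sum>i<s. f i) = 1" "\<And>i. program_objective G F \<le> 0 \<Longrightarrow> i < s \<Longrightarrow> f i = F $$ (i, i)"
proof -
  have Fc: "F \<in> carrier_mat s s" and F0: "\<And>i. i < s \<Longrightarrow> 0 \<le> F $$ (i, i)" and tr: "(\<Sum>i<s. F $$ (i, i)) = 1"
    using F by (auto simp: program_feasible_def mat_trace_def)
  show ?thesis
  proof (cases "program_objective G F \<le> 0")
    case True
    show ?thesis
      by (rule that[of "\<lambda>i. F $$ (i, i)"]) (use True F0 tr Fc in \<open>auto simp: factorization_def Let_def\<close>)
  next
    case False
    define \<eta> where "\<eta> = program_objective G F"
    define \<alpha> where "\<alpha> = program_alpha G"
    have eta: "0 < \<eta>" using False by (simp add: \<eta>_def)
    have alpha: "0 < \<alpha>" using G s by (simp add: \<alpha>_def program_alpha_def)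
    have den: "0 < \<alpha> + \<eta> * real s" using eta alpha by (simp add: add_pos_nonneg)
    define f where "f i = 1 / (\<alpha> + \<eta> * real s) * (\<alpha> * F $$ (i, i) + \<eta>)" for i
    have f0: "0 \<le> f i" if "i < s" for i
      unfolding f_def using F0[OF that] den eta alpha by simp
    have "fst (factorization G F) $$ (i, i) = sqrt (f i)" if "i < s" for i
      using that False Fc G unfolding f_def \<eta>_def \<alpha>_def by (simp add: factorization_def Let_def)
    then have "(fst (factorization G F) $$ (i, i))\<^sup>2 = f i" if "i < s" for i
      using that f0[OF that] by simp
    moreover have "(\<Sum>i<s. f i) = 1"
    proof -
      have "(\<Sum>i<s. f i) = 1 / (\<alpha> + \<eta> * real s) * (\<alpha> * (\<Sum>i<s. F $$ (i, i)) + \<eta> * real s)"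
        unfolding f_def sum_distrib_left[symmetric] sum.distrib by (simp add: mult.commute)
      then show ?thesis using den by (simp add: tr)
    qed
    ultimately show ?thesis using f0 False by (intro that[of f]) auto
  qed
qed

text \<open>Fewer than half of the entries of a probability vector on \<open>s\<close> points exceed \<open>2 / s\<close>.  On the others,
  the bound \<open>s / 4\<close> times the form of \<open>F\<close> becomes one half of the squared norm.\<close>

lemma selection_properties:
  assumes \<sigma>: "\<sigma> \<in> subsets_of_size (dim_col A) s" and s: "0 < s" and F: "program_feasible s (F \<sigma>)"
  shows "selection A F \<sigma> \<subseteq> \<sigma>" "real s / 2 \<le> real (card (selection A F \<sigma>))"
    "program_objective (gram_minus_id (column_submatrix A \<sigma>)) (F \<sigma>) \<le> 0 \<Longrightarrow> balanced A s (selection A F \<sigma>)"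
proof -
  have sub: "\<sigma> \<subseteq> {..<dim_col A}" and card: "card \<sigma> = s" using \<sigma> by (auto simp: subsets_of_size_def)
  have fin: "finite \<sigma>" using sub finite_subset by blast
  let ?B = "column_submatrix A \<sigma>"
  let ?G = "gram_minus_id ?B"
  note dims = column_submatrix_dim[OF sub, unfolded card]
  have G: "?G \<in> carrier_mat s s" using gram_minus_id_carrier[of ?B] dims by simp
  then have dG: "dim_row ?G = s" by simp
  from factorization_diagonal[OF F dG s] obtain f where
    f0: "\<And>i. i < s \<Longrightarrow> 0 \<le> f i" and fD: "\<And>i. i < s \<Longrightarrow> (fst (factorization ?G (F \<sigma>)) $$ (i, i))\<^sup>2 = f i"
    and fsum: "(\<Sum>i<s. f i) = 1"
    and fF: "\<And>i. program_objective ?G (F \<sigma>) \<le> 0 \<Longrightarrow> i < s \<Longrightarrow> f i = F \<sigma> $$ (i, i)" by auto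
  note bij = bij_betw_pick[OF fin, unfolded card]
  define J where "J = {i. i < s \<and> f i \<le> 2 / real s}"
  have sel: "selection A F \<sigma> = pick \<sigma> ` J"
    unfolding selection_def Let_def card J_def using fD by auto
  have Js: "J \<subseteq> {..<s}" by (auto simp: J_def)
  show sub\<tau>: "selection A F \<sigma> \<subseteq> \<sigma>" unfolding sel using Js bij by (auto simp: bij_betw_def)
  have cardJ: "card (selection A F \<sigma>) = card J"
    unfolding sel using Js bij by (meson bij_betw_def card_image inj_on_subset)
  have finJ: "finite J" using Js finite_subset by blast
  have "real (card ({..<s} - J)) * (2 / real s) \<le> 1"
  proof -
    have "real (card ({..<s} - J)) * (2 / real s) = (\<Sum>i\<in>{..<s} - J. 2 / real s)" by simp
    also have "\<dots> \<le> (\<Sum>i\<in>{..<s} - J. f i)" by (rule sum_mono) (auto simp: J_def)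
    also have "\<dots> \<le> (\<Sum>i<s. f i)" by (rule sum_mono2) (auto simp: f0)
    finally show ?thesis by (simp add: fsum)
  qed
  then have "real (card ({..<s} - J)) \<le> real s / 2" using s by (simp add: field_simps)
  moreover have "real (card ({..<s} - J)) = real s - real (card J)"
    using card_Diff_subset[OF finJ Js] card_mono[OF _ Js] by (simp add: of_nat_diff)
  ultimately show half: "real s / 2 \<le> real (card (selection A F \<sigma>))" unfolding cardJ by linarith
  show "balanced A s (selection A F \<sigma>)" if obj: "program_objective ?G (F \<sigma>) \<le> 0"
  proof -
    interpret program_instance ?G "F \<sigma>" s
      using G hermitian_on_gram_minus_id[of ?B] F s dims
      by unfold_locales (auto simp: program_feasible_def)
    let ?\<tau> = "selection A F \<sigma>"
    have \<tau>n: "?\<tau> \<subseteq> {..<dim_col A}" using sub\<tau> sub by auto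
    have near: "\<bar>qform ?\<tau> (gram A) y - wnorm ?\<tau> (\<lambda>_. 1) y\<bar> \<le> 1 / 2 * wnorm ?\<tau> (\<lambda>_. 1) y" for y
    proof -
      define y0 where "y0 c = (if c \<in> ?\<tau> then y c else 0)" for c
      define x where "x i = y0 (pick \<sigma> i)" for i
      have q: "qform {..<s} (gram ?B) x = qform ?\<tau> (gram A) y"
      proof -
        have "qform {..<s} (gram ?B) x = qform \<sigma> (gram A) y0"
          using qform_gram_column_submatrix[OF sub, of y0] unfolding x_def[abs_def] card .
        also have "\<dots> = qform ?\<tau> (gram A) y" unfolding y0_def by (rule qform_extend_zero[OF fin sub\<tau>])
        finally show ?thesis .
      qed
      have w: "wnorm {..<s} (\<lambda>_. 1) x = wnorm ?\<tau> (\<lambda>_. 1) y"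
      proof -
        have "wnorm {..<s} (\<lambda>_. 1) x = wnorm \<sigma> (\<lambda>_. 1) y0"
          unfolding x_def using wnorm_reindex[OF bij, of "\<lambda>_. 1" y0] by simp
        also have "\<dots> = wnorm ?\<tau> (\<lambda>_. 1) y"
          unfolding wnorm_def y0_def by (rule sum.mono_neutral_cong_right) (use fin sub\<tau> in auto)
        finally show ?thesis .
      qed
      have "\<bar>qform {..<s} (entries ?G) x\<bar> \<le> program_alpha ?G * wnorm {..<s} (\<lambda>i. F \<sigma> $$ (i, i)) x"
        by (rule objective_nonpos_bound[OF obj])
      also have "wnorm {..<s} (\<lambda>i. F \<sigma> $$ (i, i)) x \<le> 2 / real s * wnorm {..<s} (\<lambda>_. 1) x"
        unfolding wnorm_def sum_distrib_left
      proof (rule sum_mono)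
        fix i assume i: "i \<in> {..<s}"
        show "F \<sigma> $$ (i, i) * (norm (x i))\<^sup>2 \<le> 2 / real s * (1 * (norm (x i))\<^sup>2)"
        proof (cases "i \<in> J")
          case True
          then have "F \<sigma> $$ (i, i) \<le> 2 / real s" using fF[OF obj, of i] i by (auto simp: J_def)
          then show ?thesis unfolding mult_1 by (rule mult_right_mono) simp
        next
          case False
          have "pick \<sigma> i \<notin> ?\<tau>"
            unfolding sel using False i bij Js by (auto simp: bij_betw_def inj_on_def)
          then show ?thesis by (simp add: x_def y0_def)
        qed
      qed
      finally have "\<bar>qform {..<s} (entries ?G) x\<bar> \<le> program_alpha ?G * (2 / real s * wnorm {..<s} (\<lambda>_. 1) x)"
        by (simp add: mult_left_mono program_alpha_def)
      also have "\<dots> = 1 / 2 * wnorm {..<s} (\<lambda>_. 1) x"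
        using s dG by (simp add: program_alpha_def)
      finally show ?thesis using qform_gram_minus_id[of ?B x] unfolding dims q w by simp
    qed
    show ?thesis unfolding balanced_def using \<tau>n half cond_number_le_sqrt3[OF \<tau>n near] by blast
  qed
qed

text \<open>The entries of \<open>F\<close> are \<open>4 / s * (w + r)\<close>, where \<open>r\<close> is chosen to make the trace one.  Since \<open>w\<close> has mass
  at most \<open>s / 8\<close>, \<open>r\<close> is at least \<open>1 / 8\<close>, and this slack is what an inexact solver may lose.\<close>

lemma objective_small_if_dominated:
  assumes \<sigma>: "\<sigma> \<in> subsets_of_size (dim_col A) s" and s: "0 < s"
    and w: "\<And>i. i \<in> \<sigma> \<Longrightarrow> 0 \<le> w i" "(\<Sum>i\<in>\<sigma>. w i) \<le> real s / 8"
    and dom: "\<And>x. \<bar>qform \<sigma> (gram A) x - wnorm \<sigma> (\<lambda>_. 1) x\<bar> \<le> wnorm \<sigma> w x"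
  shows "\<exists>F. program_feasible s F \<and> program_objective (gram_minus_id (column_submatrix A \<sigma>)) F \<le> - (1 / 8)"
proof -
  have sub: "\<sigma> \<subseteq> {..<dim_col A}" and card: "card \<sigma> = s" using \<sigma> by (auto simp: subsets_of_size_def)
  have fin: "finite \<sigma>" using sub finite_subset by blast
  let ?B = "column_submatrix A \<sigma>"
  let ?G = "gram_minus_id ?B"
  note dims = column_submatrix_dim[OF sub, unfolded card]
  have G: "?G \<in> carrier_mat s s" using gram_minus_id_carrier[of ?B] dims by simp
  note bij = bij_betw_pick[OF fin, unfolded card]
  \<comment> \<open>The choice of \<open>r\<close> makes the trace of \<open>F\<close>, which is \<open>4 / s\<close> times the mass of \<open>w\<close> plus \<open>4 r\<close>, equal to one.\<close>
  define r where "r = 1 / 4 - (\<Sum>i\<in>\<sigma>. w i) / real s"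
  have r: "1 / 8 \<le> r" using w(2) s by (simp add: r_def field_simps)
  define f where "f i = 4 / real s * (w (pick \<sigma> i) + r)" for i
  define F where "F = mat s s (\<lambda>(i, j). if i = j then f i else 0)"
  have "(\<Sum>i<s. f i) = 4 / real s * ((\<Sum>i<s. w (pick \<sigma> i)) + real s * r)"
    unfolding f_def sum_distrib_left[symmetric] sum.distrib by simp
  also have "(\<Sum>i<s. w (pick \<sigma> i)) = (\<Sum>i\<in>\<sigma>. w i)" by (rule sum.reindex_bij_betw[OF bij])
  also have "4 / real s * ((\<Sum>i\<in>\<sigma>. w i) + real s * r) = 1" using s by (simp add: r_def field_simps)
  finally have fsum: "(\<Sum>i<s. f i) = 1" .
  have f0: "0 \<le> f i" if "i < s" for i
    using w(1)[of "pick \<sigma> i"] pick_in_set_le[of i \<sigma>] that card r by (simp add: f_def)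
  have feas: "program_feasible s F"
    unfolding program_feasible_def mat_trace_def diagonal_mat_def
    using fsum f0 by (auto simp: F_def)
  interpret program_instance ?G F s
    using G hermitian_on_gram_minus_id[of ?B] feas s dims
    by unfold_locales (auto simp: program_feasible_def)
  have "program_objective ?G F \<le> - (1 / 8)"
  proof (rule objective_le)
    fix x :: "nat \<Rightarrow> 'a"
    define y where "y c = x (inv_into {..<s} (pick \<sigma>) c)" for c
    have y: "y (pick \<sigma> i) = x i" if "i < s" for i
      unfolding y_def using bij that by (simp add: bij_betw_def inv_into_f_f)
    have q: "qform {..<s} (gram ?B) x = qform \<sigma> (gram A) y"
    proof -
      have "qform {..<s} (gram ?B) x = qform {..<s} (gram ?B) (\<lambda>i. y (pick \<sigma> i))"
        by (rule qform_cong) (simp add: y)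
      also have "\<dots> = qform \<sigma> (gram A) y"
        using qform_gram_column_submatrix[OF sub, of y] unfolding card .
      finally show ?thesis .
    qed
    have wn: "wnorm {..<s} (\<lambda>i. e (pick \<sigma> i)) x = wnorm \<sigma> e y" for e
      using wnorm_reindex[OF bij, of e y] by (simp add: wnorm_def y)
    have wn1: "wnorm {..<s} (\<lambda>_. 1) x = wnorm \<sigma> (\<lambda>_. 1) y" using wn[of "\<lambda>_. 1"] by simp
    have "program_alpha ?G * wnorm {..<s} (\<lambda>i. F $$ (i, i)) x
        = wnorm {..<s} (\<lambda>i. w (pick \<sigma> i)) x + r * wnorm {..<s} (\<lambda>_. 1) x"
    proof -
      have "program_alpha ?G * (F $$ (i, i) * (norm (x i))\<^sup>2)
          = w (pick \<sigma> i) * (norm (x i))\<^sup>2 + r * (1 * (norm (x i))\<^sup>2)" if "i < s" for i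
        using that s G by (simp add: F_def f_def program_alpha_def distrib_right)
      then show ?thesis unfolding wnorm_def sum_distrib_left sum.distrib[symmetric] by (intro sum.cong) auto
    qed
    moreover have "\<bar>qform {..<s} (entries ?G) x\<bar> \<le> wnorm \<sigma> w y"
      using dom[of y] qform_gram_minus_id[of ?B x] unfolding dims q wn1 by simp
    moreover have "1 / 8 * wnorm {..<s} (\<lambda>_. 1) x \<le> r * wnorm {..<s} (\<lambda>_. 1) x"
      using r by (intro mult_right_mono wnorm_nonneg) auto
    ultimately show "\<bar>qform {..<s} (entries ?G) x\<bar> + 1 / 8 * wnorm {..<s} (\<lambda>_. 1) x
        \<le> program_alpha ?G * wnorm {..<s} (\<lambda>i. F $$ (i, i)) x"
      unfolding wn by linarith
  qed
  with feas show ?thesis by blast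
qed

text \<open>The weights for the two one-sided bounds are added; with \<open>\<theta> = 1 / 200\<close> their mass is at most
  \<open>22 / 200 * s\<close>, which is below \<open>s / 8\<close>.\<close>

lemma few_unbalanced_selections:
  fixes A :: "'a::rc_scalar mat"
  assumes A: "standardized A" and s: "0 < s" "s \<le> dim_col A"
    and small: "16 * (spectral_norm A)\<^sup>2 * real s \<le> (1 / 200) ^ 3 * real (dim_col A)"
    and F: "\<And>\<sigma>. \<sigma> \<in> subsets_of_size (dim_col A) s \<Longrightarrow>
      program_solution (1 / 8) (gram_minus_id (column_submatrix A \<sigma>)) (F \<sigma>)"
  shows "2 * card {\<sigma>\<in>subsets_of_size (dim_col A) s. \<not> balanced A s (selection A F \<sigma>)} \<le> dim_col A choose s"
proof -
  have n: "0 < dim_col A" using s by simp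
  interpret up: gram_barrier "gram A" "dim_col A" "(spectral_norm A)\<^sup>2" "1 / 200" "- 1"
    by (rule gram_barrier_standardized[OF A n]) auto
  interpret lo: gram_barrier "gram A" "dim_col A" "(spectral_norm A)\<^sup>2" "1 / 200" 1
    by (rule gram_barrier_standardized[OF A n]) auto
  define b where "b = 11 * (1 / 200) * real s"
  have bal: "balanced A s (selection A F \<sigma>)"
    if \<sigma>: "\<sigma> \<in> subsets_of_size (dim_col A) s" and up: "up.dominated \<sigma> b" and lo: "lo.dominated \<sigma> b" for \<sigma>
  proof -
    have sub: "\<sigma> \<subseteq> {..<dim_col A}" and card: "card \<sigma> = s" using \<sigma> by (auto simp: subsets_of_size_def)
    obtain w1 where w1: "\<And>i. i \<in> \<sigma> \<Longrightarrow> 0 \<le> w1 i" "(\<Sum>i\<in>\<sigma>. w1 i) \<le> b"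
      "\<And>x. 0 \<le> - 1 * (qform \<sigma> (gram A) x - wnorm \<sigma> (\<lambda>_. 1) x) + wnorm \<sigma> w1 x"
      using up unfolding up.dominated_def by blast
    obtain w2 where w2: "\<And>i. i \<in> \<sigma> \<Longrightarrow> 0 \<le> w2 i" "(\<Sum>i\<in>\<sigma>. w2 i) \<le> b"
      "\<And>x. 0 \<le> 1 * (qform \<sigma> (gram A) x - wnorm \<sigma> (\<lambda>_. 1) x) + wnorm \<sigma> w2 x"
      using lo unfolding lo.dominated_def by blast
    define w where "w i = w1 i + w2 i" for i
    have "\<exists>F. program_feasible s F \<and> program_objective (gram_minus_id (column_submatrix A \<sigma>)) F \<le> - (1 / 8)"
    proof (rule objective_small_if_dominated[OF \<sigma> s(1), of w])
      show "0 \<le> w i" if "i \<in> \<sigma>" for i using w1(1) w2(1) that by (simp add: w_def)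
      show "(\<Sum>i\<in>\<sigma>. w i) \<le> real s / 8" using w1(2) w2(2) by (simp add: w_def sum.distrib b_def)
      show "\<bar>qform \<sigma> (gram A) x - wnorm \<sigma> (\<lambda>_. 1) x\<bar> \<le> wnorm \<sigma> w x" for x :: "nat \<Rightarrow> 'a"
      proof -
        have abs_le: "\<bar>d\<bar> \<le> p + q" if "0 \<le> - 1 * d + p" "0 \<le> 1 * d + q" "0 \<le> p" "0 \<le> q" for d p q :: real
          using that by linarith
        have "wnorm \<sigma> w x = wnorm \<sigma> w1 x + wnorm \<sigma> w2 x"
          by (simp add: w_def wnorm_def distrib_right sum.distrib)
        moreover have "0 \<le> wnorm \<sigma> w1 x" "0 \<le> wnorm \<sigma> w2 x"
          using w1(1) w2(1) by (auto intro: wnorm_nonneg)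
        ultimately show ?thesis using abs_le[OF w1(3)[of x] w2(3)[of x]] by simp
      qed
    qed
    then obtain F0 where F0: "program_feasible s F0"
      "program_objective (gram_minus_id (column_submatrix A \<sigma>)) F0 \<le> - (1 / 8)" by blast
    have dim: "dim_row (gram_minus_id (column_submatrix A \<sigma>)) = s"
      using gram_minus_id_carrier[of "column_submatrix A \<sigma>"] column_submatrix_dim[OF sub] card by simp
    have feas: "program_feasible s (F \<sigma>)"
      using F[OF \<sigma>] unfolding program_solution_def dim by blast
    have "program_objective (gram_minus_id (column_submatrix A \<sigma>)) (F \<sigma>)
        \<le> program_objective (gram_minus_id (column_submatrix A \<sigma>)) F0 + 1 / 8"
      using F[OF \<sigma>] F0(1) unfolding program_solution_def dim by blast
    with F0(2) have "program_objective (gram_minus_id (column_submatrix A \<sigma>)) (F \<sigma>) \<le> 0" by linarith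
    then show ?thesis by (rule selection_properties(3)[where F = F, OF \<sigma> s(1) feas])
  qed
  let ?X = "subsets_of_size (dim_col A) s"
  let ?bad = "{\<sigma>\<in>?X. \<not> balanced A s (selection A F \<sigma>)}"
  have "?bad \<subseteq> {\<sigma>\<in>?X. \<not> up.dominated \<sigma> b} \<union> {\<sigma>\<in>?X. \<not> lo.dominated \<sigma> b}"
    using bal by blast
  then have "card ?bad
      \<le> card ({\<sigma>\<in>?X. \<not> up.dominated \<sigma> b} \<union> {\<sigma>\<in>?X. \<not> lo.dominated \<sigma> b})"
    by (rule card_mono[rotated]) simp
  also have "\<dots> \<le> card {\<sigma>\<in>?X. \<not> up.dominated \<sigma> b} + card {\<sigma>\<in>?X. \<not> lo.dominated \<sigma> b}"
    by (rule card_Un_le)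
  finally have "card ?bad
      \<le> card {\<sigma>\<in>?X. \<not> up.dominated \<sigma> b} + card {\<sigma>\<in>?X. \<not> lo.dominated \<sigma> b}" .
  moreover have "4 * card {\<sigma>\<in>?X. \<not> up.dominated \<sigma> b} \<le> dim_col A choose s"
    unfolding b_def by (rule up.few_not_dominated[OF s(1) small s(2)])
  moreover have "4 * card {\<sigma>\<in>?X. \<not> lo.dominated \<sigma> b} \<le> dim_col A choose s"
    unfolding b_def by (rule lo.few_not_dominated[OF s(1) small s(2)])
  ultimately show ?thesis by linarith
qed

section \<open>The algorithm\<close>

text \<open>The law of total probability, split along the event \<open>B\<close>.\<close>

lemma prob_bind_pmf_le:
  assumes "0 \<le> q" "0 \<le> r"
    and B: "\<And>x. x \<in> set_pmf p \<Longrightarrow> x \<in> B \<Longrightarrow> measure_pmf.prob (f x) X \<le> q + r"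
    and not_B: "\<And>x. x \<in> set_pmf p \<Longrightarrow> x \<notin> B \<Longrightarrow> measure_pmf.prob (f x) X \<le> r"
  shows "measure_pmf.prob (bind_pmf p f) X \<le> measure_pmf.prob p B * q + r"
proof -
  have "emeasure (measure_pmf (bind_pmf p f)) X = (\<integral>\<^sup>+x. emeasure (measure_pmf (f x)) X \<partial>measure_pmf p)"
    by (rule emeasure_bind_pmf)
  also have "\<dots> \<le> (\<integral>\<^sup>+x. ennreal q * indicator B x + ennreal r \<partial>measure_pmf p)"
  proof (rule nn_integral_mono_AE)
    have "emeasure (measure_pmf (f x)) X \<le> ennreal q * indicator B x + ennreal r" if x: "x \<in> set_pmf p" for x
      using B[OF x] not_B[OF x] assms(1,2)
      by (cases "x \<in> B") (auto simp: measure_pmf.emeasure_eq_measure ennreal_plus[symmetric] simp del: ennreal_plus intro!: ennreal_leI)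
    then show "AE x in measure_pmf p. emeasure (measure_pmf (f x)) X \<le> ennreal q * indicator B x + ennreal r"
      by (simp add: AE_measure_pmf_iff)
  qed
  also have "\<dots> = ennreal q * emeasure (measure_pmf p) B + ennreal r"
    by (subst nn_integral_add) (auto simp: nn_integral_cmult_indicator)
  also have "\<dots> = ennreal (measure_pmf.prob p B * q + r)"
    using assms(1,2) by (simp add: measure_pmf.emeasure_eq_measure ennreal_mult' ennreal_plus mult.commute)
  finally have "ennreal (measure_pmf.prob (bind_pmf p f) X) \<le> ennreal (measure_pmf.prob p B * q + r)"
    by (simp add: measure_pmf.emeasure_eq_measure)
  then show ?thesis using assms(1,2) by (subst (asm) ennreal_le_iff) auto
qed

text \<open>The growth function of the asserted cost bound.\<close>

definition round_cost :: "real \<Rightarrow> nat \<Rightarrow> real \<Rightarrow> real" where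
  "round_cost m q s = (s\<^sup>2 * m + s powr (7 / 2)) * (1 + log 2 s) ^ q"

lemma round_cost_nonneg: "0 \<le> m \<Longrightarrow> 1 \<le> s \<Longrightarrow> 0 \<le> round_cost m q s"
  unfolding round_cost_def by (intro mult_nonneg_nonneg add_nonneg_nonneg zero_le_power) auto

lemma round_cost_mono:
  assumes "0 \<le> m" "1 \<le> s" "s \<le> t"
  shows "round_cost m q s \<le> round_cost m q t"
  unfolding round_cost_def using assms
  by (intro mult_mono add_mono power_mono mult_right_mono powr_mono2 zero_le_power add_nonneg_nonneg) auto

lemma round_cost_double:
  assumes "0 \<le> m" "1 \<le> s"
  shows "2 * round_cost m q s \<le> round_cost m q (2 * s)"
proof -
  have "2 * s powr (7 / 2) \<le> (2 * s) powr (7 / 2)"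
  proof -
    have "(2::real) powr 1 \<le> 2 powr (7 / 2)" by (intro powr_mono) auto
    then have "2 * s powr (7 / 2) \<le> 2 powr (7 / 2) * s powr (7 / 2)" by (intro mult_right_mono) auto
    then show ?thesis using assms by (simp add: powr_mult)
  qed
  moreover have "2 * (s\<^sup>2 * m) \<le> (2 * s)\<^sup>2 * m" using assms by (simp add: power_mult_distrib)
  ultimately have "2 * (s\<^sup>2 * m + s powr (7 / 2)) \<le> (2 * s)\<^sup>2 * m + (2 * s) powr (7 / 2)" by simp
  moreover have "(1 + log 2 s) ^ q \<le> (1 + log 2 (2 * s)) ^ q"
    using assms by (intro power_mono) auto
  ultimately have "(2 * (s\<^sup>2 * m + s powr (7 / 2))) * (1 + log 2 s) ^ q
      \<le> ((2 * s)\<^sup>2 * m + (2 * s) powr (7 / 2)) * (1 + log 2 (2 * s)) ^ q"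
    using assms by (intro mult_mono) auto
  then show ?thesis unfolding round_cost_def by (simp only: mult.assoc)
qed

lemma round_cost_quadruple:
  assumes "0 \<le> m" "1 \<le> s"
  shows "round_cost m q (4 * s) \<le> 128 * 3 ^ q * round_cost m q s"
proof -
  have "(4::real) powr (7 / 2) = 128"
  proof -
    have "(4::real) powr (7 / 2) = (2 powr 2) powr (7 / 2)" by simp
    also have "\<dots> = 2 powr (7::nat)" unfolding powr_powr by simp
    also have "\<dots> = 128" by (subst powr_realpow) auto
    finally show ?thesis .
  qed
  then have 1: "(4 * s)\<^sup>2 * m + (4 * s) powr (7 / 2) \<le> 128 * (s\<^sup>2 * m + s powr (7 / 2))"
    using assms by (simp add: powr_mult power_mult_distrib)
  have "log 2 (4 * s) = 2 + log 2 s"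
  proof -
    have "log 2 (4::real) = log 2 (2 ^ 2)" by simp
    also have "\<dots> = 2" by (subst log_nat_power) auto
    finally show ?thesis using assms by (simp add: log_mult)
  qed
  then have "1 + log 2 (4 * s) \<le> 3 * (1 + log 2 s)" using assms by simp
  then have "(1 + log 2 (4 * s)) ^ q \<le> (3 * (1 + log 2 s)) ^ q"
    using assms by (intro power_mono) auto
  then have 2: "(1 + log 2 (4 * s)) ^ q \<le> 3 ^ q * (1 + log 2 s) ^ q" by (simp only: power_mult_distrib)
  have "round_cost m q (4 * s) \<le> (128 * (s\<^sup>2 * m + s powr (7 / 2))) * (3 ^ q * (1 + log 2 s) ^ q)"
    unfolding round_cost_def using assms by (intro mult_mono 1 2) auto
  then show ?thesis unfolding round_cost_def by (simp add: mult_ac)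
qed

locale bt_run =
  fixes A :: "'a::rc_scalar mat" and S :: "'a bt_steps" and K :: real and p :: nat
  assumes A: "standardized A" and n_pos: "0 < dim_col A"
    and accuracy: "solver_accuracy (1 / 8) S" and costs: "step_costs K p S"
begin

abbreviation "n \<equiv> dim_col A"
abbreviation "m \<equiv> real (dim_row A)"

text \<open>The property that the current set keeps throughout every run, successful or not.\<close>

definition valid :: "nat set \<Rightarrow> bool" where
  "valid \<tau> \<longleftrightarrow> \<tau> \<subseteq> {..<n} \<and> cond_number (column_submatrix A \<tau>) \<le> ennreal (sqrt 3)"

lemma draw_cost:
  "0 < s \<Longrightarrow> s \<le> l \<Longrightarrow> real (draw_ops S s l) \<le> K * real s * (1 + log 2 (real s)) ^ p"
  using costs unfolding step_costs_def by blast

lemma submatrix_costs: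
  assumes "standardized B" "0 < dim_col B"
  shows "real (gram_ops S B) \<le> K * (real (dim_col B))\<^sup>2 * real (dim_row B)"
    "real (solver_ops S (gram_minus_id B)) \<le> K * real (dim_col B) powr (7 / 2) * (1 + log 2 (real (dim_col B))) ^ p"
    "real (extract_ops S (gram_minus_id B)) \<le> K * real (dim_col B) ^ 3 * (1 + log 2 (real (dim_col B))) ^ p"
    "real (test_ops S B) \<le> K * ((real (dim_col B))\<^sup>2 * real (dim_row B) + real (dim_col B) ^ 3)
       * (1 + log 2 (real (dim_col B))) ^ p"
  using costs assms unfolding step_costs_def Let_def by blast+

lemma K_nonneg: "0 \<le> K"
proof -
  have "real (draw_ops S 1 1) \<le> K * real 1 * (1 + log 2 (real 1)) ^ p"
    by (rule draw_cost) auto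
  then have "real (draw_ops S 1 1) \<le> K" by simp
  then show ?thesis by (meson of_nat_0_le_iff order_trans)
qed

definition program_choice :: "nat set \<Rightarrow> real mat" where
  "program_choice \<sigma> = solver S (gram_minus_id (column_submatrix A \<sigma>))"

definition reduce_ops :: "nat set \<Rightarrow> nat" where
  "reduce_ops \<sigma> = draw_ops S (card \<sigma>) n + gram_ops S (column_submatrix A \<sigma>)
     + solver_ops S (gram_minus_id (column_submatrix A \<sigma>))
     + extract_ops S (gram_minus_id (column_submatrix A \<sigma>))"

lemma subsets_nonempty: "s \<le> n \<Longrightarrow> subsets_of_size n s \<noteq> {}"
  using card_subsets_of_size[of n s] by (metis card.empty zero_less_binomial less_irrefl)

lemma cond_reduce_eq:
  assumes "s \<le> n"
  shows "cond_reduce S A s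
    = map_pmf (\<lambda>\<sigma>. (selection A program_choice \<sigma>, reduce_ops \<sigma>)) (pmf_of_set (subsets_of_size n s))"
proof -
  let ?G = "\<lambda>\<sigma>. gram_minus_id (column_submatrix A \<sigma>)"
  let ?out = "\<lambda>\<sigma>. ({pick \<sigma> i | i. i < s \<and>
        (fst (factorization (?G \<sigma>) (program_choice \<sigma>)) $$ (i, i))\<^sup>2 \<le> 2 / real s},
      draw_ops S s n + gram_ops S (column_submatrix A \<sigma>) + solver_ops S (?G \<sigma>) + extract_ops S (?G \<sigma>))"
  have "cond_reduce S A s = bind_pmf (pmf_of_set (subsets_of_size n s)) (\<lambda>\<sigma>. return_pmf (?out \<sigma>))"
    unfolding cond_reduce_def subsets_of_size_def program_choice_def Let_def case_prod_beta ..
  also have "\<dots> = bind_pmf (pmf_of_set (subsets_of_size n s))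
      (\<lambda>\<sigma>. return_pmf (selection A program_choice \<sigma>, reduce_ops \<sigma>))"
  proof (rule bind_pmf_cong[OF refl])
    fix \<sigma> assume "\<sigma> \<in> set_pmf (pmf_of_set (subsets_of_size n s))"
    then have "card \<sigma> = s"
      using set_pmf_of_set[OF subsets_nonempty[OF assms]] by (simp add: subsets_of_size_def)
    then show "return_pmf (?out \<sigma>) = return_pmf (selection A program_choice \<sigma>, reduce_ops \<sigma>)"
      by (simp add: selection_def reduce_ops_def Let_def)
  qed
  finally show ?thesis by (simp add: map_pmf_def)
qed

lemma program_choice_solution:
  assumes "\<sigma> \<in> subsets_of_size n s" "0 < s"
  shows "program_solution (1 / 8) (gram_minus_id (column_submatrix A \<sigma>)) (program_choice \<sigma>)"
proof -
  have sub: "\<sigma> \<subseteq> {..<n}" "card \<sigma> = s" using assms(1) by (auto simp: subsets_of_size_def)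
  then show ?thesis
    using accuracy standardized_column_submatrix[OF A sub(1)] column_submatrix_dim(2)[OF sub(1)] assms(2)
    unfolding solver_accuracy_def program_choice_def by simp
qed

lemma prob_cond_reduce_unbalanced:
  assumes s: "0 < s" "s \<le> n" and small: "16 * (spectral_norm A)\<^sup>2 * real s \<le> (1 / 200) ^ 3 * real n"
  shows "measure_pmf.prob (cond_reduce S A s) {(\<tau>, c). \<not> balanced A s \<tau>} \<le> 1 / 2"
proof -
  let ?X = "subsets_of_size n s"
  have "measure_pmf.prob (cond_reduce S A s) {(\<tau>, c). \<not> balanced A s \<tau>}
      = measure_pmf.prob (pmf_of_set ?X) {\<sigma>. \<not> balanced A s (selection A program_choice \<sigma>)}"
    unfolding cond_reduce_eq[OF s(2)] by (simp add: vimage_def)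
  also have "\<dots> = real (card (?X \<inter> {\<sigma>. \<not> balanced A s (selection A program_choice \<sigma>)})) / real (card ?X)"
    by (rule measure_pmf_of_set[OF subsets_nonempty[OF s(2)] finite_subsets_of_size])
  also have "?X \<inter> {\<sigma>. \<not> balanced A s (selection A program_choice \<sigma>)}
      = {\<sigma>\<in>?X. \<not> balanced A s (selection A program_choice \<sigma>)}" by auto
  also have "real (card {\<sigma>\<in>?X. \<not> balanced A s (selection A program_choice \<sigma>)}) / real (card ?X) \<le> 1 / 2"
  proof -
    have "2 * card {\<sigma>\<in>?X. \<not> balanced A s (selection A program_choice \<sigma>)} \<le> n choose s"
      by (rule few_unbalanced_selections[OF A s small program_choice_solution[OF _ s(1)]])
    moreover have "0 < n choose s" using s by simp
    ultimately show ?thesis unfolding card_subsets_of_size by (simp add: field_simps)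
  qed
  finally show ?thesis .
qed

lemma cond_reduce_support:
  assumes s: "0 < s" "s \<le> n" and mem: "(\<tau>, c) \<in> set_pmf (cond_reduce S A s)"
  shows "\<tau> \<subseteq> {..<n}" "real s / 2 \<le> real (card \<tau>)"
    "real (c + test_ops S (column_submatrix A \<tau>)) \<le> 4 * K * round_cost m p (real s)"
proof -
  obtain \<sigma> where \<sigma>: "\<sigma> \<in> subsets_of_size n s" and \<tau>: "\<tau> = selection A program_choice \<sigma>" and c: "c = reduce_ops \<sigma>"
    using mem subsets_nonempty[OF s(2)] unfolding cond_reduce_eq[OF s(2)] by auto
  have sub: "\<sigma> \<subseteq> {..<n}" and card: "card \<sigma> = s" using \<sigma> by (auto simp: subsets_of_size_def)
  have fin: "finite \<sigma>" using sub finite_subset by blast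
  let ?B = "column_submatrix A \<sigma>"
  note dims = column_submatrix_dim[OF sub, unfolded card]
  have feas: "program_feasible s (program_choice \<sigma>)"
    using program_choice_solution[OF \<sigma> s(1)] gram_minus_id_carrier[of ?B] dims
    unfolding program_solution_def by simp
  have \<tau>\<sigma>: "\<tau> \<subseteq> \<sigma>" and half: "real s / 2 \<le> real (card \<tau>)"
    unfolding \<tau> using selection_properties(1,2)[where F = program_choice, OF \<sigma> s(1) feas] by auto
  show \<tau>n: "\<tau> \<subseteq> {..<n}" using \<tau>\<sigma> sub by auto
  show "real s / 2 \<le> real (card \<tau>)" by (rule half)
  define t where "t = card \<tau>"
  have ts: "t \<le> s" unfolding t_def using card_mono[OF fin \<tau>\<sigma>] card by simp
  have t1: "1 \<le> t" using half s unfolding t_def by linarith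
  define L where "L = (1 + log 2 (real s)) ^ p"
  have L: "1 \<le> L" unfolding L_def using s by (intro one_le_power) auto
  define h where "h = real s powr (7 / 2)"
  have s1: "1 \<le> real s" using s by simp
  have cube: "real s ^ 3 \<le> h"
  proof -
    have "real s ^ 3 = real s powr 3" using s1 powr_realpow[of "real s" 3] by simp
    also have "\<dots> \<le> h" unfolding h_def using s1 by (intro powr_mono) auto
    finally show ?thesis .
  qed
  have lin: "real s \<le> h"
  proof -
    have "real s ^ 1 \<le> real s ^ 3" using s1 by (intro power_increasing) auto
    then show ?thesis using cube unfolding power_one_right by (rule order_trans)
  qed
  have d: "real (draw_ops S s n) \<le> K * real s * L"
    unfolding L_def by (rule draw_cost[OF s])
  have "standardized ?B" "0 < dim_col ?B"
    using standardized_column_submatrix[OF A sub] dims s by auto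
  then have ops: "real (gram_ops S ?B) \<le> K * (real s)\<^sup>2 * m"
    "real (solver_ops S (gram_minus_id ?B)) \<le> K * h * L"
    "real (extract_ops S (gram_minus_id ?B)) \<le> K * real s ^ 3 * L"
    using submatrix_costs[of ?B] unfolding dims L_def h_def by blast+
  have "standardized (column_submatrix A \<tau>)" "0 < dim_col (column_submatrix A \<tau>)"
    using standardized_column_submatrix[OF A \<tau>n] column_submatrix_dim[OF \<tau>n] t1 by (auto simp: t_def)
  then have "real (test_ops S (column_submatrix A \<tau>))
      \<le> K * ((real t)\<^sup>2 * m + real t ^ 3) * (1 + log 2 (real t)) ^ p"
    using submatrix_costs(4)[of "column_submatrix A \<tau>"] unfolding column_submatrix_dim[OF \<tau>n] t_def by blast
  also have "\<dots> \<le> K * ((real s)\<^sup>2 * m + real s ^ 3) * L"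
    unfolding L_def using ts t1 K_nonneg
    by (intro mult_mono mult_left_mono add_mono mult_right_mono power_mono zero_le_power add_nonneg_nonneg mult_nonneg_nonneg) auto
  finally have test: "real (test_ops S (column_submatrix A \<tau>)) \<le> K * ((real s)\<^sup>2 * m + real s ^ 3) * L" .
  have "real (c + test_ops S (column_submatrix A \<tau>))
      \<le> K * real s * L + K * (real s)\<^sup>2 * m + K * h * L + K * real s ^ 3 * L + K * ((real s)\<^sup>2 * m + real s ^ 3) * L"
    using d ops test unfolding c reduce_ops_def card by linarith
  also have "\<dots> \<le> K * h * L + K * ((real s)\<^sup>2 * m) * L + K * h * L + K * h * L + K * ((real s)\<^sup>2 * m + h) * L"
  proof -
    have "K * real s * L \<le> K * h * L" "K * real s ^ 3 * L \<le> K * h * L"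
      "K * ((real s)\<^sup>2 * m + real s ^ 3) * L \<le> K * ((real s)\<^sup>2 * m + h) * L"
      using K_nonneg L lin cube by (auto intro!: mult_right_mono mult_left_mono)
    moreover have "K * (real s)\<^sup>2 * m \<le> K * ((real s)\<^sup>2 * m) * L"
    proof -
      have "K * ((real s)\<^sup>2 * m) * 1 \<le> K * ((real s)\<^sup>2 * m) * L"
        using K_nonneg L by (intro mult_left_mono) auto
      then show ?thesis by (simp only: mult.assoc mult_1_right)
    qed
    ultimately show ?thesis by linarith
  qed
  also have "\<dots> = K * L * (2 * ((real s)\<^sup>2 * m) + 4 * h)" by (simp add: algebra_simps)
  also have "\<dots> \<le> K * L * (4 * ((real s)\<^sup>2 * m + h))"
    using K_nonneg L by (intro mult_left_mono) auto
  also have "\<dots> = 4 * K * round_cost m p (real s)"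
    unfolding round_cost_def L_def h_def by (simp add: mult_ac)
  finally show "real (c + test_ops S (column_submatrix A \<tau>)) \<le> 4 * K * round_cost m p (real s)" .
qed

lemma bt_attempts_support:
  assumes s: "0 < s" "s \<le> n"
  shows "(\<tau>, c) \<in> set_pmf (bt_attempts S k A s \<tau>\<^sub>0) \<Longrightarrow>
    (\<tau> = \<tau>\<^sub>0 \<or> balanced A s \<tau>) \<and> real c \<le> real k * (4 * K * round_cost m p (real s))"
proof (induction k arbitrary: \<tau> c)
  case (Suc k)
  then obtain \<tau>1 c1 where 1: "(\<tau>1, c1) \<in> set_pmf (cond_reduce S A s)"
    and 2: "(\<tau>, c) \<in> set_pmf (if cond_number (column_submatrix A \<tau>1) \<le> ennreal (sqrt 3)
     then return_pmf (\<tau>1, c1 + test_ops S (column_submatrix A \<tau>1))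
     else map_pmf (\<lambda>(\<tau>', c''). (\<tau>', c1 + test_ops S (column_submatrix A \<tau>1) + c'')) (bt_attempts S k A s \<tau>\<^sub>0))"
    by (auto simp: Let_def)
  note supp = cond_reduce_support[OF s 1]
  let ?C = "4 * K * round_cost m p (real s)"
  have C: "0 \<le> ?C" using supp(3) by (meson of_nat_0_le_iff order_trans)
  have expand: "real (Suc k) * ?C = ?C + real k * ?C" by (simp add: algebra_simps)
  show ?case
  proof (cases "cond_number (column_submatrix A \<tau>1) \<le> ennreal (sqrt 3)")
    case True
    with 2 have "\<tau> = \<tau>1" and c: "c = c1 + test_ops S (column_submatrix A \<tau>1)" by auto
    have "0 \<le> real k * ?C" by (rule mult_nonneg_nonneg[OF of_nat_0_le_iff C])
    then have "real c \<le> real (Suc k) * ?C" unfolding expand c using supp(3) by linarith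
    moreover have "balanced A s \<tau>" using \<open>\<tau> = \<tau>1\<close> supp True by (simp add: balanced_def)
    ultimately show ?thesis by blast
  next
    case False
    with 2 obtain c2 where 3: "(\<tau>, c2) \<in> set_pmf (bt_attempts S k A s \<tau>\<^sub>0)"
      and c: "c = c1 + test_ops S (column_submatrix A \<tau>1) + c2" by auto
    have "real c = real (c1 + test_ops S (column_submatrix A \<tau>1)) + real c2" by (simp add: c)
    then have "real c \<le> real (Suc k) * ?C"
      unfolding expand using Suc.IH[OF 3] supp(3) by linarith
    then show ?thesis using Suc.IH[OF 3] by blast
  qed
qed simp

lemma prob_bt_attempts_unbalanced:
  assumes s: "0 < s" "s \<le> n" and small: "16 * (spectral_norm A)\<^sup>2 * real s \<le> (1 / 200) ^ 3 * real n"
  shows "measure_pmf.prob (bt_attempts S k A s \<tau>\<^sub>0) {(\<tau>, c). \<not> balanced A s \<tau>} \<le> (1 / 2) ^ k"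
proof (induction k)
  case (Suc k)
  let ?X = "{(\<tau>, c). \<not> balanced A s \<tau>}"
  let ?f = "\<lambda>(\<tau>, c). let c' = c + test_ops S (column_submatrix A \<tau>) in
     if cond_number (column_submatrix A \<tau>) \<le> ennreal (sqrt 3)
     then return_pmf (\<tau>, c')
     else map_pmf (\<lambda>(\<tau>', c''). (\<tau>', c' + c'')) (bt_attempts S k A s \<tau>\<^sub>0)"
  have "measure_pmf.prob (bind_pmf (cond_reduce S A s) ?f) ?X
      \<le> measure_pmf.prob (cond_reduce S A s) ?X * (1 / 2) ^ k + 0"
  proof (rule prob_bind_pmf_le)
    fix x assume x: "x \<in> set_pmf (cond_reduce S A s)"
    obtain \<tau> c where xp: "x = (\<tau>, c)" by (cases x)
    note supp = cond_reduce_support[OF s x[unfolded xp]]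
    { assume "x \<in> ?X"
      then have "\<not> cond_number (column_submatrix A \<tau>) \<le> ennreal (sqrt 3)"
        using supp by (auto simp: xp balanced_def)
      then have "measure_pmf.prob (?f x) ?X
          = measure_pmf.prob (bt_attempts S k A s \<tau>\<^sub>0) ((\<lambda>(\<tau>', c''). (\<tau>', c + test_ops S (column_submatrix A \<tau>) + c'')) -` ?X)"
        by (simp add: xp Let_def)
      also have "(\<lambda>(\<tau>', c''). (\<tau>', c + test_ops S (column_submatrix A \<tau>) + c'')) -` ?X = ?X" by auto
      finally show "measure_pmf.prob (?f x) ?X \<le> (1 / 2) ^ k + 0" using Suc by simp }
    { assume "x \<notin> ?X"
      then have "cond_number (column_submatrix A \<tau>) \<le> ennreal (sqrt 3)" "balanced A s \<tau>"
        by (auto simp: xp balanced_def)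
      then show "measure_pmf.prob (?f x) ?X \<le> 0" by (simp add: xp Let_def measure_return_pmf indicator_def) }
  qed auto
  also have "\<dots> \<le> 1 / 2 * (1 / 2) ^ k"
    using prob_cond_reduce_unbalanced[OF s small] by (simp add: mult_right_mono)
  finally show ?case by simp
qed simp

definition rounds_from :: "nat \<Rightarrow> nat list" where
  "rounds_from j = filter (\<lambda>s. s \<le> n) (map (\<lambda>j. 2 ^ j) [j..<Suc n])"

lemma rounds_from_rec:
  "rounds_from j = (if 2 ^ j \<le> n then 2 ^ j # rounds_from (Suc j) else [])"
proof (cases "2 ^ j \<le> n")
  case True
  then have "j < Suc n" using less_exp[of j] by linarith
  then have "[j..<Suc n] = j # [Suc j..<Suc n]" by (rule upt_conv_Cons)
  with True show ?thesis by (simp add: rounds_from_def)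
next
  case False
  have "\<not> 2 ^ i \<le> n" if "j \<le> i" for i
  proof -
    have "(2::nat) ^ j \<le> 2 ^ i" using that by (intro power_increasing) auto
    with False show ?thesis by linarith
  qed
  with False show ?thesis by (auto simp: rounds_from_def filter_empty_conv)
qed

abbreviation attempts_cost :: "real \<Rightarrow> real" where
  "attempts_cost s \<equiv> 32 * K * round_cost m (Suc p) s"

lemma bt_rounds_Cons_power:
  "bt_rounds S A (2 ^ j # ss) \<tau>\<^sub>0 = bind_pmf (bt_attempts S (8 * j) A (2 ^ j) \<tau>\<^sub>0)
     (\<lambda>(\<tau>, c). if real (card \<tau>) < 2 ^ j / 2 then return_pmf (\<tau>, c)
       else map_pmf (\<lambda>(\<tau>', c'). (\<tau>', c + c')) (bt_rounds S A ss \<tau>))"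
proof -
  have "log 2 (real (2 ^ j)) = real j" by (simp add: log_nat_power)
  then have "8 * log 2 (real (2 ^ j)) = of_int (int (8 * j))" by simp
  then have "nat \<lfloor>8 * log 2 (real (2 ^ j))\<rfloor> = 8 * j" by (simp only: floor_of_int nat_int)
  then show ?thesis by simp
qed

lemma attempts_power_support:
  assumes "2 ^ j \<le> n" "(\<tau>, c) \<in> set_pmf (bt_attempts S (8 * j) A (2 ^ j) \<tau>\<^sub>0)"
  shows "\<tau> = \<tau>\<^sub>0 \<or> balanced A (2 ^ j) \<tau>" "real c \<le> attempts_cost (2 ^ j)"
proof -
  note supp = bt_attempts_support[OF _ assms(1,2)]
  show "\<tau> = \<tau>\<^sub>0 \<or> balanced A (2 ^ j) \<tau>" using supp by simp
  have "real c \<le> real (8 * j) * (4 * K * round_cost m p (2 ^ j))" using supp by simp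
  also have "\<dots> = 32 * K * round_cost m p (2 ^ j) * real j" by simp
  also have "\<dots> \<le> 32 * K * round_cost m p (2 ^ j) * (1 + log 2 (2 ^ j))"
    using K_nonneg by (intro mult_left_mono mult_nonneg_nonneg round_cost_nonneg) (auto simp: log_nat_power)
  also have "\<dots> = attempts_cost (2 ^ j)" by (simp add: round_cost_def mult_ac)
  finally show "real c \<le> attempts_cost (2 ^ j)" .
qed

text \<open>The invariant \<open>2 ^ j / 4 \<le> card \<tau>\<^sub>0\<close> holds before the round with \<open>s = 2 ^ j\<close> because the previous round,
  with \<open>s / 2\<close>, was left without exit; before the first round both sides are
  \<open>1\<close>.  As round costs at least double from round to round, subtracting the cost of the
  current round from twice the final bound telescopes.\<close>

lemma bt_rounds_support:
  assumes "valid \<tau>\<^sub>0" "2 ^ j / 4 \<le> real (card \<tau>\<^sub>0)" "(\<tau>, N) \<in> set_pmf (bt_rounds S A (rounds_from j) \<tau>\<^sub>0)"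
  shows "valid \<tau> \<and> 2 ^ j / 4 \<le> real (card \<tau>) \<and>
    real N \<le> 2 * attempts_cost (4 * real (card \<tau>)) - attempts_cost (2 ^ j)"
  using assms
proof (induction "Suc n - j" arbitrary: j \<tau>\<^sub>0 \<tau> N rule: less_induct)
  case less
  have cost: "attempts_cost (2 ^ j) \<le> attempts_cost (4 * real (card \<tau>'))" if "2 ^ j / 4 \<le> real (card \<tau>')" for \<tau>'
    using that K_nonneg by (intro mult_left_mono round_cost_mono) auto
  have cost0: "0 \<le> attempts_cost (2 ^ j)"
    using K_nonneg by (intro mult_nonneg_nonneg round_cost_nonneg) auto
  show ?case
  proof (cases "2 ^ j \<le> n")
    case False
    then have "\<tau> = \<tau>\<^sub>0" "N = 0" using less.prems(3) rounds_from_rec[of j] by auto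
    then show ?thesis using less.prems(1,2) cost[OF less.prems(2)] cost0 by auto
  next
    case True
    then have jn: "j < Suc n" using less_exp[of j] by linarith
    obtain \<tau>1 c where 1: "(\<tau>1, c) \<in> set_pmf (bt_attempts S (8 * j) A (2 ^ j) \<tau>\<^sub>0)"
      and 2: "(\<tau>, N) \<in> set_pmf (if real (card \<tau>1) < 2 ^ j / 2 then return_pmf (\<tau>1, c)
       else map_pmf (\<lambda>(\<tau>', c'). (\<tau>', c + c')) (bt_rounds S A (rounds_from (Suc j)) \<tau>1))"
      using less.prems(3) True unfolding rounds_from_rec[of j] if_P[OF True] bt_rounds_Cons_power by auto
    note supp = attempts_power_support[OF True 1]
    have valid1: "valid \<tau>1" using supp(1) less.prems(1) by (auto simp: valid_def balanced_def)
    show ?thesis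
    proof (cases "real (card \<tau>1) < 2 ^ j / 2")
      case exit: True
      then have "\<tau>1 = \<tau>\<^sub>0" using supp(1) by (auto simp: balanced_def)
      moreover have "\<tau> = \<tau>1" "N = c" using 2 exit by auto
      ultimately show ?thesis using less.prems(1,2) cost[OF less.prems(2)] supp(2) by auto
    next
      case False
      then obtain c' where 3: "(\<tau>, c') \<in> set_pmf (bt_rounds S A (rounds_from (Suc j)) \<tau>1)" and N: "N = c + c'"
        using 2 by auto
      have card1: "2 ^ Suc j / 4 \<le> real (card \<tau>1)" using False by simp
      have IH: "valid \<tau> \<and> 2 ^ Suc j / 4 \<le> real (card \<tau>) \<and>
          real c' \<le> 2 * attempts_cost (4 * real (card \<tau>)) - attempts_cost (2 ^ Suc j)"
        by (rule less.hyps[OF _ valid1 card1 3]) (use jn in auto)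
      have "2 * attempts_cost (2 ^ j) \<le> attempts_cost (2 ^ Suc j)"
      proof -
        have "32 * K * (2 * round_cost m (Suc p) (2 ^ j)) \<le> 32 * K * round_cost m (Suc p) (2 * 2 ^ j)"
          using K_nonneg by (intro mult_left_mono round_cost_double) auto
        then show ?thesis by simp
      qed
      moreover have "2 ^ j / 4 \<le> (2 ^ Suc j / 4 :: real)" by simp
      ultimately show ?thesis using IH supp(2) unfolding N of_nat_add by linarith
    qed
  qed
qed

text \<open>The largest \<open>s\<close> to which the probability bound for the reduction step applies, as a real number.
  It is a constant multiple of the stable rank.\<close>

definition reachable_size :: real where
  "reachable_size = (1 / 200) ^ 3 * real n / (16 * (spectral_norm A)\<^sup>2)"

lemma reachable_size_le: "reachable_size \<le> real n"
  and small_if_reachable: "real s \<le> reachable_size \<Longrightarrow> 16 * (spectral_norm A)\<^sup>2 * real s \<le> (1 / 200) ^ 3 * real n"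
proof -
  have k: "1 \<le> (spectral_norm A)\<^sup>2" by (rule spectral_norm_ge_1[OF A n_pos])
  then show "16 * (spectral_norm A)\<^sup>2 * real s \<le> (1 / 200) ^ 3 * real n" if "real s \<le> reachable_size"
  proof -
    have "0 < 16 * (spectral_norm A)\<^sup>2" using k by linarith
    from pos_le_divide_eq[OF this] that show ?thesis
      unfolding reachable_size_def by (simp only: mult.commute[of "real s"])
  qed
  have "(1 / 200) ^ 3 * real n \<le> 16 * 1 * real n" by (simp add: power3_eq_cube)
  also have "\<dots> \<le> 16 * (spectral_norm A)\<^sup>2 * real n" using k by (intro mult_right_mono mult_left_mono) auto
  finally have "(1 / 200) ^ 3 * real n \<le> real n * (16 * (spectral_norm A)\<^sup>2)" by (simp only: mult_ac)
  moreover have "0 < 16 * (spectral_norm A)\<^sup>2" using k by linarith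
  ultimately show "reachable_size \<le> real n" unfolding reachable_size_def by (simp only: pos_divide_le_eq)
qed

text \<open>A round with \<open>s = 2 ^ j\<close> within the reachable size fails with probability at most
  \<open>(1 / 2) ^ (8 * j)\<close>, and the tail of this geometric series is at most twice its first term.  Once \<open>s\<close>
  exceeds the reachable size, the invariant alone makes the current set large enough.\<close>

lemma prob_bt_rounds_small:
  assumes "valid \<tau>\<^sub>0" "2 ^ j / 4 \<le> real (card \<tau>\<^sub>0)"
  shows "measure_pmf.prob (bt_rounds S A (rounds_from j) \<tau>\<^sub>0) {(\<tau>, N). real (card \<tau>) < reachable_size / 4}
    \<le> 2 * (1 / 2) ^ (8 * j)"
  using assms
proof (induction "Suc n - j" arbitrary: j \<tau>\<^sub>0 rule: less_induct)
  case less
  let ?X = "{(\<tau>, N). real (card \<tau>) < reachable_size / 4}"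
  show ?case
  proof (cases "2 ^ j \<le> reachable_size")
    case False
    have "measure_pmf.prob (bt_rounds S A (rounds_from j) \<tau>\<^sub>0) ?X = 0"
    proof -
      have "set_pmf (bt_rounds S A (rounds_from j) \<tau>\<^sub>0) \<inter> ?X = {}"
        using bt_rounds_support[OF less.prems] False by fastforce
      then show ?thesis by (simp add: measure_pmf_zero_iff)
    qed
    then show ?thesis by simp
  next
    case True
    then have "2 ^ j \<le> real n" using reachable_size_le by linarith
    then have jn: "2 ^ j \<le> n" by (simp flip: of_nat_le_iff)
    then have j: "j < Suc n" using less_exp[of j] by linarith
    have small: "16 * (spectral_norm A)\<^sup>2 * real (2 ^ j) \<le> (1 / 200) ^ 3 * real n"
      by (rule small_if_reachable) (use True in simp)
    let ?U = "{(\<tau>, c). \<not> balanced A (2 ^ j) \<tau>}"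
    let ?f = "\<lambda>(\<tau>, c). if real (card \<tau>) < 2 ^ j / 2 then return_pmf (\<tau>, c)
       else map_pmf (\<lambda>(\<tau>', c'). (\<tau>', c + c')) (bt_rounds S A (rounds_from (Suc j)) \<tau>)"
    have "measure_pmf.prob (bind_pmf (bt_attempts S (8 * j) A (2 ^ j) \<tau>\<^sub>0) ?f) ?X
        \<le> measure_pmf.prob (bt_attempts S (8 * j) A (2 ^ j) \<tau>\<^sub>0) ?U * 1 + 2 * (1 / 2) ^ (8 * Suc j)"
    proof (rule prob_bind_pmf_le)
      fix x assume "x \<in> set_pmf (bt_attempts S (8 * j) A (2 ^ j) \<tau>\<^sub>0)"
      show "measure_pmf.prob (?f x) ?X \<le> 1 + 2 * (1 / 2) ^ (8 * Suc j)"
        using measure_pmf.prob_le_1[of "?f x" ?X] by (rule order_trans) simp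
      assume "x \<notin> ?U"
      then obtain \<tau> c where x: "x = (\<tau>, c)" and bal: "balanced A (2 ^ j) \<tau>" by auto
      have card: "2 ^ Suc j / 4 \<le> real (card \<tau>)" and val: "valid \<tau>"
        using bal by (auto simp: balanced_def valid_def)
      then have "measure_pmf.prob (?f x) ?X = measure_pmf.prob (bt_rounds S A (rounds_from (Suc j)) \<tau>)
          ((\<lambda>(\<tau>', c'). (\<tau>', c + c')) -` ?X)"
        by (simp add: x)
      also have "(\<lambda>(\<tau>', c'). (\<tau>', c + c')) -` ?X = ?X" by auto
      also have "measure_pmf.prob (bt_rounds S A (rounds_from (Suc j)) \<tau>) ?X \<le> 2 * (1 / 2) ^ (8 * Suc j)"
        by (rule less.hyps[OF _ val card]) (use j in auto)
      finally show "measure_pmf.prob (?f x) ?X \<le> 2 * (1 / 2) ^ (8 * Suc j)" .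
    qed auto
    also have "\<dots> \<le> (1 / 2) ^ (8 * j) + 2 * (1 / 2) ^ (8 * Suc j)"
      using prob_bt_attempts_unbalanced[OF _ jn small, of "8 * j" \<tau>\<^sub>0] by simp
    also have "\<dots> \<le> 2 * (1 / 2) ^ (8 * j)"
    proof -
      have "8 * Suc j = 8 * j + 8" by simp
      then have "(1 / 2 :: real) ^ (8 * Suc j) = (1 / 2) ^ (8 * j) * (1 / 2) ^ 8" by (simp only: power_add)
      also have "(1 / 2 :: real) ^ 8 = 1 / 256" by (simp add: power_divide)
      finally have "(1 / 2 :: real) ^ (8 * Suc j) = (1 / 2) ^ (8 * j) * (1 / 256)" .
      moreover have "0 \<le> (1 / 2 :: real) ^ (8 * j)" by simp
      ultimately show ?thesis by linarith
    qed
    finally show ?thesis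
      unfolding rounds_from_rec[of j] if_P[OF jn] bt_rounds_Cons_power .
  qed
qed

lemma valid_singleton: "valid {0}"
proof -
  have sub: "{0} \<subseteq> {..<n}" using n_pos by simp
  have "qform {0} (gram A) x = wnorm {0} (\<lambda>_. 1) x" for x
    using gram_diag[OF A n_pos] re_conjugate_self[of "x 0"]
    by (simp add: qform_def sesq_def kapply_def wnorm_def)
  then have "cond_number (column_submatrix A {0}) \<le> ennreal (sqrt 3)"
    by (intro cond_number_le_sqrt3[OF sub]) (simp add: wnorm_nonneg)
  with sub show ?thesis by (simp add: valid_def)
qed

lemma algorithm_BT_rounds: "algorithm_BT S A = bt_rounds S A (rounds_from 2) {0}"
  unfolding algorithm_BT_def rounds_from_def ..

lemma algorithm_BT_success:
  "3 / 4 \<le> measure_pmf.prob (algorithm_BT S A)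
    {(\<tau>, N). \<tau> \<subseteq> {..<n} \<and> (1 / 200) ^ 3 / 64 * stable_rank A \<le> real (card \<tau>) \<and>
             cond_number (column_submatrix A \<tau>) \<le> ennreal (sqrt 3)}" (is "_ \<le> measure_pmf.prob _ ?Good")
proof -
  let ?p = "algorithm_BT S A"
  let ?X = "{(\<tau>, N). real (card \<tau>) < reachable_size / 4}"
  have size: "(1 / 200) ^ 3 / 64 * stable_rank A = reachable_size / 4"
    unfolding stable_rank_standardized[OF A] reachable_size_def by simp
  have "measure_pmf.prob ?p ?X \<le> 2 * (1 / 2) ^ (8 * 2)"
    unfolding algorithm_BT_rounds by (rule prob_bt_rounds_small[OF valid_singleton]) simp
  also have "\<dots> \<le> (1 / 4 :: real)" by (simp add: power_divide)
  finally have "3 / 4 \<le> 1 - measure_pmf.prob ?p ?X" by simp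
  also have "\<dots> = measure_pmf.prob ?p (- ?X)"
    using measure_pmf.prob_compl[of ?X ?p] by (simp add: Compl_eq_Diff_UNIV)
  also have "\<dots> = measure_pmf.prob ?p (- ?X \<inter> set_pmf ?p)" by (rule measure_Int_set_pmf[symmetric])
  also have "\<dots> \<le> measure_pmf.prob ?p ?Good"
  proof (rule measure_pmf.finite_measure_mono)
    show "- ?X \<inter> set_pmf ?p \<subseteq> ?Good"
    proof
      fix x assume x: "x \<in> - ?X \<inter> set_pmf ?p"
      obtain \<tau> N where xp: "x = (\<tau>, N)" by (cases x)
      have "valid \<tau>"
        using bt_rounds_support[OF valid_singleton, of 2 \<tau> N] x by (simp add: xp algorithm_BT_rounds)
      then show "x \<in> ?Good" using x unfolding xp size by (auto simp: valid_def not_less)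
    qed
  qed simp
  finally show ?thesis .
qed

lemma algorithm_BT_cost:
  assumes "(\<tau>, N) \<in> set_pmf (algorithm_BT S A)"
  shows "real N \<le> (64 * 128 * 3 ^ Suc p * K) * ((real (card \<tau>))\<^sup>2 * m + real (card \<tau>) powr (7 / 2))
    * (1 + log 2 (real (card \<tau>))) ^ Suc p"
proof -
  have supp: "1 \<le> real (card \<tau>)" "real N \<le> 2 * attempts_cost (4 * real (card \<tau>)) - attempts_cost (2 ^ 2)"
    using bt_rounds_support[OF valid_singleton, of 2 \<tau> N] assms by (simp_all add: algorithm_BT_rounds)
  have "0 \<le> attempts_cost (2 ^ 2)"
    using K_nonneg by (intro mult_nonneg_nonneg round_cost_nonneg) auto
  with supp(2) have "real N \<le> 64 * K * round_cost m (Suc p) (4 * real (card \<tau>))" by linarith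
  also have "\<dots> \<le> 64 * K * (128 * 3 ^ Suc p * round_cost m (Suc p) (real (card \<tau>)))"
    using K_nonneg supp(1) by (intro mult_left_mono round_cost_quadruple) auto
  finally show ?thesis unfolding round_cost_def by (simp only: mult_ac)
qed

end

lemma algorithm_BT_correct:
  fixes A :: "'a::rc_scalar mat" and S :: "'a bt_steps"
  assumes "1 \<le> n" "A \<in> carrier_mat m n" "standardized A" "solver_accuracy (1 / 8) S" "step_costs K p S"
  shows "3 / 4 \<le> measure_pmf.prob (algorithm_BT S A)
            {(\<tau>, N). \<tau> \<subseteq> {..<n} \<and> (1 / 200) ^ 3 / 64 * stable_rank A \<le> real (card \<tau>) \<and>
                     cond_number (column_submatrix A \<tau>) \<le> ennreal (sqrt 3)} \<and>
          (\<forall>(\<tau>, N) \<in> set_pmf (algorithm_BT S A).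
             real N \<le> (64 * 128 * 3 ^ Suc p * K) * ((real (card \<tau>))\<^sup>2 * real m + real (card \<tau>) powr (7 / 2))
                        * (1 + log 2 (real (card \<tau>))) ^ Suc p)"
proof -
  have dims: "dim_row A = m" "dim_col A = n" using assms(2) by auto
  interpret bt_run A S K p by unfold_locales (use assms dims in auto)
  show ?thesis using algorithm_BT_success algorithm_BT_cost unfolding dims by blast
qed

theorem theorem5p7:
  "\<exists>c > (0::real). \<exists>\<epsilon> > (0::real). \<forall>(K::real) (p::nat). \<exists>(C::real) (q::nat).
     (\<forall>(m::nat) (n::nat) (A :: complex mat) (S :: complex bt_steps).
        1 \<le> n \<and> A \<in> carrier_mat m n \<and> standardized A \<and> solver_accuracy \<epsilon> S \<and> step_costs K p S \<longrightarrow>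
          measure_pmf.prob (algorithm_BT S A)
            {(\<tau>, N). \<tau> \<subseteq> {..<n} \<and> c * stable_rank A \<le> real (card \<tau>) \<and>
                     cond_number (column_submatrix A \<tau>) \<le> ennreal (sqrt 3)} \<ge> 3 / 4 \<and>
          (\<forall>(\<tau>, N) \<in> set_pmf (algorithm_BT S A).
             real N \<le> C * ((real (card \<tau>))\<^sup>2 * real m + real (card \<tau>) powr (7 / 2))
                        * (1 + log 2 (real (card \<tau>))) ^ q)) \<and>
     (\<forall>(m::nat) (n::nat) (A :: real mat) (S :: real bt_steps).
        1 \<le> n \<and> A \<in> carrier_mat m n \<and> standardized A \<and> solver_accuracy \<epsilon> S \<and> step_costs K p S \<longrightarrow>
          measure_pmf.prob (algorithm_BT S A)
            {(\<tau>, N). \<tau> \<subseteq> {..<n} \<and> c * stable_rank A \<le> real (card \<tau>) \<and>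
                     cond_number (column_submatrix A \<tau>) \<le> ennreal (sqrt 3)} \<ge> 3 / 4 \<and>
          (\<forall>(\<tau>, N) \<in> set_pmf (algorithm_BT S A).
             real N \<le> C * ((real (card \<tau>))\<^sup>2 * real m + real (card \<tau>) powr (7 / 2))
                        * (1 + log 2 (real (card \<tau>))) ^ q))"
proof (intro exI conjI allI impI)
  show "0 < ((1 / 200) ^ 3 / 64 :: real)" "0 < (1 / 8 :: real)" by auto
qed (elim conjE, rule algorithm_BT_correct[THEN conjunct1] algorithm_BT_correct[THEN conjunct2]; assumption)+

end
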